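(* The following problem is NP-complete: given a binary matrix $M$ and an integer $k\ge0$, decide whether there exist a set $R'$ of rows and a set $C'$ of columns of $M$ with $|R'|+|C'|\le k$ such that the matrix obtained from $M$ by deleting the rows in $R'$ and the columns in $C'$ has the simultaneous consecutive ones property.
   Context: A binary matrix has the consecutive ones property (C1P) for rows if its columns can be permuted so that in every row the $1$-entries occur consecutively; it has the C1P for columns if its rows can be permuted so that in every column the $1$-entries occur consecutively. It has the simultaneous consecutive ones property (SC1P) if it has both. *)

theory Defs
  imports
    "HOL-Combinatorics.Permutations"
    "HOL-Computational_Algebra.Polynomial"
    "Jordan_Normal_Form.DL_Submatrix"
begin

section \<open>Deterministic multi-tape Turing machines\<close>

text \<open>
  A machine has \<open>num_tapes\<close> two-way infinite tapes. Its tape symbols are the numbers below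
  \<open>num_symbols\<close>: 0 is the blank, 1 and 2 are the input/output bits 0 and 1, and any
  further symbols are work symbols. Its working states are the numbers below \<open>num_states\<close>;
  the start state is 0 and the unique halting state is the number \<open>num_states\<close> itself.
  From a working state and the list of scanned symbols, the transition function gives the next
  state and, for each tape, the symbol to write and the head move.
\<close>

datatype move = Left | Stay | Right

record machine =
  num_tapes :: nat
  num_symbols :: nat
  num_states :: nat
  transition :: "nat \<Rightarrow> nat list \<Rightarrow> nat \<times> (nat \<times> move) list"

definition turing_machine :: "machine \<Rightarrow> bool" where
  "turing_machine M \<longleftrightarrow>
     2 \<le> num_tapes M \<and> 3 \<le> num_symbols M \<and>
     (\<forall>q ss. q < num_states M \<longrightarrow> length ss = num_tapes M \<longrightarrow> set ss \<subseteq> {..<num_symbols M} \<longrightarrow>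
       (case transition M q ss of (q', acts) \<Rightarrow>
          q' \<le> num_states M \<and> length acts = num_tapes M \<and>
          fst ` set acts \<subseteq> {..<num_symbols M}))"

text \<open>A tape is given by its contents and the position of its head.\<close>

type_synonym tape = "(int \<Rightarrow> nat) \<times> int"
type_synonym config = "nat \<times> tape list"

fun offset :: "move \<Rightarrow> int" where
  "offset Left = -1"
| "offset Stay = 0"
| "offset Right = 1"

definition act :: "nat \<times> move \<Rightarrow> tape \<Rightarrow> tape" where
  "act = (\<lambda>(s, d) (c, h). (c(h := s), h + offset d))"

definition step :: "machine \<Rightarrow> config \<Rightarrow> config" where
  "step M = (\<lambda>(q, ts).
     if q < num_states M then
       (case transition M q (map (\<lambda>(c, h). c h) ts) of (q', acts) \<Rightarrow> (q', map2 act acts ts))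
     else (q, ts))"

definition bit_symbol :: "bool \<Rightarrow> nat" where
  "bit_symbol b = (if b then 2 else 1)"

text \<open>The contents of a tape that holds \<open>x\<close> from cell 0 on and is blank elsewhere.\<close>

definition contents :: "bool list \<Rightarrow> int \<Rightarrow> nat" where
  "contents x i = (if 0 \<le> i \<and> i < int (length x) then bit_symbol (x ! nat i) else 0)"

definition start_config :: "machine \<Rightarrow> bool list \<Rightarrow> config" where
  "start_config M x = (0, (contents x, 0) # replicate (num_tapes M - 1) (contents [], 0))"

text \<open>The input is on tape 0, the output on tape 1. A halted configuration never changes.\<close>

definition halts_with_output :: "machine \<Rightarrow> bool list \<Rightarrow> nat \<Rightarrow> bool list \<Rightarrow> bool" where
  "halts_with_output M x t y \<longleftrightarrow>
     (case (step M ^^ t) (start_config M x) of (q, ts) \<Rightarrow>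
        q = num_states M \<and> fst (ts ! 1) = contents y)"


section \<open>Polynomial time, NP, and NP-completeness\<close>

type_synonym language = "bool list set"

definition polytime_computable :: "(bool list \<Rightarrow> bool list) \<Rightarrow> bool" where
  "polytime_computable f \<longleftrightarrow>
     (\<exists>M (p :: nat poly). turing_machine M \<and>
        (\<forall>x. \<exists>t \<le> poly p (length x). halts_with_output M x t (f x)))"

definition polytime_decidable :: "language \<Rightarrow> bool" where
  "polytime_decidable L \<longleftrightarrow> polytime_computable (\<lambda>x. [x \<in> L])"

text \<open>Self-delimiting code of a bit string: every bit is announced by a 1, the end by a 0.\<close>

definition delimit :: "bool list \<Rightarrow> bool list" where
  "delimit x = concat (map (\<lambda>b. [True, b]) x) @ [False]"

definition pair_code :: "bool list \<Rightarrow> bool list \<Rightarrow> bool list" where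
  "pair_code x u = delimit x @ u"

text \<open>A language is in NP if membership has certificates of polynomial length that can be
  verified in polynomial time.\<close>

definition in_NP :: "language \<Rightarrow> bool" where
  "in_NP L \<longleftrightarrow>
     (\<exists>V (p :: nat poly). polytime_decidable V \<and>
        (\<forall>x. x \<in> L \<longleftrightarrow> (\<exists>u. length u \<le> poly p (length x) \<and> pair_code x u \<in> V)))"

definition polytime_reducible :: "language \<Rightarrow> language \<Rightarrow> bool" where
  "polytime_reducible L L' \<longleftrightarrow>
     (\<exists>f. polytime_computable f \<and> (\<forall>x. x \<in> L \<longleftrightarrow> f x \<in> L'))"

definition NP_complete :: "language \<Rightarrow> bool" where
  "NP_complete L \<longleftrightarrow> in_NP L \<and> (\<forall>L'. in_NP L' \<longrightarrow> polytime_reducible L' L)"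


section \<open>The simultaneous consecutive ones property\<close>

text \<open>
  Binary matrices are matrices over \<open>bool\<close>, with \<open>True\<close> as 1. A permutation \<open>\<pi>\<close> of the columns
  puts column \<open>\<pi> j\<close> at position \<open>j\<close>. The interval \<open>{a..<b}\<close> is empty for a row without ones.
\<close>

definition C1P_rows :: "bool mat \<Rightarrow> bool" where
  "C1P_rows A \<longleftrightarrow>
     (\<exists>\<pi>. \<pi> permutes {..<dim_col A} \<and>
        (\<forall>i<dim_row A. \<exists>a b. {j. j < dim_col A \<and> A $$ (i, \<pi> j)} = {a..<b}))"

definition C1P_cols :: "bool mat \<Rightarrow> bool" where
  "C1P_cols A \<longleftrightarrow>
     (\<exists>\<pi>. \<pi> permutes {..<dim_row A} \<and>
        (\<forall>j<dim_col A. \<exists>a b. {i. i < dim_row A \<and> A $$ (\<pi> i, j)} = {a..<b}))"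

definition SC1P :: "bool mat \<Rightarrow> bool" where
  "SC1P A \<longleftrightarrow> C1P_rows A \<and> C1P_cols A"

text \<open>\<open>submatrix A I J\<close> keeps the rows in \<open>I\<close> and the columns in \<open>J\<close>.\<close>

definition delete_rows_cols :: "bool mat \<Rightarrow> nat set \<Rightarrow> nat set \<Rightarrow> bool mat" where
  "delete_rows_cols A R C = submatrix A (- R) (- C)"

definition SC1P_deletion :: "bool mat \<Rightarrow> nat \<Rightarrow> bool" where
  "SC1P_deletion A k \<longleftrightarrow>
     (\<exists>R C. R \<subseteq> {..<dim_row A} \<and> C \<subseteq> {..<dim_col A} \<and> card R + card C \<le> k \<and>
        SC1P (delete_rows_cols A R C))"


section \<open>Instances as bit strings\<close>

text \<open>Binary representation, least significant bit first.\<close>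

fun binary :: "nat \<Rightarrow> bool list" where
  "binary n = (if n = 0 then [] else odd n # binary (n div 2))"

declare binary.simps [simp del]

text \<open>The dimensions are given in unary, then the rows one by one, then the budget in binary.\<close>

definition encode_instance :: "bool mat \<Rightarrow> nat \<Rightarrow> bool list" where
  "encode_instance A k =
     delimit (replicate (dim_row A) True) @ delimit (replicate (dim_col A) True) @
     concat (map delimit (mat_to_list A)) @ delimit (binary k)"

definition SC1P_deletion_language :: language where
  "SC1P_deletion_language = {encode_instance A k | A k. SC1P_deletion A k}"

text \<open>The encoding is injective, so the language identifies no two instances.\<close>

lemma delimit_append_inject: "delimit x @ u = delimit y @ v \<longleftrightarrow> x = y \<and> u = v"
proof (induction x arbitrary: y)
  case Nil
  show ?case by (cases y) (auto simp: delimit_def)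
next
  case (Cons b x)
  show ?case
  proof (cases y)
    case (Cons c y')
    then show ?thesis using Cons.IH[of y'] by (auto simp: delimit_def)
  qed (auto simp: delimit_def)
qed

lemma concat_delimit_inject:
  "length xs = length ys \<Longrightarrow>
   concat (map delimit xs) @ u = concat (map delimit ys) @ v \<longleftrightarrow> xs = ys \<and> u = v"
  by (induction xs ys rule: list_induct2) (auto simp: delimit_append_inject)

lemma binary_inject: "binary m = binary n \<longleftrightarrow> m = n"
proof (induction m arbitrary: n rule: less_induct)
  case (less m)
  show ?case
  proof (cases "m = 0 \<or> n = 0")
    case True
    then show ?thesis by (subst (1 2) binary.simps) auto
  next
    case False
    then have "binary m = binary n \<longleftrightarrow> (odd m \<longleftrightarrow> odd n) \<and> m div 2 = n div 2"
      using less.IH[of "m div 2" "n div 2"] by (subst (1 2) binary.simps) auto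
    also have "\<dots> \<longleftrightarrow> m = n" by (metis bit_eq_rec)
    finally show ?thesis .
  qed
qed

lemma mat_to_list_inject:
  assumes "dim_row A = dim_row B" "dim_col A = dim_col B" "mat_to_list A = mat_to_list B"
  shows "A = B"
proof (rule eq_matI)
  fix i j assume "i < dim_row B" "j < dim_col B"
  then show "A $$ (i, j) = B $$ (i, j)"
    using assms(1,2) arg_cong[OF assms(3), of "\<lambda>xss. xss ! i ! j"] by (simp add: mat_to_list_def)
qed (use assms in auto)

lemma encode_instance_inject: "encode_instance A k = encode_instance B l \<longleftrightarrow> A = B \<and> k = l"
proof
  assume eq: "encode_instance A k = encode_instance B l"
  have dims: "dim_row A = dim_row B" "dim_col A = dim_col B"
    using eq by (auto simp: encode_instance_def delimit_append_inject)
  then have len: "length (mat_to_list A) = length (mat_to_list B)"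
    by (simp add: mat_to_list_def)
  from eq dims have "mat_to_list A = mat_to_list B" "delimit (binary k) = delimit (binary l)"
    by (auto simp: encode_instance_def delimit_append_inject concat_delimit_inject[OF len])
  then show "A = B \<and> k = l"
    using mat_to_list_inject[OF dims] delimit_append_inject[of "binary k" "[]" "binary l" "[]"]
    by (simp add: binary_inject)
qed simp

end

theory Submission
  imports Defs
begin

text \<open>
  Hardness is a direct reduction from an arbitrary NP language in two steps. The computation of a verifier is
  described by one vertex per time step, carrying the state, the head positions, the scanned symbols and, for
  every tape, a pointer to the last visit of the scanned cell. The pointers make all consistency
  conditions binary, so accepting computations are the large independent sets of a conflict graph. An
  independent set problem turns into the deletion problem by hanging two paths of length 2 on every vertex and
  subdividing every edge: two adjacent surviving vertices would yield a subdivided claw, which is not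
  consecutive, while the stars around an independent set are. Polynomial-time computability is established
  for a small language of stack programs that compiles to Turing machines, and from there for functions on
  encoded data that are closed under composition and size-bounded iteration.
\<close>

section \<open>A stack language and its compilation to Turing machines\<close>

text \<open>An independent set can only forbid pairs, whereas the usual tableau argument constrains
  several neighbouring cells at once. A record therefore holds everything local to one time step,
  and "the head was elsewhere since the linked visit" splits into one inequality per intermediate
  record. The certificate needs no vertices of its own: each of its cells has at most one visit
  without a link, and the symbol recorded there is the guess. The vertices are all candidate
  records, number lists of a length that depends only on the machine, so there are polynomially
  many; since records of equal time conflict, T + 2 independent ones contain exactly one for every
  time up to T + 1. In the matrix each row and column is charged to one vertex, so N - m deletions
  leave m vertices with everything charged to them, while for an independent set of size m it is
  enough to delete the centres of the other N - m vertices. Computability goes through trees on a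
  stack because a program that replaces the top tree and leaves everything below it alone composes
  freely with others.\<close>

datatype com =
    Skip
  | Push nat nat
  | Pop nat
  | Seq com com (infixr ";;" 60)
  | Cond nat nat com com
  | Until nat nat com

type_synonym store = "nat \<Rightarrow> nat list"

text \<open>An empty stack reads as 0, just as the head of its tape sees a blank; programs use this
  as their test for emptiness.\<close>

definition peek :: "nat list \<Rightarrow> nat" where
  "peek l = (case l of [] \<Rightarrow> 0 | s # _ \<Rightarrow> s)"

text \<open>The control state of a running program is its continuation, a list of commands.\<close>

fun control :: "com list \<Rightarrow> (nat \<Rightarrow> nat) \<Rightarrow> com list" where
  "control ((a ;; b) # K) v = a # b # K"
| "control (Cond r s a b # K) v = (if v r = s then a else b) # K"
| "control (Until r s c # K) v = (if v r = s then K else c # Until r s c # K)"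
| "control K v = tl K"

fun effect :: "com list \<Rightarrow> store \<Rightarrow> store" where
  "effect (Push r s # K) \<sigma> = \<sigma>(r := s # \<sigma> r)"
| "effect (Pop r # K) \<sigma> = \<sigma>(r := tl (\<sigma> r))"
| "effect K \<sigma> = \<sigma>"

definition sstep :: "com list \<times> store \<Rightarrow> com list \<times> store" where
  "sstep = (\<lambda>(K, \<sigma>). (control K (\<lambda>r. peek (\<sigma> r)), effect K \<sigma>))"

text \<open>Tape 1 is write-only: it receives the output from left to right.\<close>

fun wf_com :: "com \<Rightarrow> bool" where
  "wf_com Skip \<longleftrightarrow> True"
| "wf_com (Push r s) \<longleftrightarrow> r < 5 \<and> s < 3"
| "wf_com (Pop r) \<longleftrightarrow> r < 5 \<and> r \<noteq> 1"
| "wf_com (a ;; b) \<longleftrightarrow> wf_com a \<and> wf_com b"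
| "wf_com (Cond r s a b) \<longleftrightarrow> r < 5 \<and> r \<noteq> 1 \<and> wf_com a \<and> wf_com b"
| "wf_com (Until r s c) \<longleftrightarrow> r < 5 \<and> r \<noteq> 1 \<and> wf_com c"

text \<open>The continuations through which a run of \<open>c\<close> in front of \<open>K\<close>
  can pass before \<open>K\<close> is reached. Each subcommand has one fixed continuation, so the
  set is finite although loops unfold; this lets continuations serve as machine states.\<close>

fun conts :: "com \<Rightarrow> com list \<Rightarrow> com list set" where
  "conts (a ;; b) K = insert ((a ;; b) # K) (conts a (b # K) \<union> conts b K)"
| "conts (Cond r s a b) K = insert (Cond r s a b # K) (conts a K \<union> conts b K)"
| "conts (Until r s c) K = insert (Until r s c # K) (conts c (Until r s c # K))"
| "conts c K = {c # K}"

lemma finite_conts: "finite (conts c K)"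
  by (induction c arbitrary: K) auto

lemma conts_start: "c # K \<in> conts c K"
  by (cases c) auto

lemma conts_closed: "K' \<in> conts c K \<Longrightarrow> control K' v \<in> insert K (conts c K)"
proof (induction c arbitrary: K)
  case (Seq a b)
  have "a # b # K \<in> conts a (b # K)" "b # K \<in> conts b K" by (rule conts_start)+
  then show ?case using Seq.IH(1)[of "b # K"] Seq.IH(2)[of K] Seq.prems by auto
next
  case (Cond r s a b)
  have "a # K \<in> conts a K" "b # K \<in> conts b K" by (rule conts_start)+
  then show ?case using Cond.IH[of K] Cond.prems by auto
next
  case (Until r s c)
  have "c # Until r s c # K \<in> conts c (Until r s c # K)" by (rule conts_start)
  then show ?case using Until.IH[of "Until r s c # K"] Until.prems by (cases "v r = s") auto
qed auto

lemma conts_wf: "wf_com c \<Longrightarrow> list_all wf_com K \<Longrightarrow> K' \<in> conts c K \<Longrightarrow> list_all wf_com K'"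
proof (induction c arbitrary: K)
  case (Seq a b)
  then show ?case using Seq.IH(1)[of "b # K"] Seq.IH(2)[of K] by auto
next
  case (Until r s c)
  then show ?case using Until.IH[of "Until r s c # K"] by auto
qed auto

text \<open>First half of a step: a push onto a stack tape moves to the blank cell left of the top.
  The output tape grows to the right, writes first and moves afterwards, so it needs no
  preparation.\<close>

fun prepare :: "com list \<Rightarrow> nat \<Rightarrow> move" where
  "prepare (Push r s # K) i = (if i = r \<and> r \<noteq> 1 then Left else Stay)"
| "prepare K i = Stay"

text \<open>A pop erases the top before stepping right, so that all cells outside the stack stay
  blank. Popping an empty stack merely drifts over blanks, in agreement with
  \<open>tl [] = []\<close>.\<close>

fun perform :: "com list \<Rightarrow> nat \<Rightarrow> nat \<Rightarrow> nat \<times> move" where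
  "perform (Push r s # K) i x = (if i = r then (s, if r = 1 then Right else Stay) else (x, Stay))"
| "perform (Pop r # K) i x = (if i = r then (0, Right) else (x, Stay))"
| "perform K i x = (x, Stay)"

text \<open>Every step of the stack machine takes two Turing machine steps, since pushing onto a stack
  that grows to the left moves the head before it writes.\<close>

fun succ_state :: "com list \<times> bool \<Rightarrow> (nat \<Rightarrow> nat) \<Rightarrow> com list \<times> bool" where
  "succ_state (K, ph) v = (if ph then (control K v, False) else (K, True))"

fun actions :: "com list \<times> bool \<Rightarrow> (nat \<Rightarrow> nat) \<Rightarrow> (nat \<times> move) list" where
  "actions (K, ph) v = map (\<lambda>i. if ph then perform K i (v i) else (v i, prepare K i)) [0..<5]"

text \<open>Pairs outside \<open>qs\<close> receive the number of the halting state; in the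
  simulation these are the pairs with the empty continuation.\<close>

definition state_code :: "(com list \<times> bool) list \<Rightarrow> com list \<times> bool \<Rightarrow> nat" where
  "state_code qs s = (if s \<in> set qs then (SOME i. i < length qs \<and> qs ! i = s) else length qs)"

definition stack_machine :: "(com list \<times> bool) list \<Rightarrow> machine" where
  "stack_machine qs = \<lparr>num_tapes = 5, num_symbols = 3, num_states = length qs,
     transition = (\<lambda>q ss. (state_code qs (succ_state (qs ! q) ((!) ss)), actions (qs ! q) ((!) ss)))\<rparr>"

lemma state_code:
  assumes "s \<in> set qs"
  shows "state_code qs s < length qs" "qs ! state_code qs s = s"
proof -
  have "\<exists>i. i < length qs \<and> qs ! i = s" using assms by (auto simp: in_set_conv_nth)
  from someI_ex[OF this] show "state_code qs s < length qs" "qs ! state_code qs s = s"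
    using assms by (auto simp: state_code_def)
qed

lemma state_code_le: "state_code qs s \<le> length qs"
  using state_code(1)[of s qs] by (cases "s \<in> set qs") (auto simp: state_code_def)

lemma turing_machine_stack_machine:
  assumes "\<And>K ph. (K, ph) \<in> set qs \<Longrightarrow> list_all wf_com K"
  shows "turing_machine (stack_machine qs)"
  unfolding turing_machine_def
proof (intro conjI allI impI)
  fix q ss
  assume q: "q < num_states (stack_machine qs)" and len: "length ss = num_tapes (stack_machine qs)"
    and ss: "set ss \<subseteq> {..<num_symbols (stack_machine qs)}"
  obtain K ph where Kph: "qs ! q = (K, ph)" by fastforce
  have "list_all wf_com K"
    using assms[of K ph] q Kph nth_mem[of q qs] by (simp add: stack_machine_def)
  moreover have "ss ! i < 3" if "i < 5" for i
    using subsetD[OF ss, of "ss ! i"] len that by (simp add: stack_machine_def)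
  ultimately have "fst (if ph then perform K i (ss ! i) else (ss ! i, prepare K i)) < 3" if "i < 5" for i
    using that by (cases "(K, i, ss ! i)" rule: perform.cases) auto
  then show "case transition (stack_machine qs) q ss of (q', acts) \<Rightarrow>
      q' \<le> num_states (stack_machine qs) \<and> length acts = num_tapes (stack_machine qs) \<and>
      fst ` set acts \<subseteq> {..<num_symbols (stack_machine qs)}"
    using Kph by (auto simp: stack_machine_def state_code_le)
qed (simp_all add: stack_machine_def)

section \<open>Stores represented on tapes\<close>

definition stack_tape :: "nat list \<Rightarrow> tape \<Rightarrow> bool" where
  "stack_tape l = (\<lambda>(c, h). \<forall>i. c i = (if h \<le> i \<and> i < h + int (length l) then l ! nat (i - h) else 0))"

text \<open>The output has to start at cell 0, so here the head position is fixed, namely at the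
  first blank behind the output. Register 1 lists the latest symbol first, hence
  \<open>rev\<close>.\<close>

definition out_tape :: "nat list \<Rightarrow> tape \<Rightarrow> bool" where
  "out_tape l = (\<lambda>(c, h). h = int (length l) \<and>
     c = (\<lambda>i. if 0 \<le> i \<and> i < int (length l) then rev l ! nat i else 0))"

definition represents :: "store \<Rightarrow> tape list \<Rightarrow> bool" where
  "represents \<sigma> ts \<longleftrightarrow> length ts = 5 \<and>
     (\<forall>i<5. if i = 1 then out_tape (\<sigma> i) (ts ! i) else stack_tape (\<sigma> i) (ts ! i))"

definition scanned :: "tape list \<Rightarrow> nat \<Rightarrow> nat" where
  "scanned ts i = fst (ts ! i) (snd (ts ! i))"

lemma stack_tape_peek: "stack_tape l t \<Longrightarrow> fst t (snd t) = peek l"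
  by (cases t; cases l) (auto simp: stack_tape_def peek_def)

lemma stack_tape_push:
  assumes "stack_tape l t"
  shows "stack_tape (s # l) (act (s, Stay) (act (fst t (snd t), Left) t))"
proof -
  obtain c h where t: "t = (c, h)" by fastforce
  have "(s # l) ! nat (i - (h - 1)) = l ! nat (i - h)" if "h \<le> i" for i
  proof -
    have "nat (i - (h - 1)) = Suc (nat (i - h))" using that by simp
    then show ?thesis by simp
  qed
  then show ?thesis using assms by (auto simp: t act_def stack_tape_def)
qed

lemma stack_tape_pop:
  assumes "stack_tape l t"
  shows "stack_tape (tl l) (act (0, Right) t)"
proof -
  obtain c h where t: "t = (c, h)" by fastforce
  have "tl l ! nat (i - (h + 1)) = l ! nat (i - h)" if "h + 1 \<le> i" "i < h + int (length l)" for i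
  proof -
    have "nat (i - h) = Suc (nat (i - (h + 1)))" using that by simp
    then show ?thesis using that by (simp add: nth_tl)
  qed
  then show ?thesis using assms by (auto simp: t act_def stack_tape_def)
qed

lemma out_tape_push:
  assumes "out_tape l t"
  shows "out_tape (s # l) (act (s, Right) t)"
proof -
  obtain c h where t: "t = (c, h)" by fastforce
  have "(rev l @ [s]) ! nat i = (if i = int (length l) then s else rev l ! nat i)"
    if "0 \<le> i" "i < 1 + int (length l)" for i
    using that by (cases "i = int (length l)") (auto simp: nth_append)
  then show ?thesis using assms by (auto simp: t act_def out_tape_def fun_eq_iff)
qed

lemma act_stay: "act (fst t (snd t), Stay) t = t"
  by (cases t) (simp add: act_def)

text \<open>Register 1 is exempt because the head of the output tape stands behind the output and
  does not scan the top of the register; well-formed programs never test it.\<close>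

lemma control_cong:
  assumes "list_all wf_com K" "\<And>r. r < 5 \<Longrightarrow> r \<noteq> 1 \<Longrightarrow> v r = w r"
  shows "control K v = control K w"
  using assms by (cases "(K, v)" rule: control.cases) auto

lemma stack_machine_step:
  assumes s: "(K, ph) \<in> set qs" and len: "length ts = 5" and wf: "list_all wf_com K"
  shows "step (stack_machine qs) (state_code qs (K, ph), ts) =
    (state_code qs (succ_state (K, ph) (scanned ts)), map2 act (actions (K, ph) (scanned ts)) ts)"
proof -
  have sc: "(\<lambda>(c, h). c h) = (\<lambda>t :: tape. fst t (snd t))" by auto
  have eq: "map (\<lambda>t. fst t (snd t)) ts ! i = scanned ts i" if "i < 5" for i
    using that len by (simp add: scanned_def)
  then have "actions (K, ph) ((!) (map (\<lambda>t. fst t (snd t)) ts)) = actions (K, ph) (scanned ts)"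
    by simp
  moreover have "succ_state (K, ph) ((!) (map (\<lambda>t. fst t (snd t)) ts)) = succ_state (K, ph) (scanned ts)"
    using control_cong[OF wf, of "(!) (map (\<lambda>t. fst t (snd t)) ts)" "scanned ts"] eq by simp
  ultimately show ?thesis
    using state_code[OF s] by (simp add: step_def stack_machine_def sc del: actions.simps succ_state.simps)
qed

lemma represents_scanned:
  assumes "represents \<sigma> ts" "r < 5" "r \<noteq> 1"
  shows "scanned ts r = peek (\<sigma> r)"
  using assms by (auto simp: represents_def scanned_def stack_tape_peek)

lemma two_steps:
  assumes qs: "(K, False) \<in> set qs" "(K, True) \<in> set qs" and wf: "list_all wf_com K" and K: "K \<noteq> []"
    and rep: "represents \<sigma> ts"
  obtains ts' where
    "(step (stack_machine qs) ^^ 2) (state_code qs (K, False), ts) =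
       (state_code qs (control K (\<lambda>r. peek (\<sigma> r)), False), ts')"
    "represents (effect K \<sigma>) ts'"
proof -
  define ts1 where "ts1 = map2 act (actions (K, False) (scanned ts)) ts"
  define ts2 where "ts2 = map2 act (actions (K, True) (scanned ts1)) ts1"
  have len: "length ts = 5" "length ts1 = 5" "length ts2 = 5"
    using rep by (auto simp: represents_def ts1_def ts2_def)
  have ts1: "ts1 ! i = act (scanned ts i, prepare K i) (ts ! i)" if "i < 5" for i
    using that len by (simp add: ts1_def)
  have ts2: "ts2 ! i = act (perform K i (scanned ts1 i)) (ts1 ! i)" if "i < 5" for i
    using that len by (simp add: ts2_def)
  have still: "ts1 ! i = ts ! i" if "i < 5" "prepare K i = Stay" for i
    using ts1[OF that(1)] that(2) act_stay[of "ts ! i"] by (simp add: scanned_def)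
  \<comment> \<open>The successor is computed after the preparatory move. Only a push moves a head
    there, and the successor of a push does not depend on scanned symbols.\<close>
  have ctl: "control K (scanned ts1) = control K (\<lambda>r. peek (\<sigma> r))"
  proof (cases "\<exists>r s K'. K = Push r s # K'")
    case False
    then have "prepare K i = Stay" for i by (cases "(K, i)" rule: prepare.cases) auto
    then have "scanned ts1 r = peek (\<sigma> r)" if "r < 5" "r \<noteq> 1" for r
      using represents_scanned[OF rep that] still[OF that(1)] by (simp add: scanned_def)
    then show ?thesis by (intro control_cong[OF wf]) auto
  qed auto
  have two: "(step (stack_machine qs) ^^ 2) (state_code qs (K, False), ts) =
      (state_code qs (control K (\<lambda>r. peek (\<sigma> r)), False), ts2)"
    using stack_machine_step[OF qs(1) len(1) wf] stack_machine_step[OF qs(2) len(2) wf] ctl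
    by (simp add: numeral_2_eq_2 ts1_def[symmetric] ts2_def[symmetric] del: actions.simps)
  have "if i = 1 then out_tape (effect K \<sigma> i) (ts2 ! i) else stack_tape (effect K \<sigma> i) (ts2 ! i)"
    if i: "i < 5" for i
  proof -
    have tape: "if i = 1 then out_tape (\<sigma> i) (ts ! i) else stack_tape (\<sigma> i) (ts ! i)"
      using rep i by (simp add: represents_def)
    consider (push) r s K' where "K = Push r s # K'" "r = i" 
      | (pop) r K' where "K = Pop r # K'" "r = i" 
      | (other) "effect K \<sigma> i = \<sigma> i" "prepare K i = Stay" "\<And>x. perform K i x = (x, Stay)"
      by (cases "(K, \<sigma>)" rule: effect.cases) fastforce+
    then show ?thesis
    proof cases
      case push
      then show ?thesis
        using tape i still[OF i] out_tape_push[of "\<sigma> i" "ts ! i" s] stack_tape_push[of "\<sigma> i" "ts ! i" s]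
        by (auto simp: ts2 ts1 scanned_def)
    next
      case pop
      then have "i \<noteq> 1" using wf by auto
      then show ?thesis
        using pop tape i still[OF i] stack_tape_pop[of "\<sigma> i" "ts ! i"] by (auto simp: ts2)
    next
      case other
      then show ?thesis using tape i still[OF i] act_stay[of "ts ! i"] by (auto simp: ts2 scanned_def)
    qed
  qed
  then have "represents (effect K \<sigma>) ts2" using len by (simp add: represents_def)
  with two show ?thesis by (rule that)
qed

lemma stack_machine_simulates:
  assumes closed: "\<And>K ph v. (K, ph) \<in> set qs \<Longrightarrow>
      K \<noteq> [] \<and> list_all wf_com K \<and> (K, False) \<in> set qs \<and> (K, True) \<in> set qs \<and>
      (control K v = [] \<or> (control K v, False) \<in> set qs)"
    and K: "K = [] \<or> (K, False) \<in> set qs" and rep: "represents \<sigma> ts"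
  shows "\<exists>ts'. (step (stack_machine qs) ^^ (2 * n)) (state_code qs (K, False), ts) =
       (state_code qs (fst ((sstep ^^ n) (K, \<sigma>)), False), ts') \<and>
       represents (snd ((sstep ^^ n) (K, \<sigma>))) ts'"
  using K rep
proof (induction n arbitrary: K \<sigma> ts)
  case (Suc n)
  let ?K = "control K (\<lambda>r. peek (\<sigma> r))"
  obtain ts1 where ts1:
    "(step (stack_machine qs) ^^ 2) (state_code qs (K, False), ts) = (state_code qs (?K, False), ts1)"
    "represents (effect K \<sigma>) ts1"
  \<comment> \<open>The empty continuation is a fixed point of both machines, so a halted run can be
    prolonged.\<close>
  proof (cases "K = []")
    case True
    then have "([], False) \<notin> set qs" using closed by blast
    then have "state_code qs ([], False) = length qs" by (simp add: state_code_def)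
    then show ?thesis
      using that[of ts] Suc.prems True by (simp add: numeral_2_eq_2 step_def stack_machine_def)
  next
    case False
    then have "(K, False) \<in> set qs" using Suc.prems by simp
    with two_steps[of K qs \<sigma> ts] False closed Suc.prems that show ?thesis by metis
  qed
  have "?K = [] \<or> (?K, False) \<in> set qs"
    using Suc.prems(1) closed by (cases "K = []") auto
  from Suc.IH[OF this ts1(2)] ts1(1) show ?case
    by (simp add: funpow_add funpow_Suc_right sstep_def numeral_2_eq_2 del: funpow.simps)
qed simp

text \<open>Big-step semantics with a time bound. The quantified continuation makes it
  compositional, and as \<open>n\<close> is only an upper bound it can be weakened at will.\<close>

definition runs :: "com \<Rightarrow> store \<Rightarrow> nat \<Rightarrow> store \<Rightarrow> bool" where
  "runs c \<sigma> n \<sigma>' \<longleftrightarrow> (\<forall>K. \<exists>m\<le>n. (sstep ^^ m) (c # K, \<sigma>) = (K, \<sigma>'))"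

definition input_store :: "bool list \<Rightarrow> store" where
  "input_store x = (\<lambda>_. [])(0 := map bit_symbol x)"

lemma polytime_computableI:
  fixes p :: "nat poly"
  assumes wf: "wf_com c"
    and run: "\<And>x. \<exists>n \<le> poly p (length x). \<exists>\<sigma>. runs c (input_store x) n \<sigma> \<and> \<sigma> 1 = rev (map bit_symbol (f x))"
  shows "polytime_computable f"
proof -
  define S where "S = (conts c [] - {[]}) \<times> (UNIV :: bool set)"
  have start: "([c], False) \<in> S" using conts_start[of c "[]"] by (simp add: S_def)
  have "finite (S - {([c], False)})" by (simp add: S_def finite_conts)
  then obtain xs where xs: "set xs = S - {([c], False)}" using finite_list by blast
  \<comment> \<open>The start state must have number 0. The initial pair is put first and kept out
    of the rest, for otherwise the choice in \<open>state_code\<close> might return another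
    index.\<close>
  define qs where "qs = ([c], False) # filter (\<lambda>s. s \<noteq> ([c], False)) xs"
  have set_qs: "set qs = S" using xs start by (auto simp: qs_def)
  have closed: "K \<noteq> [] \<and> list_all wf_com K \<and> (K, False) \<in> set qs \<and> (K, True) \<in> set qs \<and>
      (control K v = [] \<or> (control K v, False) \<in> set qs)" if "(K, ph) \<in> set qs" for K ph v
    using that conts_wf[OF wf, of "[]" K] conts_closed[of K c "[]" v] by (auto simp: set_qs S_def)
  let ?M = "stack_machine qs"
  have code0: "state_code qs ([c], False) = 0"
  proof -
    have "i = 0" if "i < length qs" "qs ! i = ([c], False)" for i
    proof (rule ccontr)
      assume "i \<noteq> 0"
      then obtain j where j: "i = Suc j" by (cases i) auto
      then have "qs ! i \<in> set (filter (\<lambda>s. s \<noteq> ([c], False)) xs)"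
        using that(1) nth_mem[of j "filter (\<lambda>s. s \<noteq> ([c], False)) xs"] by (simp add: qs_def)
      with that(2) show False by simp
    qed
    then show ?thesis using state_code[of "([c], False)" qs] start set_qs by auto
  qed
  have "turing_machine ?M" by (rule turing_machine_stack_machine) (use closed in blast)
  moreover have "\<exists>t \<le> poly (2 * p) (length x). halts_with_output ?M x t (f x)" for x
  proof -
    obtain n \<sigma> where n: "n \<le> poly p (length x)" "runs c (input_store x) n \<sigma>" "\<sigma> 1 = rev (map bit_symbol (f x))"
      using run by blast
    then obtain m where m: "m \<le> n" "(sstep ^^ m) ([c], input_store x) = ([], \<sigma>)"
      unfolding runs_def by metis
    let ?ts = "(contents x, 0) # replicate 4 (contents [], 0)"
    have rep: "represents (input_store x) ?ts"
      unfolding represents_def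
    proof (intro conjI allI impI)
      fix i :: nat assume "i < 5"
      then have i: "i = 0 \<or> i = 1 \<or> i = 2 \<or> i = 3 \<or> i = 4" by auto
      have "contents [] = (\<lambda>_. 0)" by (simp add: contents_def fun_eq_iff)
      with i show "if i = 1 then out_tape (input_store x i) (?ts ! i) else stack_tape (input_store x i) (?ts ! i)"
        by (auto simp: input_store_def out_tape_def stack_tape_def contents_def fun_eq_iff)
    qed simp
    have "\<exists>ts'. (step ?M ^^ (2 * m)) (state_code qs ([c], False), ?ts) =
        (state_code qs (fst ((sstep ^^ m) ([c], input_store x)), False), ts') \<and>
        represents (snd ((sstep ^^ m) ([c], input_store x))) ts'"
      by (rule stack_machine_simulates) (use closed start set_qs rep in blast)+
    then obtain ts' where ts': "(step ?M ^^ (2 * m)) (0, ?ts) = (state_code qs ([], False), ts')" "represents \<sigma> ts'"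
      using m(2) code0 by auto
    have "state_code qs ([], False) = length qs" using closed by (auto simp: state_code_def)
    moreover have "fst (ts' ! 1) = contents (f x)"
    proof -
      have "out_tape (\<sigma> 1) (ts' ! 1)" using ts'(2) by (auto simp: represents_def)
      then show ?thesis
        using n(3) by (cases "ts' ! 1") (auto simp: out_tape_def contents_def fun_eq_iff)
    qed
    ultimately have "halts_with_output ?M x (2 * m) (f x)"
      using ts'(1) by (simp add: halts_with_output_def start_config_def stack_machine_def)
    \<comment> \<open>The factor 2 is the price of the two half-steps.\<close>
    moreover have "2 * m \<le> poly (2 * p) (length x)" using m(1) n(1) by simp
    ultimately show ?thesis by blast
  qed
  ultimately show ?thesis unfolding polytime_computable_def by blast
qed

section \<open>Trees on a stack\<close>

lemma runs_mono: "runs c \<sigma> n \<sigma>' \<Longrightarrow> n \<le> m \<Longrightarrow> runs c \<sigma> m \<sigma>'"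
  unfolding runs_def by (meson order_trans)

lemma runs_Skip: "runs Skip \<sigma> 1 \<sigma>"
  unfolding runs_def by (intro allI exI[of _ 1]) (simp add: sstep_def)

lemma runs_Push: "runs (Push r s) \<sigma> 1 (\<sigma>(r := s # \<sigma> r))"
  unfolding runs_def by (intro allI exI[of _ 1]) (simp add: sstep_def)

lemma runs_Pop: "runs (Pop r) \<sigma> 1 (\<sigma>(r := tl (\<sigma> r)))"
  unfolding runs_def by (intro allI exI[of _ 1]) (simp add: sstep_def)

lemma runs_Seq:
  assumes "runs a \<sigma> n \<sigma>1" "runs b \<sigma>1 m \<sigma>2"
  shows "runs (a ;; b) \<sigma> (1 + n + m) \<sigma>2"
  unfolding runs_def
proof
  fix K
  obtain i where i: "i \<le> n" "(sstep ^^ i) (a # b # K, \<sigma>) = (b # K, \<sigma>1)"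
    using assms(1) unfolding runs_def by blast
  obtain j where j: "j \<le> m" "(sstep ^^ j) (b # K, \<sigma>1) = (K, \<sigma>2)"
    using assms(2) unfolding runs_def by blast
  have "(sstep ^^ (j + i)) (a # b # K, \<sigma>) = (K, \<sigma>2)" using i j by (simp add: funpow_add)
  then have "(sstep ^^ Suc (j + i)) ((a ;; b) # K, \<sigma>) = (K, \<sigma>2)"
    by (simp add: sstep_def funpow_Suc_right del: funpow.simps)
  then show "\<exists>k\<le>1 + n + m. (sstep ^^ k) ((a ;; b) # K, \<sigma>) = (K, \<sigma>2)"
    using i(1) j(1) by (intro exI[of _ "Suc (j + i)"]) simp
qed

lemma runs_Cond:
  assumes "runs (if peek (\<sigma> r) = s then a else b) \<sigma> n \<sigma>1"
  shows "runs (Cond r s a b) \<sigma> (1 + n) \<sigma>1"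
  unfolding runs_def
proof
  fix K
  obtain i where i: "i \<le> n" "(sstep ^^ i) ((if peek (\<sigma> r) = s then a else b) # K, \<sigma>) = (K, \<sigma>1)"
    using assms unfolding runs_def by blast
  then have "(sstep ^^ Suc i) (Cond r s a b # K, \<sigma>) = (K, \<sigma>1)"
    by (simp add: sstep_def funpow_Suc_right del: funpow.simps)
  then show "\<exists>k\<le>1 + n. (sstep ^^ k) (Cond r s a b # K, \<sigma>) = (K, \<sigma>1)"
    using i(1) by (intro exI[of _ "Suc i"]) simp
qed

lemma runs_Until_stop: "peek (\<sigma> r) = s \<Longrightarrow> runs (Until r s c) \<sigma> 1 \<sigma>"
  unfolding runs_def by (intro allI exI[of _ 1]) (simp add: sstep_def)

lemma runs_Until_step:
  assumes "peek (\<sigma> r) \<noteq> s" "runs c \<sigma> n \<sigma>1" "runs (Until r s c) \<sigma>1 m \<sigma>2"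
  shows "runs (Until r s c) \<sigma> (1 + n + m) \<sigma>2"
  unfolding runs_def
proof
  fix K
  let ?U = "Until r s c"
  obtain i where i: "i \<le> n" "(sstep ^^ i) (c # ?U # K, \<sigma>) = (?U # K, \<sigma>1)"
    using assms(2) unfolding runs_def by blast
  obtain j where j: "j \<le> m" "(sstep ^^ j) (?U # K, \<sigma>1) = (K, \<sigma>2)"
    using assms(3) unfolding runs_def by blast
  have "(sstep ^^ (j + i)) (c # ?U # K, \<sigma>) = (K, \<sigma>2)" using i j by (simp add: funpow_add)
  then have "(sstep ^^ Suc (j + i)) (?U # K, \<sigma>) = (K, \<sigma>2)"
    using assms(1) by (simp add: sstep_def funpow_Suc_right del: funpow.simps)
  then show "\<exists>k\<le>1 + n + m. (sstep ^^ k) (?U # K, \<sigma>) = (K, \<sigma>2)"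
    using i(1) j(1) by (intro exI[of _ "Suc (j + i)"]) simp
qed

section \<open>Straight-line programs, executed by rewriting\<close>

fun loop_free :: "com \<Rightarrow> bool" where
  "loop_free (a ;; b) \<longleftrightarrow> loop_free a \<and> loop_free b"
| "loop_free (Cond r s a b) \<longleftrightarrow> loop_free a \<and> loop_free b"
| "loop_free (Until r s c) \<longleftrightarrow> False"
| "loop_free c \<longleftrightarrow> True"

fun go :: "com \<Rightarrow> store \<Rightarrow> store" where
  "go (a ;; b) \<sigma> = go b (go a \<sigma>)"
| "go (Cond r s a b) \<sigma> = (if peek (\<sigma> r) = s then go a \<sigma> else go b \<sigma>)"
| "go (Push r s) \<sigma> = \<sigma>(r := s # \<sigma> r)"
| "go (Pop r) \<sigma> = \<sigma>(r := tl (\<sigma> r))"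
| "go c \<sigma> = \<sigma>"

fun cost :: "com \<Rightarrow> nat" where
  "cost (a ;; b) = 1 + cost a + cost b"
| "cost (Cond r s a b) = 1 + (cost a + cost b)"
| "cost c = 1"

lemma runs_go: "loop_free c \<Longrightarrow> runs c \<sigma> (cost c) (go c \<sigma>)"
proof (induction c arbitrary: \<sigma>)
  case (Seq a b)
  then show ?case using runs_Seq[of a \<sigma> "cost a" "go a \<sigma>" b] by simp
next
  case (Cond r s a b)
  then have "runs a \<sigma> (cost a) (go a \<sigma>)" "runs b \<sigma> (cost b) (go b \<sigma>)" by auto
  then have "runs a \<sigma> (cost a + cost b) (go a \<sigma>)" "runs b \<sigma> (cost a + cost b) (go b \<sigma>)"
    by (auto elim: runs_mono)
  then show ?case using runs_Cond[of \<sigma> r s a b] by simp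
qed (auto intro: runs_Skip[simplified] runs_Push[simplified] runs_Pop[simplified])

lemma runs_goI: "loop_free c \<Longrightarrow> go c \<sigma> = \<sigma>' \<Longrightarrow> cost c \<le> n \<Longrightarrow> runs c \<sigma> n \<sigma>'"
  using runs_go runs_mono by metis

lemma peek_simps [simp]: "peek [] = 0" "peek (s # l) = s"
  by (simp_all add: peek_def)

text \<open>Register 0 is the main stack, register 1 the output; registers 2, 3, 4 are auxiliary.\<close>

definition st :: "nat list \<Rightarrow> nat list \<Rightarrow> nat list \<Rightarrow> nat list \<Rightarrow> nat list \<Rightarrow> store" where
  "st m w a b c = (\<lambda>_. [])(0 := m, 1 := w, 2 := a, 3 := b, 4 := c)"

lemma st_simps [simp]:
  "st m w a b c 0 = m" "st m w a b c 1 = w" "st m w a b c (Suc 0) = w"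
  "st m w a b c 2 = a" "st m w a b c 3 = b" "st m w a b c 4 = c"
  "(st m w a b c)(0 := x) = st x w a b c"
  "(st m w a b c)(1 := x) = st m x a b c"
  "(st m w a b c)(Suc 0 := x) = st m x a b c"
  "(st m w a b c)(2 := x) = st m w x b c"
  "(st m w a b c)(3 := x) = st m w a x c"
  "(st m w a b c)(4 := x) = st m w a b x"
  by (auto simp: st_def fun_eq_iff)

abbreviation stk :: "nat list \<Rightarrow> nat list \<Rightarrow> store" where
  "stk m w \<equiv> st m w [] [] []"

definition pour :: "nat \<Rightarrow> nat \<Rightarrow> com" where
  "pour r q = Until r 0 (Cond r 1 (Pop r ;; Push q 1) (Pop r ;; Push q 2))"

lemma runs_pour:
  assumes "set (\<sigma> r) \<subseteq> {1, 2}" "r \<noteq> q"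
  shows "runs (pour r q) \<sigma> (8 * length (\<sigma> r) + 1) (\<sigma>(r := [], q := rev (\<sigma> r) @ \<sigma> q))"
  using assms
proof (induction "\<sigma> r" arbitrary: \<sigma>)
  case Nil
  then have eq: "\<sigma>(r := [], q := rev (\<sigma> r) @ \<sigma> q) = \<sigma>" by (auto simp: fun_eq_iff)
  show ?case unfolding eq pour_def using Nil.hyps[symmetric]
    by (intro runs_mono[OF runs_Until_stop]) simp_all
next
  case (Cons s l)
  let ?\<sigma> = "\<sigma>(r := l, q := s # \<sigma> q)"
  let ?c = "Cond r 1 (Pop r ;; Push q 1) (Pop r ;; Push q 2)"
  have sr: "\<sigma> r = s # l" using Cons.hyps(2) by simp
  have "go ?c \<sigma> = ?\<sigma>" using Cons.prems sr by auto
  then have step: "runs ?c \<sigma> 7 ?\<sigma>" by (intro runs_goI) simp_all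
  have rest: "runs (pour r q) ?\<sigma> (8 * length l + 1) (\<sigma>(r := [], q := rev (\<sigma> r) @ \<sigma> q))"
  proof -
    have "?\<sigma>(r := [], q := rev (?\<sigma> r) @ ?\<sigma> q) = \<sigma>(r := [], q := rev (\<sigma> r) @ \<sigma> q)"
      using Cons.prems sr by (auto simp: fun_eq_iff)
    then show ?thesis using Cons.hyps(1)[of ?\<sigma>] Cons.prems sr by simp
  qed
  have "peek (\<sigma> r) \<noteq> 0" using sr Cons.prems(1) by auto
  from runs_Until_step[OF this step rest[unfolded pour_def], folded pour_def] show ?case
    by (rule runs_mono) (simp add: sr)
qed

definition clear :: "nat \<Rightarrow> com" where
  "clear r = Until r 0 (Pop r)"

lemma runs_clear:
  assumes "0 \<notin> set (\<sigma> r)"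
  shows "runs (clear r) \<sigma> (2 * length (\<sigma> r) + 1) (\<sigma>(r := []))"
  using assms
proof (induction "\<sigma> r" arbitrary: \<sigma>)
  case Nil
  then have eq: "\<sigma>(r := []) = \<sigma>" by (auto simp: fun_eq_iff)
  show ?case unfolding eq clear_def using Nil.hyps[symmetric]
    by (intro runs_mono[OF runs_Until_stop]) simp_all
next
  case (Cons s l)
  have sr: "\<sigma> r = s # l" using Cons.hyps(2) by simp
  have rest: "runs (clear r) (\<sigma>(r := l)) (2 * length l + 1) (\<sigma>(r := []))"
    using Cons.hyps(1)[of "\<sigma>(r := l)"] Cons.prems sr by simp
  have step: "runs (Pop r) \<sigma> 1 (\<sigma>(r := l))" using runs_Pop[of r \<sigma>] sr by simp
  have "peek (\<sigma> r) \<noteq> 0" using sr Cons.prems(1) by auto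
  from runs_Until_step[OF this step rest[unfolded clear_def], folded clear_def] show ?case
    by (rule runs_mono) (simp add: sr)
qed

section \<open>Binary trees in prefix notation\<close>

datatype tree = Leaf | Node tree tree

text \<open>Prefix notation delimits itself, so one stack can hold several trees.\<close>

primrec ser :: "tree \<Rightarrow> nat list" where
  "ser Leaf = [1]"
| "ser (Node a b) = 2 # ser a @ ser b"

definition tsize :: "tree \<Rightarrow> nat" where
  "tsize t = length (ser t)"

lemma tsize_simps [simp]: "tsize Leaf = 1" "tsize (Node a b) = 1 + tsize a + tsize b"
  by (simp_all add: tsize_def)

lemma length_ser [simp]: "length (ser t) = tsize t"
  by (simp add: tsize_def)

lemma tsize_pos: "0 < tsize t"
  by (cases t) auto

lemma set_ser: "set (ser t) \<subseteq> {1, 2}"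
  by (induction t) auto

lemma zero_notin_ser: "0 \<notin> set (ser t)"
  by (induction t) auto

lemma ser_append_inject: "ser a @ u = ser b @ v \<longleftrightarrow> a = b \<and> u = v"
proof (induction a arbitrary: b u v)
  case Leaf
  then show ?case by (cases b) auto
next
  case (Node a1 a2)
  then show ?case by (cases b) auto
qed

lemma ser_inject: "ser a = ser b \<longleftrightarrow> a = b"
  using ser_append_inject[of a "[]" b "[]"] by simp

text \<open>Register 4 counts the subtrees still to be read.\<close>

definition take_step :: "nat \<Rightarrow> nat \<Rightarrow> com" where
  "take_step r q = Cond r 2 (Pop r ;; Push q 2 ;; Push 4 1) (Pop r ;; Push q 1 ;; Pop 4)"

definition take_tree :: "nat \<Rightarrow> nat \<Rightarrow> com" where
  "take_tree r q = Push 4 1 ;; Until 4 0 (take_step r q)"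

text \<open>The counter keeps running after a subtree has been read, so the loop cannot be cut
  there. The claim instead prepends the reading of \<open>t\<close> to a run that starts behind
  \<open>t\<close>; then the two subtrees of a node are handled by one induction hypothesis each. A
  node replaces one pending tree by two, a leaf finishes one. Each symbol costs 11 steps for the
  body and one for the test.\<close>

lemma runs_take_loop:
  assumes rq: "r \<noteq> q" "r \<noteq> 4" "q \<noteq> 4"
    and "runs (Until 4 0 (take_step r q)) (\<sigma>(r := rest, q := rev (ser t) @ Q, 4 := cs)) n \<sigma>'"
  shows "runs (Until 4 0 (take_step r q)) (\<sigma>(r := ser t @ rest, q := Q, 4 := 1 # cs)) (n + 12 * tsize t) \<sigma>'"
  using assms(4)
proof (induction t arbitrary: rest Q cs n)
  case Leaf
  let ?\<sigma> = "\<sigma>(r := ser Leaf @ rest, q := Q, 4 := 1 # cs)"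
  have "go (take_step r q) ?\<sigma> = \<sigma>(r := rest, q := rev (ser Leaf) @ Q, 4 := cs)"
    using rq by (auto simp: take_step_def fun_eq_iff)
  then have "runs (take_step r q) ?\<sigma> 11 (\<sigma>(r := rest, q := rev (ser Leaf) @ Q, 4 := cs))"
    by (intro runs_goI) (simp_all add: take_step_def)
  from runs_Until_step[OF _ this Leaf] show ?case by (rule runs_mono) simp_all
next
  case (Node a b)
  let ?\<sigma> = "\<sigma>(r := ser (Node a b) @ rest, q := Q, 4 := 1 # cs)"
  let ?\<sigma>1 = "\<sigma>(r := ser a @ ser b @ rest, q := 2 # Q, 4 := 1 # 1 # cs)"
  have "go (take_step r q) ?\<sigma> = ?\<sigma>1"
    using rq by (auto simp: take_step_def fun_eq_iff)
  then have step: "runs (take_step r q) ?\<sigma> 11 ?\<sigma>1"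
    by (intro runs_goI) (simp_all add: take_step_def)
  have "runs (Until 4 0 (take_step r q)) (\<sigma>(r := ser b @ rest, q := rev (ser a) @ 2 # Q, 4 := 1 # cs))
      (n + 12 * tsize b) \<sigma>'"
    by (rule Node.IH(2)) (use Node.prems in simp)
  then have "runs (Until 4 0 (take_step r q)) ?\<sigma>1 (n + 12 * tsize b + 12 * tsize a) \<sigma>'"
    by (rule Node.IH(1))
  from runs_Until_step[OF _ step this] show ?case by (rule runs_mono) simp_all
qed

lemma runs_take_tree:
  assumes rq: "r \<noteq> q" "r \<noteq> 4" "q \<noteq> 4" and "\<sigma> r = ser t @ rest" "\<sigma> 4 = []"
  shows "runs (take_tree r q) \<sigma> (3 + 12 * tsize t) (\<sigma>(r := rest, q := rev (ser t) @ \<sigma> q))"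
proof -
  let ?\<sigma> = "\<sigma>(r := rest, q := rev (ser t) @ \<sigma> q, 4 := [])"
  have eq: "?\<sigma> = \<sigma>(r := rest, q := rev (ser t) @ \<sigma> q)"
    "\<sigma>(r := ser t @ rest, q := \<sigma> q, 4 := [1]) = \<sigma>(4 := [1])"
    using assms by (auto simp: fun_eq_iff)
  have "runs (Until 4 0 (take_step r q)) ?\<sigma> 1 ?\<sigma>" by (rule runs_Until_stop) simp
  from runs_take_loop[OF rq this]
  have "runs (Until 4 0 (take_step r q)) (\<sigma>(4 := [1])) (1 + 12 * tsize t) ?\<sigma>"
    by (simp only: eq)
  moreover have "runs (Push 4 1) \<sigma> 1 (\<sigma>(4 := [1]))" using runs_Push[of 4 1 \<sigma>] assms(5) by simp
  ultimately have "runs (take_tree r q) \<sigma> (1 + 1 + (1 + 12 * tsize t)) ?\<sigma>"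
    unfolding take_tree_def by (intro runs_Seq)
  then show ?thesis unfolding eq by (rule runs_mono) simp
qed

definition drop_tree :: com where
  "drop_tree = take_tree 0 3 ;; clear 3"

lemma runs_drop_tree:
  "runs drop_tree (stk (ser t @ rest) w) (20 * tsize t) (stk rest w)"
proof -
  have "runs (take_tree 0 3) (stk (ser t @ rest) w) (3 + 12 * tsize t) (st rest w [] (rev (ser t)) [])"
    using runs_take_tree[of 0 3 "stk (ser t @ rest) w" t rest] by simp
  moreover have "runs (clear 3) (st rest w [] (rev (ser t)) []) (2 * tsize t + 1) (stk rest w)"
    using runs_clear[of "st rest w [] (rev (ser t)) []" 3] by (simp add: zero_notin_ser)
  ultimately have "runs drop_tree (stk (ser t @ rest) w) (1 + (3 + 12 * tsize t) + (2 * tsize t + 1)) (stk rest w)"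
    unfolding drop_tree_def by (rule runs_Seq)
  then show ?thesis by (rule runs_mono) (use tsize_pos[of t] in linarith)
qed

definition copy :: com where
  "copy = Until 2 0 (Cond 2 1 (Pop 2 ;; Push 0 1 ;; Push 3 1) (Pop 2 ;; Push 0 2 ;; Push 3 2))"

lemma runs_copy:
  assumes "set l \<subseteq> {1, 2}"
  shows "runs copy (st m w l b []) (12 * length l + 1) (st (rev l @ m) w [] (rev l @ b) [])"
  using assms
proof (induction l arbitrary: m b)
  case Nil
  then show ?case using runs_Until_stop[of "st m w [] b []" 2 0] by (simp add: copy_def)
next
  case (Cons s l)
  let ?c = "Cond 2 1 (Pop 2 ;; Push 0 1 ;; Push 3 1) (Pop 2 ;; Push 0 2 ;; Push 3 2)"
  have "go ?c (st m w (s # l) b []) = st (s # m) w l (s # b) []" using Cons.prems by auto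
  then have step: "runs ?c (st m w (s # l) b []) 11 (st (s # m) w l (s # b) [])"
    by (intro runs_goI) simp_all
  have "peek (st m w (s # l) b [] 2) \<noteq> 0" using Cons.prems by auto
  moreover have "runs copy (st (s # m) w l (s # b) []) (12 * length l + 1) (st (rev l @ s # m) w [] (rev l @ s # b) [])"
    using Cons by auto
  ultimately have "runs copy (st m w (s # l) b []) (1 + 11 + (12 * length l + 1)) (st (rev l @ s # m) w [] (rev l @ s # b) [])"
    unfolding copy_def using step by (intro runs_Until_step)
  then show ?case by (simp add: runs_mono)
qed

text \<open>Every transfer reverses. After \<open>copy\<close> both the main stack and register 3
  hold the tree in its original order, so bringing the second copy back takes two transfers.\<close>

definition dup :: com where
  "dup = take_tree 0 2 ;; copy ;; pour 3 2 ;; pour 2 0"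

lemma runs_dup:
  "runs dup (stk (ser t @ rest) w) (50 * tsize t) (stk (ser t @ ser t @ rest) w)"
proof -
  have sub: "set (rev (ser t)) \<subseteq> {1, 2}" using set_ser[of t] by simp
  have "runs (take_tree 0 2) (stk (ser t @ rest) w) (3 + 12 * tsize t) (st rest w (rev (ser t)) [] [])"
    using runs_take_tree[of 0 2 "stk (ser t @ rest) w" t rest] by simp
  moreover have "runs copy (st rest w (rev (ser t)) [] []) (12 * tsize t + 1) (st (ser t @ rest) w [] (ser t) [])"
    using runs_copy[OF sub, of rest w "[]"] by simp
  moreover have "runs (pour 3 2) (st (ser t @ rest) w [] (ser t) []) (8 * tsize t + 1) (st (ser t @ rest) w (rev (ser t)) [] [])"
    using runs_pour[of "st (ser t @ rest) w [] (ser t) []" 3 2] set_ser[of t] by simp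
  moreover have "runs (pour 2 0) (st (ser t @ rest) w (rev (ser t)) [] []) (8 * tsize t + 1) (stk (ser t @ ser t @ rest) w)"
    using runs_pour[of "st (ser t @ rest) w (rev (ser t)) [] []" 2 0] sub by simp
  ultimately have "runs dup (stk (ser t @ rest) w) (1 + (3 + 12 * tsize t) + (1 + (12 * tsize t + 1) +
      (1 + (8 * tsize t + 1) + (8 * tsize t + 1)))) (stk (ser t @ ser t @ rest) w)"
    unfolding dup_def by (intro runs_Seq)
  then show ?thesis by (rule runs_mono) (use tsize_pos[of t] in linarith)
qed

definition swap :: com where
  "swap = take_tree 0 2 ;; take_tree 0 3 ;; pour 2 0 ;; pour 3 0"

lemma runs_swap:
  "runs swap (stk (ser t @ ser s @ rest) w) (30 * (tsize t + tsize s)) (stk (ser s @ ser t @ rest) w)"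
proof -
  have sub: "set (rev (ser t)) \<subseteq> {1, 2}" "set (rev (ser s)) \<subseteq> {1, 2}"
    using set_ser[of t] set_ser[of s] by simp_all
  have "runs (take_tree 0 2) (stk (ser t @ ser s @ rest) w) (3 + 12 * tsize t) (st (ser s @ rest) w (rev (ser t)) [] [])"
    using runs_take_tree[of 0 2 "stk (ser t @ ser s @ rest) w" t "ser s @ rest"] by simp
  moreover have "runs (take_tree 0 3) (st (ser s @ rest) w (rev (ser t)) [] []) (3 + 12 * tsize s)
      (st rest w (rev (ser t)) (rev (ser s)) [])"
    using runs_take_tree[of 0 3 "st (ser s @ rest) w (rev (ser t)) [] []" s rest] by simp
  moreover have "runs (pour 2 0) (st rest w (rev (ser t)) (rev (ser s)) []) (8 * tsize t + 1) (st (ser t @ rest) w [] (rev (ser s)) [])"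
    using runs_pour[of "st rest w (rev (ser t)) (rev (ser s)) []" 2 0] sub by simp
  moreover have "runs (pour 3 0) (st (ser t @ rest) w [] (rev (ser s)) []) (8 * tsize s + 1) (stk (ser s @ ser t @ rest) w)"
    using runs_pour[of "st (ser t @ rest) w [] (rev (ser s)) []" 3 0] sub by simp
  ultimately have "runs swap (stk (ser t @ ser s @ rest) w) (1 + (3 + 12 * tsize t) + (1 + (3 + 12 * tsize s) +
      (1 + (8 * tsize t + 1) + (8 * tsize s + 1)))) (stk (ser s @ ser t @ rest) w)"
    unfolding swap_def by (intro runs_Seq)
  then show ?thesis by (rule runs_mono) (use tsize_pos[of t] tsize_pos[of s] in \<open>simp add: algebra_simps\<close>)
qed

section \<open>Polynomial-time functions on trees\<close>

lemma poly_mono_nat: "a \<le> b \<Longrightarrow> poly p a \<le> poly (p :: nat poly) b"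
  by (induction p) (auto intro: add_mono mult_mono)

text \<open>Quantifying over \<open>rest\<close> and \<open>w\<close> expresses that only the top
  tree is touched; the auxiliary registers are empty before and after. One polynomial bounds both
  time and output size, because sizes are needed to bound the time of whatever runs next.\<close>

definition computes :: "com \<Rightarrow> ('a \<Rightarrow> tree) \<Rightarrow> ('a \<Rightarrow> tree) \<Rightarrow> nat poly \<Rightarrow> bool" where
  "computes c e f p \<longleftrightarrow> wf_com c \<and> (\<forall>t rest w. tsize (f t) \<le> poly p (tsize (e t)) \<and>
     runs c (stk (ser (e t) @ rest) w) (poly p (tsize (e t))) (stk (ser (f t) @ rest) w))"

text \<open>The tree \<open>f x\<close> can be computed from the code \<open>e x\<close> of \<open>x\<close>; nothing is required of a
  program on trees that are not codes.\<close>

definition fp :: "('a \<Rightarrow> tree) \<Rightarrow> ('a \<Rightarrow> tree) \<Rightarrow> bool" where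
  "fp e f \<longleftrightarrow> (\<exists>c p. computes c e f p)"

lemma fpI:
  assumes "wf_com c" "\<And>t. tsize (f t) \<le> poly p (tsize (e t))"
    "\<And>t rest w. runs c (stk (ser (e t) @ rest) w) (poly q (tsize (e t))) (stk (ser (f t) @ rest) w)"
  shows "fp e f"
proof -
  have "computes c e f (p + q)"
    unfolding computes_def
  proof (intro conjI allI)
    fix t rest w
    show "tsize (f t) \<le> poly (p + q) (tsize (e t))" using assms(2)[of t] by simp
    show "runs c (stk (ser (e t) @ rest) w) (poly (p + q) (tsize (e t))) (stk (ser (f t) @ rest) w)"
      by (rule runs_mono[OF assms(3)]) simp
  qed (rule assms(1))
  then show ?thesis unfolding fp_def by blast
qed

lemma computesD:
  assumes "computes c e f p"
  shows "wf_com c" "tsize (f t) \<le> poly p (tsize (e t))"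
    "runs c (stk (ser (e t) @ rest) w) (poly p (tsize (e t))) (stk (ser (f t) @ rest) w)"
  using assms unfolding computes_def by blast+

lemma wf_tree_ops [simp]: "wf_com drop_tree" "wf_com dup" "wf_com swap"
  by (simp_all add: drop_tree_def dup_def swap_def take_tree_def take_step_def clear_def pour_def copy_def)

lemma fp_id: "fp e e"
proof (rule fpI[of Skip _ "[:0, 1:]" _ "[:1:]"])
  show "runs Skip (stk (ser (e t) @ rest) w) (poly [:1:] (tsize (e t))) (stk (ser (e t) @ rest) w)" for t rest w
    using runs_Skip by simp
qed simp_all

primrec pushes :: "nat list \<Rightarrow> com" where
  "pushes [] = Skip"
| "pushes (s # l) = pushes l ;; Push 0 s"

lemma runs_pushes: "runs (pushes l) (st m w a b c) (2 * length l + 1) (st (l @ m) w a b c)"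
proof (rule runs_goI)
  show "loop_free (pushes l)" "cost (pushes l) \<le> 2 * length l + 1" by (induction l) auto
  show "go (pushes l) (st m w a b c) = st (l @ m) w a b c" by (induction l) auto
qed

lemma wf_pushes: "set l \<subseteq> {1, 2} \<Longrightarrow> wf_com (pushes l)"
  by (induction l) auto

lemma fp_const: "fp e (\<lambda>_. k)"
proof (rule fpI[of "drop_tree ;; pushes (ser k)" _ "[:tsize k:]" _ "[:2 * tsize k + 2, 20:]"])
  fix t rest w
  have "runs (drop_tree ;; pushes (ser k)) (stk (ser (e t) @ rest) w) (1 + 20 * tsize (e t) + (2 * tsize k + 1))
     (stk (ser k @ rest) w)"
    using runs_Seq[OF runs_drop_tree runs_pushes[of "ser k"]] by simp
  then show "runs (drop_tree ;; pushes (ser k)) (stk (ser (e t) @ rest) w) (poly [:2 * tsize k + 2, 20:] (tsize (e t)))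
     (stk (ser k @ rest) w)"
    by (rule runs_mono) simp
qed (simp_all add: wf_pushes set_ser del: One_nat_def)

fun tfst :: "tree \<Rightarrow> tree" where
  "tfst (Node a b) = a"
| "tfst Leaf = Leaf"

fun tsnd :: "tree \<Rightarrow> tree" where
  "tsnd (Node a b) = b"
| "tsnd Leaf = Leaf"

lemma fp_tfst: "fp e (\<lambda>t. tfst (e t))"
proof (rule fpI[of "Cond 0 2 (Pop 0 ;; swap ;; drop_tree) Skip" _ "[:1, 1:]" _ "[:10, 50:]"])
  fix t rest w
  show "runs (Cond 0 2 (Pop 0 ;; swap ;; drop_tree) Skip) (stk (ser (e t) @ rest) w) (poly [:10, 50:] (tsize (e t)))
      (stk (ser (tfst (e t)) @ rest) w)"
  proof (cases "e t")
    case Leaf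
    have "runs (Cond 0 2 (Pop 0 ;; swap ;; drop_tree) Skip) (stk (ser (e t) @ rest) w) (1 + 1)
      (stk (ser (tfst (e t)) @ rest) w)"
      by (rule runs_Cond) (use Leaf runs_Skip in simp)
    then show ?thesis by (rule runs_mono) simp
  next
    case (Node a b)
    have "runs (Pop 0) (stk (ser (e t) @ rest) w) 1 (stk (ser a @ ser b @ rest) w)"
      using Node runs_Pop[of 0 "stk (ser (e t) @ rest) w"] by simp
    note pop = this
    have "runs (Pop 0 ;; swap ;; drop_tree) (stk (ser (e t) @ rest) w)
        (1 + 1 + (1 + 30 * (tsize a + tsize b) + 20 * tsize b)) (stk (ser a @ rest) w)"
      by (rule runs_Seq pop runs_swap runs_drop_tree)+
    then have "runs (Cond 0 2 (Pop 0 ;; swap ;; drop_tree) Skip) (stk (ser (e t) @ rest) w)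
        (1 + (1 + 1 + (1 + 30 * (tsize a + tsize b) + 20 * tsize b))) (stk (ser a @ rest) w)"
      using Node by (intro runs_Cond) simp
    then show ?thesis using Node by (auto elim!: runs_mono)
  qed
next
  show "tsize (tfst (e t)) \<le> poly [:1, 1:] (tsize (e t))" for t by (cases "e t") auto
qed simp

lemma fp_tsnd: "fp e (\<lambda>t. tsnd (e t))"
proof (rule fpI[of "Cond 0 2 (Pop 0 ;; drop_tree) Skip" _ "[:1, 1:]" _ "[:10, 50:]"])
  fix t rest w
  show "runs (Cond 0 2 (Pop 0 ;; drop_tree) Skip) (stk (ser (e t) @ rest) w) (poly [:10, 50:] (tsize (e t)))
      (stk (ser (tsnd (e t)) @ rest) w)"
  proof (cases "e t")
    case Leaf
    have "runs (Cond 0 2 (Pop 0 ;; drop_tree) Skip) (stk (ser (e t) @ rest) w) (1 + 1)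
      (stk (ser (tsnd (e t)) @ rest) w)"
      by (rule runs_Cond) (use Leaf runs_Skip in simp)
    then show ?thesis by (rule runs_mono) simp
  next
    case (Node a b)
    have "runs (Pop 0) (stk (ser (e t) @ rest) w) 1 (stk (ser a @ ser b @ rest) w)"
      using Node runs_Pop[of 0 "stk (ser (e t) @ rest) w"] by simp
    note pop = this
    have "runs (Pop 0 ;; drop_tree) (stk (ser (e t) @ rest) w)
        (1 + 1 + 20 * tsize a) (stk (ser b @ rest) w)"
      by (rule runs_Seq pop runs_drop_tree)+
    then have "runs (Cond 0 2 (Pop 0 ;; drop_tree) Skip) (stk (ser (e t) @ rest) w)
        (1 + (1 + 1 + 20 * tsize a)) (stk (ser b @ rest) w)"
      using Node by (intro runs_Cond) simp
    then show ?thesis using Node by (auto elim!: runs_mono)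
  qed
next
  show "tsize (tsnd (e t)) \<le> poly [:1, 1:] (tsize (e t))" for t by (cases "e t") auto
qed simp

lemma fp_comp:
  assumes "fp e' f" "fp e (\<lambda>t. e' (g t))"
  shows "fp e (\<lambda>t. f (g t))"
proof -
  obtain c p where "computes c e' f p" using assms(1) unfolding fp_def by blast
  note f = computesD[OF this]
  obtain d q where "computes d e (\<lambda>t. e' (g t)) q" using assms(2) unfolding fp_def by blast
  note g = computesD[OF this]
  have mono: "poly p (tsize (e' (g t))) \<le> poly (pcompose p q) (tsize (e t))" for t
    by (simp add: poly_pcompose poly_mono_nat g(2))
  show ?thesis
  proof (rule fpI[of "d ;; c" _ "pcompose p q" _ "1 + q + pcompose p q"])
    show "tsize (f (g t)) \<le> poly (pcompose p q) (tsize (e t))" for t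
      using f(2)[of "g t"] mono[of t] by simp
    show "runs (d ;; c) (stk (ser (e t) @ rest) w) (poly (1 + q + pcompose p q) (tsize (e t)))
        (stk (ser (f (g t)) @ rest) w)" for t rest w
      by (rule runs_mono[OF runs_Seq[OF g(3) f(3)]]) (use mono[of t] in simp)
  qed (use f g in simp)
qed

text \<open>The argument is duplicated, \<open>g\<close> runs on the upper copy, and its value is
  swapped below the other copy on which \<open>f\<close> then runs. This leaves \<open>f t\<close>
  above \<open>g t\<close>, the order that a \<open>Node\<close> symbol on top requires.\<close>

lemma runs_both:
  assumes "fp e f" "fp e g"
  obtains c p where "wf_com c" "\<And>t. tsize (f t) + tsize (g t) \<le> poly p (tsize (e t))"
    "\<And>t rest w. runs c (stk (ser (e t) @ rest) w) (poly p (tsize (e t))) (stk (ser (f t) @ ser (g t) @ rest) w)"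
proof -
  obtain c p where "computes c e f p" using assms(1) unfolding fp_def by blast
  note f = computesD[OF this]
  obtain d q where "computes d e g q" using assms(2) unfolding fp_def by blast
  note g = computesD[OF this]
  let ?r = "[:3, 80:] + 31 * q + p"
  show ?thesis
  proof (rule that[of "dup ;; d ;; swap ;; c" ?r])
    show "tsize (f t) + tsize (g t) \<le> poly ?r (tsize (e t))" for t
      using f(2)[of t] g(2)[of t] by simp
    fix t rest w
    have "runs (dup ;; d ;; swap ;; c) (stk (ser (e t) @ rest) w)
        (1 + 50 * tsize (e t) + (1 + poly q (tsize (e t)) + (1 + 30 * (tsize (g t) + tsize (e t)) + poly p (tsize (e t)))))
        (stk (ser (f t) @ ser (g t) @ rest) w)"
      by (rule runs_Seq runs_dup runs_swap f(3) g(3))+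
    then show "runs (dup ;; d ;; swap ;; c) (stk (ser (e t) @ rest) w) (poly ?r (tsize (e t)))
        (stk (ser (f t) @ ser (g t) @ rest) w)"
      by (rule runs_mono) (use g(2)[of t] in simp)
  qed (use f g in simp)
qed

lemma fp_Node:
  assumes "fp e f" "fp e g"
  shows "fp e (\<lambda>t. Node (f t) (g t))"
proof -
  obtain c p where c: "wf_com c" "\<And>t. tsize (f t) + tsize (g t) \<le> poly p (tsize (e t))"
    "\<And>t rest w. runs c (stk (ser (e t) @ rest) w) (poly p (tsize (e t))) (stk (ser (f t) @ ser (g t) @ rest) w)"
    using runs_both[OF assms] by blast
  show ?thesis
  proof (rule fpI[of "c ;; Push 0 2" _ "1 + p" _ "2 + p"])
    fix t rest w
    have "runs (Push 0 2) (stk (ser (f t) @ ser (g t) @ rest) w) 1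
       (stk (ser (Node (f t) (g t)) @ rest) w)"
      using runs_Push[of 0 2 "stk (ser (f t) @ ser (g t) @ rest) w"] by simp
    from runs_Seq[OF c(3) this]
    show "runs (c ;; Push 0 2) (stk (ser (e t) @ rest) w) (poly (2 + p) (tsize (e t)))
       (stk (ser (Node (f t) (g t)) @ rest) w)"
      by (rule runs_mono) simp
    show "tsize (Node (f t) (g t)) \<le> poly (1 + p) (tsize (e t))" using c(2)[of t] by simp
  qed (use c in simp)
qed

lemma fp_if:
  assumes "fp e f" "fp e g" "fp e h"
  shows "fp e (\<lambda>t. if f t = Leaf then g t else h t)"
proof -
  obtain c p where "computes c e f p" using assms(1) unfolding fp_def by blast
  note f = computesD[OF this]
  obtain d q where "computes d e g q" using assms(2) unfolding fp_def by blast
  note g = computesD[OF this]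
  obtain d2 r where "computes d2 e h r" using assms(3) unfolding fp_def by blast
  note h = computesD[OF this]
  let ?c = "dup ;; c ;; Cond 0 1 (Pop 0 ;; d) (drop_tree ;; d2)"
  show ?thesis
  proof (rule fpI[of ?c _ "q + r" _ "[:5, 50:] + 21 * p + q + r"])
    show "tsize (if f t = Leaf then g t else h t) \<le> poly (q + r) (tsize (e t))" for t
      using g(2)[of t] h(2)[of t] by auto
    fix t rest w
    let ?s = "stk (ser (f t) @ ser (e t) @ rest) w"
    let ?s' = "stk (ser (if f t = Leaf then g t else h t) @ rest) w"
    have "runs (if peek (?s 0) = 1 then Pop 0 ;; d else drop_tree ;; d2) ?s
        (1 + 20 * tsize (f t) + poly q (tsize (e t)) + poly r (tsize (e t))) ?s'"
    proof (cases "f t")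
      case Leaf
      have "runs (Pop 0) ?s 1 (stk (ser (e t) @ rest) w)" using Leaf runs_Pop[of 0 ?s] by simp
      from runs_Seq[OF this g(3)] have "runs (Pop 0 ;; d) ?s (1 + 1 + poly q (tsize (e t))) (stk (ser (g t) @ rest) w)" .
      then show ?thesis using Leaf by (auto elim!: runs_mono)
    next
      case (Node a b)
      from runs_Seq[OF runs_drop_tree h(3)]
      have "runs (drop_tree ;; d2) ?s (1 + 20 * tsize (f t) + poly r (tsize (e t))) (stk (ser (h t) @ rest) w)" .
      then show ?thesis using Node by (auto elim!: runs_mono)
    qed
    note branch = this
    have "runs ?c (stk (ser (e t) @ rest) w) (1 + 50 * tsize (e t) + (1 + poly p (tsize (e t)) +
       (1 + (1 + 20 * tsize (f t) + poly q (tsize (e t)) + poly r (tsize (e t)))))) ?s'"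
      by (rule runs_Seq runs_dup f(3) runs_Cond branch)+
    then show "runs ?c (stk (ser (e t) @ rest) w) (poly ([:5, 50:] + 21 * p + q + r) (tsize (e t))) ?s'"
      by (rule runs_mono) (use f(2)[of t] in simp)
  qed (use f g h in simp)
qed

text \<open>Every mismatch between registers 2 and 3 is recorded by a symbol on register 4.\<close>

definition mark_mismatches :: com where
  "mark_mismatches = Until 2 0 (Cond 2 1 (Cond 3 1 Skip (Push 4 1)) (Cond 3 2 Skip (Push 4 1)) ;; Pop 2 ;; Pop 3)"

lemma runs_mark_mismatches:
  assumes "set l \<subseteq> {1, 2}"
  shows "\<exists>fl'. runs mark_mismatches (st m w l l' fl) (15 * length l + 1) (st m w [] (drop (length l) l') fl') \<and>
    (fl' = [] \<longleftrightarrow> fl = [] \<and> take (length l) l' = l) \<and> length fl' \<le> length fl + length l \<and> set fl' \<subseteq> insert 1 (set fl)"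
  using assms
proof (induction l arbitrary: l' fl)
  case Nil
  show ?case
    by (rule exI[of _ fl]) (use runs_Until_stop[of "st m w [] l' fl" 2 0] in \<open>auto simp: mark_mismatches_def\<close>)
next
  case (Cons s l)
  let ?c = "Cond 2 1 (Cond 3 1 Skip (Push 4 1)) (Cond 3 2 Skip (Push 4 1)) ;; Pop 2 ;; Pop 3"
  let ?fl = "if peek l' = s then fl else 1 # fl"
  have "go ?c (st m w (s # l) l' fl) = st m w l (tl l') ?fl" using Cons.prems by auto
  then have step: "runs ?c (st m w (s # l) l' fl) 14 (st m w l (tl l') ?fl)"
    by (intro runs_goI) simp_all
  obtain fl' where fl': "runs mark_mismatches (st m w l (tl l') ?fl) (15 * length l + 1) (st m w [] (drop (length l) (tl l')) fl')"
    "fl' = [] \<longleftrightarrow> ?fl = [] \<and> take (length l) (tl l') = l" "length fl' \<le> length ?fl + length l" "set fl' \<subseteq> insert 1 (set ?fl)"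
    using Cons.IH[of "tl l'" ?fl] Cons.prems by auto
  have "peek (st m w (s # l) l' fl 2) \<noteq> 0" using Cons.prems by auto
  from runs_Until_step[OF this step fl'(1)[unfolded mark_mismatches_def], folded mark_mismatches_def]
  have "runs mark_mismatches (st m w (s # l) l' fl) (15 * length (s # l) + 1) (st m w [] (drop (length (s # l)) l') fl')"
    by (simp add: drop_Suc)
  moreover have "fl' = [] \<longleftrightarrow> fl = [] \<and> take (length (s # l)) l' = s # l"
    using fl'(2) Cons.prems by (cases l') auto
  ultimately show ?case using fl'(3,4) by (intro exI[of _ fl']) (auto split: if_splits)
qed

text \<open>If the first tree is longer, register 3 runs empty and peeks as 0, which counts as a
  mismatch. If the second is longer, the first \<open>Cond\<close> finds the remainder in register
  3, records it and clears it.\<close>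

definition compare :: com where
  "compare = take_tree 0 2 ;; take_tree 0 3 ;; mark_mismatches ;; Cond 3 0 Skip (Push 4 1 ;; clear 3) ;;
     Cond 4 0 (pushes (ser (Node Leaf Leaf))) (clear 4 ;; pushes (ser Leaf))"

definition tree_of_bool :: "bool \<Rightarrow> tree" where
  "tree_of_bool b = (if b then Node Leaf Leaf else Leaf)"

lemma wf_compare: "wf_com compare"
  by (simp add: compare_def take_tree_def take_step_def mark_mismatches_def clear_def)

lemma runs_compare:
  "runs compare (stk (ser a @ ser b @ rest) w) (40 * (tsize a + tsize b) + 40) (stk (ser (tree_of_bool (a = b)) @ rest) w)"
proof -
  let ?l = "rev (ser a)" and ?l' = "rev (ser b)"
  have sub: "set ?l \<subseteq> {1, 2}" using set_ser[of a] by simp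
  have 1: "runs (take_tree 0 2) (stk (ser a @ ser b @ rest) w) (3 + 12 * tsize a) (st (ser b @ rest) w ?l [] [])"
    using runs_take_tree[of 0 2 "stk (ser a @ ser b @ rest) w" a "ser b @ rest"] by simp
  have 2: "runs (take_tree 0 3) (st (ser b @ rest) w ?l [] []) (3 + 12 * tsize b) (st rest w ?l ?l' [])"
    using runs_take_tree[of 0 3 "st (ser b @ rest) w ?l [] []" b rest] by simp
  let ?d = "drop (tsize a) ?l'"
  obtain fl where fl: "runs mark_mismatches (st rest w ?l ?l' []) (15 * tsize a + 1) (st rest w [] ?d fl)"
    "fl = [] \<longleftrightarrow> take (tsize a) ?l' = ?l" "length fl \<le> tsize a" "set fl \<subseteq> {1}"
    using runs_mark_mismatches[OF sub, of rest w ?l' "[]"] by auto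
  define fl1 where "fl1 = (if ?d = [] then fl else 1 # fl)"
  have d0: "0 \<notin> set ?d" using zero_notin_ser[of b] set_drop_subset[of "tsize a" ?l'] by auto
  have 3: "runs (Cond 3 0 Skip (Push 4 1 ;; clear 3)) (st rest w [] ?d fl) (1 + (3 + (2 * tsize b + 1))) (st rest w [] [] fl1)"
  proof (rule runs_Cond)
    have "runs (clear 3) (st rest w [] ?d (1 # fl)) (2 * length ?d + 1) (st rest w [] [] (1 # fl))"
      using runs_clear[of "st rest w [] ?d (1 # fl)" 3] d0 by simp
    moreover have "runs (Push 4 1) (st rest w [] ?d fl) 1 (st rest w [] ?d (1 # fl))"
      using runs_Push[of 4 1 "st rest w [] ?d fl"] by simp
    ultimately have "runs (Push 4 1 ;; clear 3) (st rest w [] ?d fl) (1 + 1 + (2 * length ?d + 1)) (st rest w [] [] (1 # fl))"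
      by (intro runs_Seq)
    then have A: "runs (Push 4 1 ;; clear 3) (st rest w [] ?d fl) (3 + (2 * tsize b + 1)) (st rest w [] [] (1 # fl))"
      by (rule runs_mono) simp
    have B: "runs Skip (st rest w [] [] fl) (3 + (2 * tsize b + 1)) (st rest w [] [] fl)"
      by (rule runs_mono[OF runs_Skip]) simp
    have "peek ?d = 0 \<longleftrightarrow> ?d = []" using d0 by (cases ?d) auto
    then show "runs (if peek (st rest w [] ?d fl 3) = 0 then Skip else Push 4 1 ;; clear 3) (st rest w [] ?d fl)
        (3 + (2 * tsize b + 1)) (st rest w [] [] fl1)"
      using A B unfolding fl1_def by (auto simp del: drop_eq_Nil)
  qed
  have fl1: "0 \<notin> set fl1" "length fl1 \<le> Suc (tsize a)" using fl(3,4) by (auto simp: fl1_def)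
  have "fl1 = [] \<longleftrightarrow> take (tsize a) ?l' = ?l \<and> ?d = []" using fl(2) by (auto simp: fl1_def)
  also have "\<dots> \<longleftrightarrow> ?l' = ?l"
    by (metis append_Nil2 append_take_drop_id drop_all length_rev length_ser order_refl take_all)
  also have "\<dots> \<longleftrightarrow> a = b" by (auto simp: ser_inject)
  finally have eq: "fl1 = [] \<longleftrightarrow> a = b" .
  have 4: "runs (Cond 4 0 (pushes (ser (Node Leaf Leaf))) (clear 4 ;; pushes (ser Leaf))) (st rest w [] [] fl1)
      (1 + (2 * tsize a + 10)) (stk (ser (tree_of_bool (a = b)) @ rest) w)"
  proof (rule runs_Cond)
    have "runs (clear 4) (st rest w [] [] fl1) (2 * length fl1 + 1) (stk rest w)"
      using runs_clear[of "st rest w [] [] fl1" 4] fl1 by simp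
    from runs_Seq[OF this runs_pushes[of "ser Leaf"]]
    have A: "runs (clear 4 ;; pushes (ser Leaf)) (st rest w [] [] fl1) (2 * tsize a + 10) (stk (ser Leaf @ rest) w)"
      by (rule runs_mono) (use fl1 in simp)
    have B: "runs (pushes (ser (Node Leaf Leaf))) (stk rest w) (2 * tsize a + 10) (stk (ser (Node Leaf Leaf) @ rest) w)"
      by (rule runs_mono[OF runs_pushes]) simp
    have "peek fl1 = 0 \<longleftrightarrow> fl1 = []" using fl1 by (cases fl1) auto
    then show "runs (if peek (st rest w [] [] fl1 4) = 0 then pushes (ser (Node Leaf Leaf)) else clear 4 ;; pushes (ser Leaf))
      (st rest w [] [] fl1) (2 * tsize a + 10) (stk (ser (tree_of_bool (a = b)) @ rest) w)"
      using A B eq by (auto simp: tree_of_bool_def simp del: ser.simps)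
  qed
  have "runs compare (stk (ser a @ ser b @ rest) w) (1 + (3 + 12 * tsize a) + (1 + (3 + 12 * tsize b) +
      (1 + (15 * tsize a + 1) + (1 + (1 + (3 + (2 * tsize b + 1))) + (1 + (2 * tsize a + 10))))))
      (stk (ser (tree_of_bool (a = b)) @ rest) w)"
    unfolding compare_def by (rule runs_Seq 1 2 3 4 fl(1))+
  then show ?thesis by (rule runs_mono) simp
qed

lemma fp_eq:
  assumes "fp e f" "fp e g"
  shows "fp e (\<lambda>t. tree_of_bool (f t = g t))"
proof -
  obtain c p where c: "wf_com c" "\<And>t. tsize (f t) + tsize (g t) \<le> poly p (tsize (e t))"
    "\<And>t rest w. runs c (stk (ser (e t) @ rest) w) (poly p (tsize (e t))) (stk (ser (f t) @ ser (g t) @ rest) w)"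
    using runs_both[OF assms] by blast
  show ?thesis
  proof (rule fpI[of "c ;; compare" _ "[:3:]" _ "[:41:] + 41 * p"])
    fix t rest w
    show "tsize (tree_of_bool (f t = g t)) \<le> poly [:3:] (tsize (e t))" by (simp add: tree_of_bool_def)
    show "runs (c ;; compare) (stk (ser (e t) @ rest) w) (poly ([:41:] + 41 * p) (tsize (e t)))
        (stk (ser (tree_of_bool (f t = g t)) @ rest) w)"
      by (rule runs_mono[OF runs_Seq[OF c(3) runs_compare]]) (use c(2)[of t] in simp)
  qed (use c wf_compare in simp)
qed

section \<open>Bounded iteration\<close>

primrec spine :: "tree \<Rightarrow> nat" where
  "spine Leaf = 0"
| "spine (Node a b) = Suc (spine b)"

lemma spine_le: "spine t \<le> tsize t"
  by (induction t) auto

text \<open>The counter is the top tree. Removing its root symbol leaves its two children; the left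
  one is dropped and the right one is the counter of the next round.\<close>

definition repeat :: "com \<Rightarrow> com" where
  "repeat c = Until 0 1 (Pop 0 ;; drop_tree ;; swap ;; c ;; swap)"

lemma runs_repeat:
  assumes h: "\<And>t rest w. runs c (stk (ser (e t) @ rest) w) (poly p (tsize (e t))) (stk (ser (e (h t)) @ rest) w)"
    and "\<And>i. i \<le> spine n \<Longrightarrow> tsize (e ((h ^^ i) s)) \<le> B" and "tsize n \<le> N"
  shows "runs (repeat c) (stk (ser n @ ser (e s) @ rest) w) (spine n * (80 * N + 60 * B + poly p B + 6) + 1)
    (stk (ser Leaf @ ser (e ((h ^^ spine n) s)) @ rest) w)"
  using assms(2,3)
proof (induction n arbitrary: s)
  case Leaf
  then show ?case using runs_Until_stop[of "stk (ser Leaf @ ser (e s) @ rest) w" 0 1] by (simp add: repeat_def)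
next
  case (Node a n)
  let ?s = "stk (ser (Node a n) @ ser (e s) @ rest) w"
  let ?s1 = "stk (ser n @ ser (e (h s)) @ rest) w"
  have B: "tsize (e ((h ^^ i) (h s))) \<le> B" if "i \<le> spine n" for i
    using Node.prems(1)[of "Suc i"] that by (simp add: funpow_Suc_right del: funpow.simps)
  have le: "tsize (e s) \<le> B" "tsize (e (h s)) \<le> B" using Node.prems(1)[of 0] B[of 0] by simp_all
  have "runs (Pop 0) ?s 1 (stk (ser a @ ser n @ ser (e s) @ rest) w)"
    using runs_Pop[of 0 ?s] by simp
  note pop = this
  have "runs (Pop 0 ;; drop_tree ;; swap ;; c ;; swap) ?s (1 + 1 + (1 + 20 * tsize a + (1 + 30 * (tsize n + tsize (e s)) +
      (1 + poly p (tsize (e s)) + 30 * (tsize (e (h s)) + tsize n))))) ?s1"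
    by (rule runs_Seq pop runs_drop_tree runs_swap h)+
  then have step: "runs (Pop 0 ;; drop_tree ;; swap ;; c ;; swap) ?s (80 * N + 60 * B + poly p B + 5) ?s1"
    by (rule runs_mono) (use le Node.prems(2) poly_mono_nat[OF le(1), of p] in simp)
  have rest: "runs (repeat c) ?s1 (spine n * (80 * N + 60 * B + poly p B + 6) + 1)
    (stk (ser Leaf @ ser (e ((h ^^ spine n) (h s))) @ rest) w)"
    by (rule Node.IH(2)) (use B Node.prems(2) in auto)
  have "peek (?s 0) \<noteq> 1" by simp
  from runs_Until_step[OF this step rest[unfolded repeat_def], folded repeat_def]
  have "runs (repeat c) ?s (spine (Node a n) * (80 * N + 60 * B + poly p B + 6) + 1)
    (stk (ser Leaf @ ser (e ((h ^^ spine n) (h s))) @ rest) w)"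
    by (rule runs_mono) simp
  then show ?case by (simp add: funpow_Suc_right del: funpow.simps)
qed

text \<open>A polynomial-time step may square the size in every round, so a polynomial bound on all
  iterates is demanded in advance; it also bounds the time of each round. The iterated state may
  have a coding \<open>e'\<close> different from that of the input.\<close>

lemma fp_iterate:
  assumes "fp e n" "fp e (\<lambda>t. e' (s t))" "fp e' (\<lambda>t. e' (h t))"
    and bound: "\<And>t i. i \<le> spine (n t) \<Longrightarrow> tsize (e' ((h ^^ i) (s t))) \<le> poly b (tsize (e t))"
  shows "fp e (\<lambda>t. e' ((h ^^ spine (n t)) (s t)))"
proof -
  obtain c p where c: "wf_com c" "\<And>t. tsize (n t) + tsize (e' (s t)) \<le> poly p (tsize (e t))"
    "\<And>t rest w. runs c (stk (ser (e t) @ rest) w) (poly p (tsize (e t))) (stk (ser (n t) @ ser (e' (s t)) @ rest) w)"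
    using runs_both[OF assms(1,2)] by blast
  obtain d r where "computes d e' (\<lambda>t. e' (h t)) r" using assms(3) unfolding fp_def by blast
  note h = computesD[OF this]
  let ?k = "80 * p + 60 * b + pcompose r b + [:6:]"
  show ?thesis
  proof (rule fpI[of "c ;; repeat d ;; Pop 0" _ b _ "[:4:] + p + p * ?k"])
    fix t rest w
    let ?f = "e' ((h ^^ spine (n t)) (s t))"
    show "tsize ?f \<le> poly b (tsize (e t))" by (rule bound) simp
    have N: "tsize (n t) \<le> poly p (tsize (e t))" using c(2)[of t] by simp
    have 1: "runs (repeat d) (stk (ser (n t) @ ser (e' (s t)) @ rest) w) (spine (n t) * poly ?k (tsize (e t)) + 1)
       (stk (ser Leaf @ ser ?f @ rest) w)"
      using runs_repeat[OF h(3) bound N] by (simp add: poly_pcompose add.assoc)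
    have 2: "runs (Pop 0) (stk (ser Leaf @ ser ?f @ rest) w) 1 (stk (ser ?f @ rest) w)"
      using runs_Pop[of 0 "stk (ser Leaf @ ser ?f @ rest) w"] by simp
    have "runs (c ;; repeat d ;; Pop 0) (stk (ser (e t) @ rest) w)
       (1 + poly p (tsize (e t)) + (1 + (spine (n t) * poly ?k (tsize (e t)) + 1) + 1)) (stk (ser ?f @ rest) w)"
      by (rule runs_Seq c(3) 1 2)+
    moreover have "spine (n t) * poly ?k (tsize (e t)) \<le> poly p (tsize (e t)) * poly ?k (tsize (e t))"
      using spine_le[of "n t"] N by (intro mult_right_mono) auto
    ultimately show "runs (c ;; repeat d ;; Pop 0) (stk (ser (e t) @ rest) w) (poly ([:4:] + p + p * ?k) (tsize (e t)))
       (stk (ser ?f @ rest) w)"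
      by (elim runs_mono) simp
  qed (use c h in \<open>simp add: repeat_def\<close>)
qed

section \<open>Bit strings as input and output\<close>

primrec tree_of_bits :: "bool list \<Rightarrow> tree" where
  "tree_of_bits [] = Leaf"
| "tree_of_bits (b # l) = Node (tree_of_bool b) (tree_of_bits l)"

lemma tsize_tree_of_bits: "length l \<le> tsize (tree_of_bits l)" "tsize (tree_of_bits l) \<le> 1 + 4 * length l"
  by (induction l) (auto simp: tree_of_bool_def)

text \<open>The tree is built from the last bit backwards, hence the reversal into register 2. The
  strings \<open>[2, 1]\<close> and \<open>[2, 2, 1, 1]\<close> are a node symbol followed by the
  code of \<open>False\<close> or of \<open>True\<close>.\<close>

definition read_input :: com where
  "read_input = pour 0 2 ;; Push 0 1 ;;
     Until 2 0 (Cond 2 1 (Pop 2 ;; pushes [2, 1]) (Pop 2 ;; pushes [2, 2, 1, 1]))"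

definition write_output :: com where
  "write_output = Until 0 1 (Pop 0 ;; Cond 0 1 (Pop 0 ;; Push 1 1) (Pop 0 ;; Pop 0 ;; Pop 0 ;; Push 1 2))"

lemma wf_io: "wf_com read_input" "wf_com write_output"
  by (simp_all add: read_input_def write_output_def pour_def)

lemma runs_read_input:
  "runs read_input (stk (map bit_symbol x) []) (40 * length x + 10) (stk (ser (tree_of_bits x)) [])"
proof -
  let ?c = "Cond 2 1 (Pop 2 ;; pushes [2, 1]) (Pop 2 ;; pushes [2, 2, 1, 1])"
  have loop: "runs (Until 2 0 ?c) (st (ser (tree_of_bits l)) [] (map bit_symbol l') [] []) (30 * length l' + 1)
      (stk (ser (tree_of_bits (rev l' @ l))) [])" for l l'
  proof (induction l' arbitrary: l)
    case Nil
    then show ?case using runs_Until_stop[of "stk (ser (tree_of_bits l)) []" 2 0] by simp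
  next
    case (Cons b l')
    let ?s = "st (ser (tree_of_bits l)) [] (map bit_symbol (b # l')) [] []"
    have step: "runs ?c ?s 29 (st (ser (tree_of_bits (b # l))) [] (map bit_symbol l') [] [])"
      by (rule runs_goI) (auto simp: bit_symbol_def tree_of_bool_def)
    have "peek (?s 2) \<noteq> 0" by (simp add: bit_symbol_def)
    from runs_Until_step[OF this step Cons.IH] have "runs (Until 2 0 ?c) ?s (1 + 29 + (30 * length l' + 1))
      (stk (ser (tree_of_bits (rev l' @ b # l))) [])" .
    then show ?case by simp
  qed
  have "set (map bit_symbol x) \<subseteq> {1, 2}" by (auto simp: bit_symbol_def)
  then have 1: "runs (pour 0 2) (stk (map bit_symbol x) []) (8 * length x + 1) (st [] [] (rev (map bit_symbol x)) [] [])"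
    using runs_pour[of "stk (map bit_symbol x) []" 0 2] by simp
  have 2: "runs (Push 0 1) (st [] [] (rev (map bit_symbol x)) [] []) 1 (st (ser (tree_of_bits [])) [] (map bit_symbol (rev x)) [] [])"
    using runs_Push[of 0 1 "st [] [] (rev (map bit_symbol x)) [] []"] by (simp add: rev_map)
  have 3: "runs (Until 2 0 ?c) (st (ser (tree_of_bits [])) [] (map bit_symbol (rev x)) [] []) (30 * length x + 1)
      (stk (ser (tree_of_bits x)) [])"
    using loop[of "[]" "rev x"] by simp
  have "runs read_input (stk (map bit_symbol x) []) (1 + (8 * length x + 1) + (1 + 1 + (30 * length x + 1)))
     (stk (ser (tree_of_bits x)) [])"
    unfolding read_input_def by (rule runs_Seq 1 2 3)+
  then show ?thesis by (rule runs_mono) simp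
qed

lemma runs_write_output:
  "runs write_output (stk (ser (tree_of_bits y)) w) (30 * length y + 1) (stk [1] (rev (map bit_symbol y) @ w))"
proof (induction y arbitrary: w)
  case Nil
  then show ?case using runs_Until_stop[of "stk (ser (tree_of_bits [])) w" 0 1] by (simp add: write_output_def)
next
  case (Cons b y)
  let ?c = "Pop 0 ;; Cond 0 1 (Pop 0 ;; Push 1 1) (Pop 0 ;; Pop 0 ;; Pop 0 ;; Push 1 2)"
  let ?s = "stk (ser (tree_of_bits (b # y))) w"
  have step: "runs ?c ?s 29 (stk (ser (tree_of_bits y)) (bit_symbol b # w))"
    by (rule runs_goI) (auto simp: bit_symbol_def tree_of_bool_def)
  have "peek (?s 0) \<noteq> 1" by simp
  from runs_Until_step[OF this step Cons.IH[unfolded write_output_def], folded write_output_def]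
  show ?case by simp
qed

lemma fp_polytime_computable:
  assumes "fp tree_of_bits (\<lambda>x. tree_of_bits (f x))"
  shows "polytime_computable f"
proof -
  obtain c p where "computes c tree_of_bits (\<lambda>x. tree_of_bits (f x)) p"
    using assms unfolding fp_def by blast
  note c = computesD[OF this]
  \<comment> \<open>\<open>[:1, 4:]\<close> bounds the size of the code of a bit string in terms of
    its length.\<close>
  let ?q = "pcompose p [:1, 4:]"
  show ?thesis
  proof (rule polytime_computableI[of "read_input ;; c ;; write_output" "[:20, 40:] + 31 * ?q"])
    fix x
    let ?n = "tsize (tree_of_bits x)"
    have start: "input_store x = stk (map bit_symbol x) []"
      by (auto simp: input_store_def st_def fun_eq_iff)
    have 1: "runs c (stk (ser (tree_of_bits x)) []) (poly p ?n) (stk (ser (tree_of_bits (f x))) [])"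
      using c(3)[of x "[]" "[]"] by simp
    have "runs (read_input ;; c ;; write_output) (input_store x) (1 + (40 * length x + 10) + (1 + poly p ?n + (30 * length (f x) + 1)))
       (stk [1] (rev (map bit_symbol (f x)) @ []))"
      unfolding start by (rule runs_Seq runs_read_input 1 runs_write_output)+
    moreover have "poly p ?n \<le> poly ?q (length x)"
      using tsize_tree_of_bits(2)[of x] by (simp add: poly_pcompose poly_mono_nat mult.commute)
    moreover have "length (f x) \<le> poly p ?n"
      using c(2)[of x] tsize_tree_of_bits(1)[of "f x"] by simp
    ultimately show "\<exists>n\<le>poly ([:20, 40:] + 31 * ?q) (length x).
        \<exists>\<sigma>. runs (read_input ;; c ;; write_output) (input_store x) n \<sigma> \<and> \<sigma> 1 = rev (map bit_symbol (f x))"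
      by (intro exI[of _ "1 + (40 * length x + 10) + (1 + poly p ?n + (30 * length (f x) + 1))"] conjI
          exI[of _ "stk [1] (rev (map bit_symbol (f x)) @ [])"]) (simp_all del: One_nat_def)
  qed (use c(1) wf_io in simp)
qed

section \<open>Polynomial-time functions on encodable types\<close>

text \<open>Injectivity reduces equality of values to equality of trees, which
  \<open>compare\<close> decides.\<close>

class encodable =
  fixes encode :: "'a \<Rightarrow> tree"
  assumes encode_inject: "encode x = encode y \<longleftrightarrow> x = y"

instantiation bool :: encodable
begin
definition "encode = tree_of_bool"
instance by standard (simp add: encode_bool_def tree_of_bool_def)
end

text \<open>Unary coding. Times, positions and vertex indices are all polynomially bounded, so this
  costs nothing essential, and a number can directly count the rounds of a loop. Only a budget can
  be too large; it is kept as a bit string.\<close>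

instantiation nat :: encodable
begin
primrec encode_nat :: "nat \<Rightarrow> tree" where
  "encode_nat 0 = Leaf"
| "encode_nat (Suc n) = Node Leaf (encode_nat n)"
instance
proof
  fix x y :: nat show "encode x = encode y \<longleftrightarrow> x = y"
    by (induction x arbitrary: y) (case_tac y; simp)+
qed
end

instantiation list :: (encodable) encodable
begin
primrec encode_list :: "'a list \<Rightarrow> tree" where
  "encode_list [] = Leaf"
| "encode_list (a # l) = Node (encode a) (encode_list l)"
instance
proof
  fix x y :: "'a list" show "encode x = encode y \<longleftrightarrow> x = y"
    by (induction x arbitrary: y) (case_tac y; simp add: encode_inject)+
qed
end

instantiation prod :: (encodable, encodable) encodable
begin
definition "encode = (\<lambda>(a, b). Node (encode a) (encode b))"
instance by standard (auto simp: encode_prod_def encode_inject)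
end

definition esize :: "'a :: encodable \<Rightarrow> nat" where
  "esize x = tsize (encode x)"

lemma esize_simps [simp]:
  "esize (0 :: nat) = 1" "esize (Suc n) = 2 + esize n"
  "esize ([] :: 'a :: encodable list) = 1" "esize (a # l) = 1 + esize a + esize l"
  "esize (b, c) = 1 + esize b + esize c"
  by (simp_all add: esize_def encode_prod_def)

lemma esize_append: "esize (l @ m) < esize l + esize m"
  by (induction l) auto

lemma length_le_esize: "length l \<le> esize l"
  by (induction l) auto

lemma esize_mem: "a \<in> set l \<Longrightarrow> esize a \<le> esize l"
  by (induction l) auto

lemma esize_drop: "esize (drop i l) \<le> esize l"
  by (induction l arbitrary: i) (auto simp: drop_Cons split: nat.split intro: le_SucI trans_le_add2)

lemma esize_tl: "esize (tl l) \<le> esize l"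
  by (cases l) auto

definition polyfun :: "('a :: encodable \<Rightarrow> 'b :: encodable) \<Rightarrow> bool" where
  "polyfun f \<longleftrightarrow> fp encode (\<lambda>x. encode (f x))"

lemma polyfun_esize:
  assumes "polyfun f"
  obtains p where "\<And>x. esize (f x) \<le> poly p (esize x)"
  using assms unfolding polyfun_def esize_def fp_def computes_def by blast

lemma polyfun_polytime_computable: "polyfun f \<Longrightarrow> polytime_computable f"
proof -
  have "encode = tree_of_bits"
  proof
    show "encode x = tree_of_bits x" for x by (induction x) (auto simp: encode_bool_def)
  qed
  then show "polyfun f \<Longrightarrow> polytime_computable f"
    unfolding polyfun_def by (simp add: fp_polytime_computable)
qed

text \<open>Closure rules that follow the structure of a term, so that \<open>intro pf\<close>
  establishes polynomial-time computability of an explicit definition. An argument with a bound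
  variable is treated in uncurried form, as a function of the parameter paired with that
  variable.\<close>

named_theorems pf

lemma pf_id [pf]: "polyfun (\<lambda>x. x)"
  unfolding polyfun_def by (rule fp_id)

lemma pf_const [pf]: "polyfun (\<lambda>x. c)"
  unfolding polyfun_def by (rule fp_const)

lemma pf_comp: "polyfun f \<Longrightarrow> polyfun g \<Longrightarrow> polyfun (\<lambda>x. f (g x))"
  unfolding polyfun_def by (rule fp_comp)

lemma pf_Pair [pf]: "polyfun f \<Longrightarrow> polyfun g \<Longrightarrow> polyfun (\<lambda>x. (f x, g x))"
  unfolding polyfun_def encode_prod_def by (simp add: fp_Node)

lemma pf_fst [pf]: "polyfun f \<Longrightarrow> polyfun (\<lambda>x. fst (f x))"
proof (rule pf_comp[of fst])
  have "encode (fst x) = tfst (encode x)" for x :: "'b \<times> 'c" by (cases x) (simp add: encode_prod_def)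
  then show "polyfun (fst :: 'b \<times> 'c \<Rightarrow> 'b)" unfolding polyfun_def by (simp add: fp_tfst)
qed

lemma pf_snd [pf]: "polyfun f \<Longrightarrow> polyfun (\<lambda>x. snd (f x))"
proof (rule pf_comp[of snd])
  have "encode (snd x) = tsnd (encode x)" for x :: "'b \<times> 'c" by (cases x) (simp add: encode_prod_def)
  then show "polyfun (snd :: 'b \<times> 'c \<Rightarrow> 'c)" unfolding polyfun_def by (simp add: fp_tsnd)
qed

lemma pf_if [pf]:
  assumes "polyfun c" "polyfun f" "polyfun g"
  shows "polyfun (\<lambda>x. if c x then f x else g x)"
proof -
  have eq: "encode (if c x then f x else g x) = (if encode (c x) = Leaf then encode (g x) else encode (f x))" for x
    by (simp add: encode_bool_def tree_of_bool_def)
  show ?thesis using assms unfolding polyfun_def eq by (intro fp_if)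
qed

lemma pf_eq [pf]: "polyfun f \<Longrightarrow> polyfun g \<Longrightarrow> polyfun (\<lambda>x. f x = g x)"
  using fp_eq[of encode "\<lambda>x. encode (f x)" "\<lambda>x. encode (g x)"]
  by (simp add: polyfun_def encode_bool_def encode_inject)

lemma pf_not [pf]: "polyfun f \<Longrightarrow> polyfun (\<lambda>x. \<not> f x)"
proof -
  have eq: "(\<not> f x) = (if f x then False else True)" for x by simp
  show "polyfun f \<Longrightarrow> polyfun (\<lambda>x. \<not> f x)" unfolding eq by (intro pf)
qed

lemma pf_conj [pf]: "polyfun f \<Longrightarrow> polyfun g \<Longrightarrow> polyfun (\<lambda>x. f x \<and> g x)"
proof -
  have eq: "(f x \<and> g x) = (if f x then g x else False)" for x by simp
  show "polyfun f \<Longrightarrow> polyfun g \<Longrightarrow> polyfun (\<lambda>x. f x \<and> g x)" unfolding eq by (intro pf)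
qed

lemma pf_disj [pf]: "polyfun f \<Longrightarrow> polyfun g \<Longrightarrow> polyfun (\<lambda>x. f x \<or> g x)"
proof -
  have eq: "(f x \<or> g x) = (if f x then True else g x)" for x by simp
  show "polyfun f \<Longrightarrow> polyfun g \<Longrightarrow> polyfun (\<lambda>x. f x \<or> g x)" unfolding eq by (intro pf)
qed

lemma pf_imp [pf]: "polyfun f \<Longrightarrow> polyfun g \<Longrightarrow> polyfun (\<lambda>x. f x \<longrightarrow> g x)"
proof -
  have eq: "(f x \<longrightarrow> g x) = (if f x then g x else True)" for x by simp
  show "polyfun f \<Longrightarrow> polyfun g \<Longrightarrow> polyfun (\<lambda>x. f x \<longrightarrow> g x)" unfolding eq by (intro pf)
qed

lemma pf_Cons [pf]: "polyfun f \<Longrightarrow> polyfun g \<Longrightarrow> polyfun (\<lambda>x. f x # g x)"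
  unfolding polyfun_def by (simp add: fp_Node)

lemma pf_Suc [pf]: "polyfun f \<Longrightarrow> polyfun (\<lambda>x. Suc (f x))"
  unfolding polyfun_def by (simp add: fp_Node fp_const)

lemma pf_tl [pf]: "polyfun f \<Longrightarrow> polyfun (\<lambda>x. tl (f x))"
proof (rule pf_comp[of tl])
  have "encode (tl l) = tsnd (encode l)" for l :: "'b list" by (cases l) auto
  then show "polyfun (tl :: 'b list \<Rightarrow> _)" unfolding polyfun_def by (simp add: fp_tsnd)
qed

lemma pf_pred: "polyfun f \<Longrightarrow> polyfun (\<lambda>x. f x - Suc 0)"
proof (rule pf_comp[of "\<lambda>n. n - Suc 0"])
  have "encode (n - Suc 0) = tsnd (encode n)" for n :: nat by (cases n) auto
  then show "polyfun (\<lambda>n. n - Suc 0)" unfolding polyfun_def by (simp add: fp_tsnd)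
qed

definition head :: "'a \<Rightarrow> 'a list \<Rightarrow> 'a" where
  "head d l = (case l of [] \<Rightarrow> d | a # _ \<Rightarrow> a)"

lemma head_simps [simp]: "head d [] = d" "head d (a # l) = a"
  by (simp_all add: head_def)

lemma pf_head [pf]: "polyfun f \<Longrightarrow> polyfun (\<lambda>x. head d (f x))"
proof (rule pf_comp[of "head d"])
  have eq: "encode (head d l) = (if encode l = Leaf then encode d else tfst (encode l))" for l by (cases l) auto
  show "polyfun (head d)" unfolding polyfun_def eq by (intro fp_if fp_id fp_const fp_tfst)
qed

lemma pf_case_list [pf]:
  assumes "polyfun l" "polyfun g" "polyfun (\<lambda>p. h (fst p) (fst (snd p)) (snd (snd p)))"
  shows "polyfun (\<lambda>x. case l x of [] \<Rightarrow> g x | a # r \<Rightarrow> h x a r)"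
proof -
  \<comment> \<open>The default of \<open>head\<close> is arbitrary, since that branch is taken for
    nonempty lists only.\<close>
  have eq: "(case l x of [] \<Rightarrow> g x | a # r \<Rightarrow> h x a r) =
      (if l x = [] then g x else (\<lambda>p. h (fst p) (fst (snd p)) (snd (snd p))) (x, head undefined (l x), tl (l x)))" for x
    by (cases "l x") auto
  show ?thesis unfolding eq by (intro pf assms(1,2) pf_comp[OF assms(3)])
qed

text \<open>\<open>False\<close> is coded by a leaf, so a number and a list of that many
  \<open>False\<close> have the same code and the identity program converts one into the other. This
  turns iteration by a number into a fold.\<close>

lemma polyfun_nat_list_cast: "polyfun (\<lambda>n. replicate n False)"
proof -
  have "encode (replicate n False) = encode n" for n
    by (induction n) (simp_all add: encode_bool_def tree_of_bool_def)
  then show ?thesis unfolding polyfun_def by (simp add: fp_id)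
qed

section \<open>Iteration and folds over lists\<close>

lemma pf_iterate:
  fixes stp :: "'c :: encodable \<Rightarrow> 'c"
  assumes "polyfun stp" "polyfun l" "polyfun s"
    and bound: "\<And>x i. i \<le> length (l x) \<Longrightarrow> esize ((stp ^^ i) (s x)) \<le> poly b (esize x)"
  shows "polyfun (\<lambda>x. (stp ^^ length (l x)) (s x))"
proof -
  have sp: "spine (encode l) = length l" for l :: "'b list" by (induction l) auto
  have "fp encode (\<lambda>x. encode ((stp ^^ spine (encode (l x))) (s x)))"
    by (rule fp_iterate[where n = "\<lambda>x. encode (l x)" and s = s and e' = encode and b = b]) (use assms in \<open>auto simp: polyfun_def esize_def sp\<close>)
  then show ?thesis by (simp add: polyfun_def sp)
qed

text \<open>A fold is an iteration whose state consists of the remaining list, the parameter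
  \<open>x\<close>, which the step may use, and the accumulator.\<close>

lemma pf_fold:
  assumes l: "polyfun l" and s: "polyfun s"
    and h: "polyfun (\<lambda>p. h (fst p) (fst (snd p)) (snd (snd p)))"
    and bound: "\<And>x i. i \<le> length (l x) \<Longrightarrow> esize (fold (h x) (take i (l x)) (s x)) \<le> poly b (esize x)"
  shows "polyfun (\<lambda>x. fold (h x) (l x) (s x))"
proof -
  define stp where "stp = (\<lambda>q. case fst q of [] \<Rightarrow> q
    | a # r \<Rightarrow> (r, fst (snd q), h (fst (snd q)) a (snd (snd q))))"
  have "polyfun stp"
    unfolding stp_def
    by (intro pf pf_comp[OF h, of "\<lambda>p. (fst (snd (fst p)), fst (snd p), snd (snd (fst p)))", simplified])
  have iter: "(stp ^^ i) (l x, x, s x) = (drop i (l x), x, fold (h x) (take i (l x)) (s x))" if "i \<le> length (l x)" for x i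
    using that
  proof (induction i)
    case (Suc i)
    then have "drop i (l x) = l x ! i # drop (Suc i) (l x)" by (simp add: Cons_nth_drop_Suc)
    then show ?case using Suc by (simp add: stp_def take_Suc_conv_app_nth)
  qed simp
  obtain p where p: "\<And>x. esize (l x) \<le> poly p (esize x)" using polyfun_esize[OF l] by blast
  have "polyfun (\<lambda>x. (stp ^^ length (l x)) (l x, x, s x))"
  proof (rule pf_iterate[OF \<open>polyfun stp\<close> l, where b = "[:2, 1:] + p + b"])
    fix x i assume i: "i \<le> length (l x)"
    show "esize ((stp ^^ i) (l x, x, s x)) \<le> poly ([:2, 1:] + p + b) (esize x)"
      using iter[OF i] bound[OF i] esize_drop[of i "l x"] p[of x] by simp
  qed ((intro pf l s)+)
  then have "polyfun (\<lambda>x. snd (snd ((stp ^^ length (l x)) (l x, x, s x))))" by (intro pf)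
  then show ?thesis by (simp add: iter)
qed

text \<open>The usual way to meet the size bound: each round adds at most an amount that depends on
  the parameter and the list element but not on the accumulator, so growth is a polynomial number of
  polynomial summands.\<close>

lemma pf_fold_add:
  assumes l: "polyfun l" and s: "polyfun s"
    and h: "polyfun (\<lambda>p. h (fst p) (fst (snd p)) (snd (snd p)))"
    and k: "polyfun (\<lambda>p. k (fst p) (snd p))"
    and le: "\<And>x a acc. esize (h x a acc) \<le> esize acc + esize (k x a)"
  shows "polyfun (\<lambda>x. fold (h x) (l x) (s x))"
proof -
  obtain p where p: "\<And>x. esize (l x) \<le> poly p (esize x)" using polyfun_esize[OF l] by blast
  obtain q where q: "\<And>x. esize (s x) \<le> poly q (esize x)" using polyfun_esize[OF s] by blast
  obtain r where r: "\<And>y. esize (k (fst y) (snd y)) \<le> poly r (esize y)" using polyfun_esize[OF k] by blast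
  \<comment> \<open>If \<open>x\<close> has size n, a pair \<open>(x, a)\<close> with
    \<open>a\<close> from \<open>l x\<close> has size at most 1 + n + p(n).\<close>
  let ?r = "pcompose r ([:1, 1:] + p)"
  have k': "esize (k x a) \<le> poly ?r (esize x)" if "a \<in> set (l x)" for x a
  proof -
    have "esize (k x a) \<le> poly r (esize (x, a))" using r[of "(x, a)"] by simp
    also have "\<dots> \<le> poly ?r (esize x)"
      using esize_mem[OF that] p[of x] by (simp add: poly_pcompose poly_mono_nat)
    finally show ?thesis .
  qed
  show ?thesis
  proof (rule pf_fold[OF l s h, where b = "q + p * ?r"])
    fix x i assume i: "i \<le> length (l x)"
    have "esize (fold (h x) m (s x)) \<le> esize (s x) + length m * poly ?r (esize x)" if "set m \<subseteq> set (l x)" for m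
      using that
    proof (induction m rule: rev_induct)
      case (snoc a m)
      then show ?case using le[of x a "fold (h x) m (s x)"] k'[of a x] by simp
    qed simp
    from this[OF set_take_subset[of i]]
    have "esize (fold (h x) (take i (l x)) (s x)) \<le> esize (s x) + i * poly ?r (esize x)"
      using i by (simp add: min_absorb2)
    also have "\<dots> \<le> poly q (esize x) + poly p (esize x) * poly ?r (esize x)"
      using q[of x] i length_le_esize[of "l x"] p[of x] by (intro add_mono mult_right_mono) auto
    finally show "esize (fold (h x) (take i (l x)) (s x)) \<le> poly (q + p * ?r) (esize x)" by simp
  qed
qed

lemma pf_funpow_add:
  fixes h :: "'a :: encodable \<Rightarrow> 'b :: encodable \<Rightarrow> 'b"
  assumes n: "polyfun n" and s: "polyfun s"
    and h: "polyfun (\<lambda>p. h (fst p) (snd p))"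
    and k: "polyfun k" and le: "\<And>x acc. esize (h x acc) \<le> esize acc + esize (k x)"
  shows "polyfun (\<lambda>x. (h x ^^ n x) (s x))"
proof -
  have "polyfun (\<lambda>x. fold (\<lambda>_. h x) (replicate (n x) False) (s x))"
    by (rule pf_fold_add[where k = "\<lambda>x a. k x"])
      (use le in \<open>auto intro!: pf s pf_comp[OF polyfun_nat_list_cast n] pf_comp[OF k]
        pf_comp[OF h, of "\<lambda>p. (fst p, snd (snd p))", simplified]\<close>)
  then show ?thesis by (simp add: fold_replicate)
qed

section \<open>Library functions on lists and numbers\<close>

lemma pf_rev [pf]: "polyfun l \<Longrightarrow> polyfun (\<lambda>x. rev (l x))"
proof -
  assume l: "polyfun l"
  have "polyfun (\<lambda>x. fold (\<lambda>a acc. a # acc) (l x) [])"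
    by (rule pf_fold_add[where k = "\<lambda>x a. [a]"]) ((intro pf l)+, simp)
  then show ?thesis by (simp add: rev_conv_fold)
qed

lemma pf_append [pf]: 
  assumes "polyfun l" "polyfun m" shows "polyfun (\<lambda>x. l x @ m x)"
proof -
  have "polyfun (\<lambda>x. fold (\<lambda>a acc. a # acc) (rev (l x)) (m x))"
    by (rule pf_fold_add[where k = "\<lambda>x a. [a]"]) ((intro pf assms)+, simp)
  then show ?thesis by (simp add: fold_Cons_rev)
qed

lemma pf_map [pf]:
  assumes l: "polyfun l" and f: "polyfun (\<lambda>p. f (fst p) (snd p))"
  shows "polyfun (\<lambda>x. map (\<lambda>a. f x a) (l x))"
proof -
  have "polyfun (\<lambda>x. rev (fold (\<lambda>a acc. f x a # acc) (l x) []))"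
    by (rule pf_rev, rule pf_fold_add[where k = "\<lambda>x a. [f x a]"])
      ((intro pf l f pf_comp[OF f, of "\<lambda>p. (fst p, fst (snd p))", simplified])+, simp)
  moreover have "fold (\<lambda>a acc. f x a # acc) m acc = rev (map (f x) m) @ acc" for x m acc
    by (induction m arbitrary: acc) auto
  ultimately show ?thesis by simp
qed

lemma pf_concat [pf]: 
  assumes l: "polyfun l" shows "polyfun (\<lambda>x. concat (l x))"
proof -
  have "polyfun (\<lambda>x. fold (\<lambda>a acc. acc @ a) (l x) [])"
    by (rule pf_fold_add[where k = "\<lambda>x a. a"]) ((intro pf l)+, rule less_imp_le[OF esize_append])
  moreover have "fold (\<lambda>a acc. acc @ a) m acc = acc @ concat m" for m and acc :: "'b list"
    by (induction m arbitrary: acc) auto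
  ultimately show ?thesis by simp
qed

lemma pf_filter [pf]:
  assumes l: "polyfun l" and f: "polyfun (\<lambda>p. f (fst p) (snd p))"
  shows "polyfun (\<lambda>x. filter (\<lambda>a. f x a) (l x))"
proof -
  have "polyfun (\<lambda>x. concat (map (\<lambda>a. if f x a then [a] else []) (l x)))"
    by (intro pf l f)
  moreover have "concat (map (\<lambda>a. if P a then [a] else []) m) = filter P m" for P and m :: "'b list"
    by (induction m) auto
  ultimately show ?thesis by simp
qed

lemma pf_length [pf]:
  assumes l: "polyfun l" shows "polyfun (\<lambda>x. length (l x))"
proof -
  have "polyfun (\<lambda>x. fold (\<lambda>_ n. Suc n) (l x) 0)"
    by (rule pf_fold_add[where k = "\<lambda>x a. Suc 0"]) ((intro pf l)+, simp)
  moreover have "fold (\<lambda>_ n. Suc n) m n = length m + n" for m :: "'b list" and n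
    by (induction m arbitrary: n) auto
  ultimately show ?thesis by simp
qed

lemma pf_replicate [pf]:
  assumes "polyfun n" "polyfun a" shows "polyfun (\<lambda>x. replicate (n x) (a x))"
proof -
  have "polyfun (\<lambda>x. map (\<lambda>_. a x) (replicate (n x) False))"
    by (intro pf pf_comp[OF assms(2)] pf_comp[OF polyfun_nat_list_cast assms(1)])
  then show ?thesis by (simp add: map_replicate)
qed

lemma pf_plus [pf]:
  assumes "polyfun m" "polyfun n" shows "polyfun (\<lambda>x. m x + n x :: nat)"
proof -
  have "polyfun (\<lambda>x. (Suc ^^ m x) (n x))"
    by (rule pf_funpow_add[where k = "\<lambda>x. Suc 0"]) ((intro pf assms)+, simp)
  then show ?thesis by simp
qed

lemma esize_nat: "esize (n :: nat) = 2 * n + 1"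
  by (induction n) auto

lemma pf_minus [pf]:
  assumes "polyfun m" "polyfun n" shows "polyfun (\<lambda>x. m x - n x :: nat)"
proof -
  have "polyfun (\<lambda>x. ((\<lambda>k. k - Suc 0) ^^ n x) (m x))"
    by (rule pf_funpow_add[where k = "\<lambda>x. 0 :: nat"]) ((intro pf pf_pred assms)+, simp add: esize_nat)
  moreover have "((\<lambda>k. k - Suc 0) ^^ n) m = m - n" for m n by (induction n) auto
  ultimately show ?thesis by simp
qed

lemma pf_times [pf]:
  assumes "polyfun m" "polyfun n" shows "polyfun (\<lambda>x. m x * n x :: nat)"
proof -
  have "polyfun (\<lambda>x. ((\<lambda>k. m x + k) ^^ n x) 0)"
    by (rule pf_funpow_add[where k = m]) ((intro pf assms pf_comp[OF assms(1)])+, simp add: esize_nat)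
  moreover have "((\<lambda>k. m + k) ^^ n) 0 = m * n" for m n :: nat by (induction n) auto
  ultimately show ?thesis by simp
qed

lemma pf_less [pf]: "polyfun m \<Longrightarrow> polyfun n \<Longrightarrow> polyfun (\<lambda>x. (m x :: nat) < n x)"
proof -
  have eq: "(m x < n x) = (n x - m x \<noteq> 0)" for x by auto
  show "polyfun m \<Longrightarrow> polyfun n \<Longrightarrow> polyfun (\<lambda>x. (m x :: nat) < n x)" unfolding eq by (intro pf)
qed

lemma pf_le [pf]: "polyfun m \<Longrightarrow> polyfun n \<Longrightarrow> polyfun (\<lambda>x. (m x :: nat) \<le> n x)"
proof -
  have eq: "(m x \<le> n x) = (m x - n x = 0)" for x by auto
  show "polyfun m \<Longrightarrow> polyfun n \<Longrightarrow> polyfun (\<lambda>x. (m x :: nat) \<le> n x)" unfolding eq by (intro pf)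
qed

lemma pf_upt [pf]:
  assumes n: "polyfun n" shows "polyfun (\<lambda>x. [0..<n x])"
proof -
  have "polyfun (\<lambda>x. ((\<lambda>acc. (n x - Suc (length acc)) # acc) ^^ n x) [])"
    by (rule pf_funpow_add[where k = "\<lambda>x. [n x]"]) ((intro pf assms pf_comp[OF n])+, simp add: esize_nat)
  moreover have "((\<lambda>acc. (n - Suc (length acc)) # acc) ^^ i) [] = [n - i..<n]" if "i \<le> n" for i n
    using that
  proof (induction i)
    case (Suc i)
    then have "[n - Suc i..<n] = (n - Suc i) # [n - i..<n]" by (simp add: upt_conv_Cons Suc_diff_Suc)
    then show ?case using Suc by simp
  qed simp
  ultimately show ?thesis by simp
qed

lemma pf_ball [pf]:
  assumes "polyfun l" "polyfun (\<lambda>p. P (fst p) (snd p))"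
  shows "polyfun (\<lambda>x. \<forall>a\<in>set (l x). P x a)"
proof -
  have "polyfun (\<lambda>x. filter (\<lambda>a. \<not> P x a) (l x) = [])" by (intro pf assms)
  then show ?thesis by (simp add: filter_empty_conv)
qed

lemma pf_all_less [pf]:
  fixes n :: "'a :: encodable \<Rightarrow> nat"
  assumes "polyfun n" "polyfun (\<lambda>p. P (fst p) (snd p))"
  shows "polyfun (\<lambda>x. \<forall>i<n x. P x i)"
proof -
  have "polyfun (\<lambda>x. \<forall>i\<in>set [0..<n x]. P x i)" by (intro pf assms)
  then show ?thesis by (simp add: Ball_def)
qed

lemma pf_drop [pf]:
  assumes "polyfun n" "polyfun l" shows "polyfun (\<lambda>x. drop (n x) (l x))"
proof -
  have "polyfun (\<lambda>x. (tl ^^ n x) (l x))"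
    by (rule pf_funpow_add[where k = "\<lambda>x. Suc 0"]) ((intro pf assms)+, rule trans_le_add1[OF esize_tl])
  moreover have "(tl ^^ n) l = drop n l" for n and l :: "'b list"
    by (induction n) (auto simp: drop_Suc tl_drop)
  ultimately show ?thesis by simp
qed

text \<open>A total variant of \<open>!\<close> with a known value outside the list, so that it is
  computable on every argument.\<close>

definition entry :: "'a \<Rightarrow> 'a list \<Rightarrow> nat \<Rightarrow> 'a" where
  "entry d l i = head d (drop i l)"

lemma entry_nth: "i < length l \<Longrightarrow> entry d l i = l ! i"
  by (simp add: entry_def Cons_nth_drop_Suc[symmetric])

lemma pf_entry [pf]: "polyfun l \<Longrightarrow> polyfun i \<Longrightarrow> polyfun (\<lambda>x. entry d (l x) (i x))"
  unfolding entry_def by (intro pf)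

text \<open>The length \<open>k\<close> is a constant and not part of the input; this keeps the list
  of all tuples polynomial, with the exponent growing with \<open>k\<close>.\<close>

lemma pf_n_lists [pf]: "polyfun l \<Longrightarrow> polyfun (\<lambda>x. List.n_lists k (l x))"
proof (induction k)
  case (Suc k)
  show ?case unfolding List.n_lists.simps
    by (intro pf Suc.IH Suc.prems pf_comp[OF Suc.prems])
qed (simp add: pf_const)

lemma pf_poly [pf]: "polyfun n \<Longrightarrow> polyfun (\<lambda>x. poly p (n x) :: nat)"
proof (induction p)
  case (pCons a p)
  show ?case unfolding poly_pCons by (intro pf pCons)
qed (simp add: pf_const)

lemma pf_div [pf]:
  assumes "polyfun m" "polyfun n" shows "polyfun (\<lambda>x. (m x :: nat) div n x)"
proof -
  \<comment> \<open>The quotient is the number of positive multiples of the divisor up to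
    \<open>m x\<close>.\<close>
  have "polyfun (\<lambda>x. if n x = 0 then 0 else length (filter (\<lambda>i. Suc i * n x \<le> m x) [0..<m x]))"
    by (intro pf assms pf_comp[OF assms(1)] pf_comp[OF assms(2)])
  moreover have "(if n = 0 then 0 else length (filter (\<lambda>i. Suc i * n \<le> m) [0..<m])) = m div n" for m n :: nat
  proof (cases "n = 0")
    case False
    have "Suc i * n \<le> m \<longleftrightarrow> i < m div n" for i
      using False less_eq_div_iff_mult_less_eq[of n "Suc i" m] by (simp add: Suc_le_eq)
    moreover have "filter (\<lambda>i. i < k) [0..<m] = [0..<k]" if "k \<le> m" for k
      using that by (induction m) (auto simp: le_Suc_eq filter_empty_conv intro!: filter_True)
    ultimately show ?thesis using False div_le_dividend[of m n] by simp
  qed simp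
  ultimately show ?thesis by simp
qed

lemma pf_mod [pf]: "polyfun m \<Longrightarrow> polyfun n \<Longrightarrow> polyfun (\<lambda>x. (m x :: nat) mod n x)"
proof -
  have eq: "m x mod n x = m x - m x div n x * n x" for x by (simp add: minus_div_mult_eq_mod)
  show "polyfun m \<Longrightarrow> polyfun n \<Longrightarrow> polyfun (\<lambda>x. (m x :: nat) mod n x)" unfolding eq by (intro pf)
qed

lemma pf_delimit [pf]: "polyfun x \<Longrightarrow> polyfun (\<lambda>y. delimit (x y))"
  unfolding delimit_def by (intro pf)

section \<open>Membership in NP\<close>

text \<open>Intervals described by betweenness, with bounded quantifiers only, so that the condition
  can be tested by the closure rules.\<close>

definition consec :: "(nat \<Rightarrow> bool) \<Rightarrow> nat \<Rightarrow> bool" where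
  "consec f n \<longleftrightarrow> (\<forall>a<n. \<forall>b<n. \<forall>c<n. a < b \<longrightarrow> b < c \<longrightarrow> f a \<longrightarrow> f c \<longrightarrow> f b)"

lemma consec_iff: "(\<exists>a b. {j. j < n \<and> f j} = {a..<b}) \<longleftrightarrow> consec f n"
proof
  assume "\<exists>a b. {j. j < n \<and> f j} = {a..<b}"
  then obtain a b where eq: "{j. j < n \<and> f j} = {a..<b}" by blast
  have "j < n \<and> f j \<longleftrightarrow> a \<le> j \<and> j < b" for j using eq by (metis atLeastLessThan_iff mem_Collect_eq)
  then show "consec f n" unfolding consec_def by (meson less_imp_le order.trans order.strict_trans)
next
  assume c: "consec f n"
  let ?S = "{j. j < n \<and> f j}"
  show "\<exists>a b. ?S = {a..<b}"
  proof (cases "?S = {}")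
    case True
    then show ?thesis by (intro exI[of _ 0]) auto
  next
    case False
    have fin: "finite ?S" by simp
    have "?S = {Min ?S..<Suc (Max ?S)}"
    proof
      show "?S \<subseteq> {Min ?S..<Suc (Max ?S)}" using fin by (auto simp: less_Suc_eq_le)
      show "{Min ?S..<Suc (Max ?S)} \<subseteq> ?S"
      proof
        fix j assume j: "j \<in> {Min ?S..<Suc (Max ?S)}"
        have mem: "Min ?S \<in> ?S" "Max ?S \<in> ?S" using Min_in[OF fin False] Max_in[OF fin False] by auto
        consider "j = Min ?S" | "j = Max ?S" | "Min ?S < j" "j < Max ?S" using j by fastforce
        then show "j \<in> ?S"
        proof cases
          case 3
          then have "j < n" using mem(2) by simp
          with 3 mem c show ?thesis unfolding consec_def by blast
        qed (use mem in simp_all)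
      qed
    qed
    then show ?thesis by blast
  qed
qed

text \<open>\<open>submatrix\<close> numbers the kept indices by \<open>pick\<close>. The kept sets
  are complements of finite sets, hence infinite, but only their elements below the dimension
  matter.\<close>

lemma pick_bij:
  assumes "infinite I"
  shows "bij_betw (pick I) {..<card {i. i < n \<and> i \<in> I}} {i. i < n \<and> i \<in> I}"
proof (rule bij_betw_imageI)
  show "inj_on (pick I) {..<card {i. i < n \<and> i \<in> I}}"
    using pick_eq_iff_inf[OF assms] by (auto intro: inj_onI)
  show "pick I ` {..<card {i. i < n \<and> i \<in> I}} = {i. i < n \<and> i \<in> I}"
  proof (intro equalityI subsetI)
    fix i assume "i \<in> pick I ` {..<card {i. i < n \<and> i \<in> I}}"
    then show "i \<in> {i. i < n \<and> i \<in> I}" using pick_le pick_in_set_inf[OF assms] by auto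
  next
    fix i assume i: "i \<in> {i. i < n \<and> i \<in> I}"
    let ?k = "card {a \<in> I. a < i}"
    have "{a \<in> I. a < i} \<subset> {i. i < n \<and> i \<in> I}" using i by auto
    then have "?k < card {i. i < n \<and> i \<in> I}" by (intro psubset_card_mono) auto
    moreover have "pick I ?k = i" using pick_card_in_set i by auto
    ultimately show "i \<in> pick I ` {..<card {i. i < n \<and> i \<in> I}}" by force
  qed
qed

definition kept :: "nat \<Rightarrow> nat set \<Rightarrow> nat" where
  "kept n R = card {i. i < n \<and> i \<in> - R}"

lemma kept: 
  assumes "R \<subseteq> {..<n}"
  shows "kept n R = n - card R"
proof -
  have "{i. i < n \<and> i \<in> - R} = {..<n} - R" by auto
  then show ?thesis using assms by (simp add: kept_def card_Diff_subset finite_subset)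
qed

lemma pick_kept_bij:
  assumes "finite R"
  shows "bij_betw (pick (- R)) {..<kept n R} ({..<n} - R)"
proof -
  have "infinite (- R)" using assms by (simp add: finite_compl)
  from pick_bij[OF this, of n] show ?thesis by (simp add: kept_def set_diff_eq)
qed

text \<open>Certificates for the deletion problem: the rows and the columns that are kept, each listed in
  an order that witnesses the property.\<close>

definition witness :: "nat \<Rightarrow> nat \<Rightarrow> (nat \<Rightarrow> nat \<Rightarrow> bool) \<Rightarrow> nat list \<Rightarrow> nat list \<Rightarrow> bool" where
  "witness r c M rs cs \<longleftrightarrow>
     (\<forall>i<length rs. \<forall>j<length rs. i < j \<longrightarrow> entry 0 rs i \<noteq> entry 0 rs j) \<and>
     (\<forall>i<length cs. \<forall>j<length cs. i < j \<longrightarrow> entry 0 cs i \<noteq> entry 0 cs j) \<and>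
     (\<forall>i<length rs. entry 0 rs i < r) \<and> (\<forall>i<length cs. entry 0 cs i < c) \<and>
     (\<forall>i<length rs. consec (\<lambda>j. M (entry 0 rs i) (entry 0 cs j)) (length cs)) \<and>
     (\<forall>j<length cs. consec (\<lambda>i. M (entry 0 rs i) (entry 0 cs j)) (length rs))"

lemma distinct_entry: "(\<forall>i<length l. \<forall>j<length l. i < j \<longrightarrow> entry 0 l i \<noteq> entry 0 l j) \<longleftrightarrow> distinct l"
  unfolding distinct_conv_nth
proof (intro iffI allI impI)
  fix i j assume "\<forall>i<length l. \<forall>j<length l. i < j \<longrightarrow> entry 0 l i \<noteq> entry 0 l j" "i < length l" "j < length l" "i \<noteq> j"
  then show "l ! i \<noteq> l ! j" by (cases "i < j") (metis entry_nth, metis entry_nth nat_neq_iff)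
next
  fix i j assume "\<forall>i<length l. \<forall>j<length l. i \<noteq> j \<longrightarrow> l ! i \<noteq> l ! j" "i < length l" "j < length l" "i < j"
  then show "entry 0 l i \<noteq> entry 0 l j" by (simp add: entry_nth)
qed

lemma all_entry_less: "(\<forall>i<length l. entry 0 l i < r) \<longleftrightarrow> set l \<subseteq> {..<r}"
  by (auto simp: entry_nth subset_iff in_set_conv_nth)

lemma consec_cong: "(\<And>i. i < n \<Longrightarrow> f i = g i) \<Longrightarrow> consec f n = consec g n"
  by (simp add: consec_def cong: imp_cong)

lemma witness_iff:
  "witness r c M rs cs \<longleftrightarrow> distinct rs \<and> distinct cs \<and> set rs \<subseteq> {..<r} \<and> set cs \<subseteq> {..<c} \<and>
     (\<forall>i<length rs. consec (\<lambda>j. M (rs ! i) (cs ! j)) (length cs)) \<and>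
     (\<forall>j<length cs. consec (\<lambda>i. M (rs ! i) (cs ! j)) (length rs))"
  unfolding witness_def distinct_entry all_entry_less
  by (simp add: entry_nth cong: consec_cong)

text \<open>A column order is good or bad for each row separately, whatever the order of the rows.
  So each half may be checked on the rearranged matrix; inverse permutations bring an arbitrary row
  or column of \<open>B\<close> into the form treated by the hypotheses.\<close>

lemma SC1P_witness:
  assumes "dim_row B = length rs" "dim_col B = length cs" 
    "\<rho> permutes {..<length rs}" "\<pi> permutes {..<length cs}"
    "\<And>i j. i < length rs \<Longrightarrow> j < length cs \<Longrightarrow> B $$ (\<rho> i, \<pi> j) = M (rs ! i) (cs ! j)"
    "\<forall>i<length rs. consec (\<lambda>j. M (rs ! i) (cs ! j)) (length cs)"
    "\<forall>j<length cs. consec (\<lambda>i. M (rs ! i) (cs ! j)) (length rs)"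
  shows "SC1P B"
proof -
  have "consec (\<lambda>j. B $$ (i, \<pi> j)) (dim_col B)" if "i < dim_row B" for i
  proof -
    from that have "inv_into UNIV \<rho> i \<in> {..<length rs}"
      using permutes_in_image[OF permutes_inv[OF assms(3)], of i] assms(1) by simp
    then have "consec (\<lambda>j. B $$ (\<rho> (inv_into UNIV \<rho> i), \<pi> j)) (length cs)"
      using assms(5,6) consec_cong[of "length cs" "\<lambda>j. B $$ (\<rho> (inv_into UNIV \<rho> i), \<pi> j)"] by simp
    then show ?thesis using permutes_inverses(1)[OF assms(3)] assms(2) by simp
  qed
  moreover have "consec (\<lambda>i. B $$ (\<rho> i, j)) (dim_row B)" if "j < dim_col B" for j
  proof -
    from that have "inv_into UNIV \<pi> j \<in> {..<length cs}"
      using permutes_in_image[OF permutes_inv[OF assms(4)], of j] assms(2) by simp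
    then have "consec (\<lambda>i. B $$ (\<rho> i, \<pi> (inv_into UNIV \<pi> j))) (length rs)"
      using assms(5,7) consec_cong[of "length rs" "\<lambda>i. B $$ (\<rho> i, \<pi> (inv_into UNIV \<pi> j))"] by simp
    then show ?thesis using permutes_inverses(1)[OF assms(4)] assms(1) by simp
  qed
  ultimately show ?thesis
    unfolding SC1P_def C1P_rows_def C1P_cols_def consec_iff using assms(1-4) by metis
qed

text \<open>A duplicate-free list differs from the enumeration of its elements by
  \<open>pick\<close> only by a permutation, namely the list followed by the inverse of that
  enumeration.\<close>

lemma list_permutation:
  assumes "distinct xs" "set xs \<subseteq> {..<n}"
  shows "kept n ({..<n} - set xs) = length xs"
    and "\<exists>\<pi>. \<pi> permutes {..<length xs} \<and> (\<forall>j<length xs. pick (- ({..<n} - set xs)) (\<pi> j) = xs ! j)"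
proof -
  let ?R = "{..<n} - set xs"
  have "{i. i < n \<and> i \<in> - ?R} = set xs" using assms(2) by auto
  then show len: "kept n ?R = length xs" by (simp add: kept_def distinct_card[OF assms(1)])
  have "{..<n} - ?R = set xs" using assms(2) by auto
  then have bij: "bij_betw (pick (- ?R)) {..<length xs} (set xs)"
    using pick_kept_bij[of ?R n] len by simp
  have nth: "bij_betw ((!) xs) {..<length xs} (set xs)" by (rule bij_betw_nth[OF assms(1)]) auto
  let ?g = "the_inv_into {..<length xs} (pick (- ?R))"
  let ?\<pi> = "\<lambda>j. if j < length xs then ?g (xs ! j) else j"
  have "bij_betw (?g \<circ> (!) xs) {..<length xs} {..<length xs}"
    by (rule bij_betw_trans[OF nth bij_betw_the_inv_into[OF bij]])
  then have "bij_betw ?\<pi> {..<length xs} {..<length xs}"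
    by (subst bij_betw_cong[of _ _ "?g \<circ> (!) xs"]) auto
  then have "?\<pi> permutes {..<length xs}" by (rule bij_imp_permutes) auto
  moreover have "pick (- ?R) (?\<pi> j) = xs ! j" if "j < length xs" for j
    using that f_the_inv_into_f_bij_betw[OF bij, of "xs ! j"] by simp
  ultimately show "\<exists>\<pi>. \<pi> permutes {..<length xs} \<and> (\<forall>j<length xs. pick (- ?R) (\<pi> j) = xs ! j)" by blast
qed

lemma permutation_list:
  assumes "R \<subseteq> {..<n}" "\<pi> permutes {..<kept n R}"
  defines "xs \<equiv> map (\<lambda>j. pick (- R) (\<pi> j)) [0..<kept n R]"
  shows "distinct xs" "set xs \<subseteq> {..<n}"
proof -
  have bij: "bij_betw (pick (- R)) {..<kept n R} ({..<n} - R)"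
    using assms(1) by (intro pick_kept_bij finite_subset[OF assms(1)]) simp
  have "bij_betw (pick (- R) \<circ> \<pi>) {..<kept n R} ({..<n} - R)"
    by (rule bij_betw_trans[OF permutes_imp_bij[OF assms(2)] bij])
  moreover have "{..<kept n R} = set [0..<kept n R]" by auto
  ultimately have "inj_on (pick (- R) \<circ> \<pi>) (set [0..<kept n R])" "(pick (- R) \<circ> \<pi>) ` set [0..<kept n R] = {..<n} - R"
    by (auto simp: bij_betw_def)
  then show "distinct xs" "set xs \<subseteq> {..<n}" by (auto simp: xs_def distinct_map inj_on_def)
qed

lemma SC1P_deletion_iff:
  "SC1P_deletion A k \<longleftrightarrow> (\<exists>rs cs. witness (dim_row A) (dim_col A) (\<lambda>i j. A $$ (i, j)) rs cs \<and>
     (dim_row A - length rs) + (dim_col A - length cs) \<le> k)"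
proof
  assume "SC1P_deletion A k"
  then obtain R C where RC: "R \<subseteq> {..<dim_row A}" "C \<subseteq> {..<dim_col A}" "card R + card C \<le> k"
    and B: "SC1P (delete_rows_cols A R C)" unfolding SC1P_deletion_def by blast
  let ?B = "delete_rows_cols A R C"
  have dim: "dim_row ?B = kept (dim_row A) R" "dim_col ?B = kept (dim_col A) C"
    by (simp_all add: delete_rows_cols_def dim_submatrix kept_def)
  obtain \<pi> where \<pi>: "\<pi> permutes {..<dim_col ?B}" "\<forall>i<dim_row ?B. consec (\<lambda>j. ?B $$ (i, \<pi> j)) (dim_col ?B)"
    using B unfolding SC1P_def C1P_rows_def consec_iff by blast
  obtain \<rho> where \<rho>: "\<rho> permutes {..<dim_row ?B}" "\<forall>j<dim_col ?B. consec (\<lambda>i. ?B $$ (\<rho> i, j)) (dim_row ?B)"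
    using B unfolding SC1P_def C1P_cols_def consec_iff by blast
  define rs where "rs = map (\<lambda>j. pick (- R) (\<rho> j)) [0..<dim_row ?B]"
  define cs where "cs = map (\<lambda>j. pick (- C) (\<pi> j)) [0..<dim_col ?B]"
  have len: "length rs = dim_row ?B" "length cs = dim_col ?B" by (simp_all add: rs_def cs_def)
  have lt: "\<rho> i < dim_row ?B" "\<pi> j < dim_col ?B" if "i < dim_row ?B" "j < dim_col ?B" for i j
    using that permutes_in_image[OF \<rho>(1), of i] permutes_in_image[OF \<pi>(1), of j] by simp_all
  have ent: "A $$ (rs ! i, cs ! j) = ?B $$ (\<rho> i, \<pi> j)" if "i < dim_row ?B" "j < dim_col ?B" for i j
    using lt[OF that] that by (simp add: rs_def cs_def delete_rows_cols_def dim_submatrix submatrix_index)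
  have "witness (dim_row A) (dim_col A) (\<lambda>i j. A $$ (i, j)) rs cs"
    unfolding witness_iff
  proof (intro conjI allI impI)
    show "distinct rs" "set rs \<subseteq> {..<dim_row A}" "distinct cs" "set cs \<subseteq> {..<dim_col A}"
      using permutation_list[OF RC(1), of \<rho>] permutation_list[OF RC(2), of \<pi>] \<rho>(1) \<pi>(1)
      unfolding dim rs_def cs_def by auto
    fix i assume "i < length rs"
    then have i: "i < dim_row ?B" by (simp add: len)
    have "consec (\<lambda>j. A $$ (rs ! i, cs ! j)) (length cs) = consec (\<lambda>j. ?B $$ (\<rho> i, \<pi> j)) (length cs)"
      by (rule consec_cong) (use ent[OF i] len in simp)
    then show "consec (\<lambda>j. A $$ (rs ! i, cs ! j)) (length cs)"
      using \<pi>(2) permutes_in_image[OF \<rho>(1), of i] i by (simp add: len)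
  next
    fix j assume "j < length cs"
    then have j: "j < dim_col ?B" by (simp add: len)
    have "consec (\<lambda>i. A $$ (rs ! i, cs ! j)) (length rs) = consec (\<lambda>i. ?B $$ (\<rho> i, \<pi> j)) (length rs)"
      by (rule consec_cong) (use ent[OF _ j] len in simp)
    then show "consec (\<lambda>i. A $$ (rs ! i, cs ! j)) (length rs)"
      using \<rho>(2) permutes_in_image[OF \<pi>(1), of j] j by (simp add: len)
  qed
  moreover have "card R \<le> dim_row A" "card C \<le> dim_col A"
    using RC card_mono[OF _ RC(1)] card_mono[OF _ RC(2)] by simp_all
  then have "(dim_row A - length rs) + (dim_col A - length cs) \<le> k"
    using RC(3) by (simp add: len dim kept[OF RC(1)] kept[OF RC(2)])
  ultimately show "\<exists>rs cs. witness (dim_row A) (dim_col A) (\<lambda>i j. A $$ (i, j)) rs cs \<and>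
     (dim_row A - length rs) + (dim_col A - length cs) \<le> k" by blast
next
  assume "\<exists>rs cs. witness (dim_row A) (dim_col A) (\<lambda>i j. A $$ (i, j)) rs cs \<and>
     (dim_row A - length rs) + (dim_col A - length cs) \<le> k"
  then obtain rs cs where w: "distinct rs" "distinct cs" "set rs \<subseteq> {..<dim_row A}" "set cs \<subseteq> {..<dim_col A}"
     "\<forall>i<length rs. consec (\<lambda>j. A $$ (rs ! i, cs ! j)) (length cs)"
     "\<forall>j<length cs. consec (\<lambda>i. A $$ (rs ! i, cs ! j)) (length rs)"
    and k: "(dim_row A - length rs) + (dim_col A - length cs) \<le> k"
    unfolding witness_iff by blast
  let ?R = "{..<dim_row A} - set rs" and ?C = "{..<dim_col A} - set cs"
  let ?B = "delete_rows_cols A ?R ?C"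
  have dim: "dim_row ?B = length rs" "dim_col ?B = length cs"
    using list_permutation(1)[OF w(1,3)] list_permutation(1)[OF w(2,4)]
    unfolding kept_def delete_rows_cols_def dim_submatrix by simp_all
  obtain \<rho> where \<rho>: "\<rho> permutes {..<length rs}" "\<forall>j<length rs. pick (- ?R) (\<rho> j) = rs ! j"
    using list_permutation(2)[OF w(1,3)] by blast
  obtain \<pi> where \<pi>: "\<pi> permutes {..<length cs}" "\<forall>j<length cs. pick (- ?C) (\<pi> j) = cs ! j"
    using list_permutation(2)[OF w(2,4)] by blast
  have "SC1P ?B"
  proof (rule SC1P_witness[OF dim \<rho>(1) \<pi>(1) _ w(5,6)])
    fix i j assume ij: "i < length rs" "j < length cs"
    then have "\<rho> i < length rs" "\<pi> j < length cs"
      using permutes_in_image[OF \<rho>(1), of i] permutes_in_image[OF \<pi>(1), of j] by simp_all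
    then have "?B $$ (\<rho> i, \<pi> j) = A $$ (pick (- ?R) (\<rho> i), pick (- ?C) (\<pi> j))"
      using dim unfolding delete_rows_cols_def dim_submatrix by (intro submatrix_index) simp_all
    then show "?B $$ (\<rho> i, \<pi> j) = A $$ (rs ! i, cs ! j)" using \<rho>(2) \<pi>(2) ij by simp
  qed
  moreover have "card ?R = dim_row A - length rs" "card ?C = dim_col A - length cs"
    using w by (simp_all add: card_Diff_subset distinct_card)
  ultimately show "SC1P_deletion A k"
    unfolding SC1P_deletion_def using k by (intro exI[of _ ?R] exI[of _ ?C]) auto
qed

subsection \<open>Parsing\<close>

text \<open>The state records whether the next bit is announced data, the current block, and the
  finished blocks.\<close>

definition block_step :: "bool \<Rightarrow> bool \<times> bool list \<times> bool list list \<Rightarrow> bool \<times> bool list \<times> bool list list" where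
  "block_step b q = (if fst q then (False, fst (snd q) @ [b], snd (snd q))
     else if b then (True, snd q) else (False, [], snd (snd q) @ [fst (snd q)]))"

definition blocks :: "bool list \<Rightarrow> bool list list" where
  "blocks z = snd (snd (fold block_step z (False, [], [])))"

lemma fold_block_step_delimit:
  "fold block_step (delimit x) (False, cur, bs) = (False, [], bs @ [cur @ x])"
proof (induction x arbitrary: cur)
  case (Cons b x)
  then show ?case by (simp add: delimit_def block_step_def)
qed (simp add: delimit_def block_step_def)

lemma blocks_concat: "blocks (concat (map delimit xs)) = xs"
proof -
  have "fold block_step (concat (map delimit xs)) (False, [], bs) = (False, [], bs @ xs)" for bs
    by (induction xs arbitrary: bs) (simp_all add: fold_block_step_delimit)
  then show ?thesis by (simp add: blocks_def)
qed

text \<open>Finished blocks are never altered. Hence the input remains the first block even if an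
  arbitrary, ill-formed certificate follows.\<close>

lemma blocks_delimit_append: "\<exists>bs. blocks (delimit x @ u) = x # bs"
proof -
  have "\<exists>bs'. snd (snd (fold block_step u q)) = snd (snd q) @ bs'" for q
  proof (induction u arbitrary: q)
    case (Cons b u)
    have "snd (snd (block_step b q)) = snd (snd q) @ (if fst q \<or> b then [] else [fst (snd q)])"
      by (simp add: block_step_def)
    then obtain b1 where "snd (snd (block_step b q)) = snd (snd q) @ b1" by blast
    moreover obtain b2 where "snd (snd (fold block_step u (block_step b q))) = snd (snd (block_step b q)) @ b2"
      using Cons.IH by blast
    ultimately show ?case by simp
  qed simp
  from this[of "(False, [], [x])"] show ?thesis
    by (auto simp: blocks_def fold_block_step_delimit)
qed

lemma pf_blocks [pf]:
  assumes "polyfun z" shows "polyfun (\<lambda>x. blocks (z x))"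
proof -
  have eq: "esize (l @ m) + 1 = esize l + esize m" for l m :: "'b :: encodable list"
    by (induction l) auto
  have "polyfun (\<lambda>x. fold (\<lambda>b q. block_step b q) (z x) (False, [], []))"
  \<comment> \<open>This allowance covers what one round can add: an appended bit, a flag turning
    \<open>True\<close>, or the list cells around a finished block.\<close>
  proof (rule pf_fold_add[where k = "\<lambda>x b. [b, True, False]"])
    show "esize (block_step b q) \<le> esize q + esize [b, True, False]" for b q
      using eq[of "fst (snd q)" "[b]"] eq[of "snd (snd q)" "[fst (snd q)]"]
      by (cases q) (auto simp: block_step_def)
  qed (unfold block_step_def, (intro pf assms)+)
  then show ?thesis unfolding blocks_def by (intro pf)
qed

fun binval :: "bool list \<Rightarrow> nat" where
  "binval [] = 0"
| "binval (b # bs) = (if b then 1 else 0) + 2 * binval bs"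

lemma binval_binary: "binval (binary n) = n"
proof (induction n rule: less_induct)
  case (less n)
  show ?case
  proof (cases "n = 0")
    case False
    then show ?thesis using less[of "n div 2"] by (subst binary.simps) (auto simp: odd_two_times_div_two_succ)
  qed (simp add: binary.simps)
qed

lemma binary_binval: "bs \<noteq> [] \<Longrightarrow> last bs \<Longrightarrow> binary (binval bs) = bs \<and> 0 < binval bs"
proof (induction bs)
  case (Cons b bs)
  show ?case
  proof (cases "bs = []")
    case True
    then show ?thesis using Cons.prems by (simp add: binary.simps)
  next
    case False
    then have IH: "binary (binval bs) = bs" "0 < binval bs" using Cons by simp_all
    moreover have "binary (binval (b # bs)) = odd (binval (b # bs)) # binary (binval (b # bs) div 2)"
      using IH(2) by (subst binary.simps) auto
    ultimately show ?thesis by simp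
  qed
qed simp

lemma binary_last: "n \<noteq> 0 \<Longrightarrow> binary n \<noteq> [] \<and> last (binary n)"
proof (induction n rule: less_induct)
  case (less n)
  show ?case
  proof (cases "n div 2 = 0")
    case True
    then have "n = 1" using less.prems by linarith
    then show ?thesis by (simp add: binary.simps)
  next
    case False
    then have "binary (n div 2) \<noteq> [] \<and> last (binary (n div 2))" using less by simp
    then show ?thesis using less.prems by (subst (1 2) binary.simps) simp
  qed
qed

lemma canonical_binary: "(bs = [] \<or> head False (rev bs)) \<longleftrightarrow> (\<exists>k. bs = binary k)"
proof -
  have "head False (rev bs) \<longleftrightarrow> bs \<noteq> [] \<and> last bs"
    by (cases bs rule: rev_cases) auto
  moreover have "binary 0 = []" by (simp add: binary.simps)
  ultimately show ?thesis using binary_binval[of bs] binary_last by metis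
qed

text \<open>The budget may be exponentially large, so it is only evaluated up to a cap.\<close>

definition cap_step :: "nat \<Rightarrow> bool \<Rightarrow> nat \<Rightarrow> nat" where
  "cap_step N b v = (if N \<le> v + v + (if b then 1 else 0) then N else v + v + (if b then 1 else 0))"

definition capval :: "nat \<Rightarrow> bool list \<Rightarrow> nat" where
  "capval N bs = fold (cap_step N) (rev bs) 0"

lemma capval: "capval N bs = min N (binval bs)"
  by (induction bs) (auto simp: capval_def cap_step_def)

lemma pf_capval [pf]:
  assumes N: "polyfun N" and bs: "polyfun bs"
  shows "polyfun (\<lambda>x. capval (N x) (bs x))"
proof -
  obtain p where p: "\<And>x. esize (N x) \<le> poly p (esize x)" using polyfun_esize[OF N] by blast
  show ?thesis unfolding capval_def
  proof (rule pf_fold[where b = p])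
    fix x i assume "i \<le> length (rev (bs x))"
    have "fold (cap_step (N x)) l v \<le> N x"
      if "v \<le> N x" for l v
      using that by (induction l arbitrary: v) (auto simp: cap_step_def)
    from this[of 0]
    have "esize (fold (cap_step (N x)) l 0) \<le> esize (N x)" for l
      by (simp add: esize_nat)
    then show "esize (fold (cap_step (N x)) (take i (rev (bs x))) 0) \<le> poly p (esize x)"
      using p order.trans by blast
  qed (unfold cap_step_def, (intro pf N bs pf_comp[OF N])+)
qed

subsection \<open>The verifier\<close>

definition row_count :: "bool list list \<Rightarrow> nat" where
  "row_count ws = length (entry [] ws 0)"

definition col_count :: "bool list list \<Rightarrow> nat" where
  "col_count ws = length (entry [] ws 1)"

text \<open>The offset 2 skips the two dimension blocks.\<close>

definition cell :: "bool list list \<Rightarrow> nat \<Rightarrow> nat \<Rightarrow> bool" where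
  "cell ws i j = entry False (entry [] ws (i + 2)) j"

definition budget :: "bool list list \<Rightarrow> bool list" where
  "budget ws = entry [] ws (row_count ws + 2)"

definition well_formed :: "bool list list \<Rightarrow> bool" where
  "well_formed ws \<longleftrightarrow> length ws = row_count ws + 3 \<and>
     entry [] ws 0 = replicate (row_count ws) True \<and> entry [] ws 1 = replicate (col_count ws) True \<and>
     (\<forall>i<row_count ws. length (entry [] ws (i + 2)) = col_count ws) \<and>
     (budget ws = [] \<or> head False (rev (budget ws)))"

definition instance_blocks :: "bool mat \<Rightarrow> nat \<Rightarrow> bool list list" where
  "instance_blocks A k = replicate (dim_row A) True # replicate (dim_col A) True # mat_to_list A @ [binary k]"

lemma encode_instance_blocks: "encode_instance A k = concat (map delimit (instance_blocks A k))"
  by (simp add: encode_instance_def instance_blocks_def)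

lemma instance_blocks_simps:
  "row_count (instance_blocks A k) = dim_row A" "col_count (instance_blocks A k) = dim_col A"
  "budget (instance_blocks A k) = binary k"
  "\<And>i j. i < dim_row A \<Longrightarrow> j < dim_col A \<Longrightarrow> cell (instance_blocks A k) i j = A $$ (i, j)"
  "well_formed (instance_blocks A k)"
proof -
  let ?ws = "instance_blocks A k"
  have len: "length ?ws = dim_row A + 3" by (simp add: instance_blocks_def mat_to_list_def)
  show r: "row_count ?ws = dim_row A" and c: "col_count ?ws = dim_col A"
    by (simp_all add: row_count_def col_count_def instance_blocks_def entry_def)
  show b: "budget ?ws = binary k"
    by (simp add: budget_def r entry_nth len) (simp add: instance_blocks_def mat_to_list_def nth_append)
  have row: "entry [] ?ws (i + 2) = map (\<lambda>j. A $$ (i, j)) [0..<dim_col A]" if "i < dim_row A" for i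
    using that by (simp add: entry_nth len) (simp add: instance_blocks_def mat_to_list_def nth_append)
  then show "\<And>i j. i < dim_row A \<Longrightarrow> j < dim_col A \<Longrightarrow> cell (instance_blocks A k) i j = A $$ (i, j)"
    by (simp add: cell_def entry_nth)
  show "well_formed ?ws"
    unfolding well_formed_def r c b canonical_binary
    using row len by (auto simp: instance_blocks_def entry_def)
qed

lemma well_formed_instance:
  assumes "well_formed ws"
  obtains A k where "ws = instance_blocks A k"
proof -
  define A where "A = mat (row_count ws) (col_count ws) (\<lambda>(i, j). cell ws i j)"
  obtain k where k: "budget ws = binary k" using assms unfolding well_formed_def canonical_binary by blast
  have "ws = instance_blocks A k"
  proof (rule nth_equalityI)
    show len: "length ws = length (instance_blocks A k)"
      using assms by (simp add: well_formed_def instance_blocks_def mat_to_list_def A_def)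
    fix n assume n: "n < length ws"
    have lw: "length ws = row_count ws + 3" using assms by (simp add: well_formed_def)
    have en: "ws ! n = entry [] ws n" using n by (simp add: entry_nth)
    have "n = 0 \<or> n = 1 \<or> (\<exists>i. n = i + 2 \<and> i < row_count ws) \<or> n = row_count ws + 2"
      using n lw by presburger
    then consider "n = 0" | "n = 1" | i where "n = i + 2" "i < row_count ws" | "n = row_count ws + 2"
      by blast
    then show "ws ! n = instance_blocks A k ! n"
    proof cases
      case 1
      then show ?thesis using assms en by (simp add: well_formed_def instance_blocks_def A_def)
    next
      case 2
      then show ?thesis using assms en by (simp add: well_formed_def instance_blocks_def A_def)
    next
      case 3
      then have "length (ws ! n) = col_count ws" using assms n by (auto simp: well_formed_def entry_nth)
      moreover have "cell ws i j = ws ! n ! j" if "j < col_count ws" for j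
        using that 3 n \<open>length (ws ! n) = col_count ws\<close> by (simp add: cell_def entry_nth)
      ultimately have "ws ! n = map (\<lambda>j. cell ws i j) [0..<col_count ws]"
        by (intro nth_equalityI) simp_all
      then show ?thesis using 3 by (simp add: instance_blocks_def mat_to_list_def A_def nth_append)
    next
      case 4
      then have "ws ! n = binary k" using k n by (simp add: budget_def entry_nth)
      then show ?thesis using 4 by (simp add: instance_blocks_def mat_to_list_def A_def nth_append)
    qed
  qed
  then show ?thesis by (rule that)
qed

text \<open>With the number d of deletions itself as cap, the last condition says that d is at most
  the minimum of d and the budget, so a large budget is never evaluated.\<close>

definition accepts :: "bool list list \<Rightarrow> nat list \<Rightarrow> nat list \<Rightarrow> bool" where
  "accepts ws rs cs \<longleftrightarrow> well_formed ws \<and> witness (row_count ws) (col_count ws) (cell ws) rs cs \<and>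
     (row_count ws - length rs) + (col_count ws - length cs) \<le>
       capval ((row_count ws - length rs) + (col_count ws - length cs)) (budget ws)"

lemma witness_cong:
  assumes "\<And>i j. i < r \<Longrightarrow> j < c \<Longrightarrow> M i j = M' i j"
  shows "witness r c M rs cs = witness r c M' rs cs"
proof -
  have "consec (\<lambda>j. M (rs ! i) (cs ! j)) (length cs) = consec (\<lambda>j. M' (rs ! i) (cs ! j)) (length cs)"
    if "set rs \<subseteq> {..<r}" "set cs \<subseteq> {..<c}" "i < length rs" for i
    using that assms by (intro consec_cong) (auto simp: subset_iff)
  moreover have "consec (\<lambda>i. M (rs ! i) (cs ! j)) (length rs) = consec (\<lambda>i. M' (rs ! i) (cs ! j)) (length rs)"
    if "set rs \<subseteq> {..<r}" "set cs \<subseteq> {..<c}" "j < length cs" for j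
    using that assms by (intro consec_cong) (auto simp: subset_iff)
  ultimately show ?thesis unfolding witness_iff by blast
qed

lemma accepts_instance:
  "accepts (instance_blocks A k) rs cs \<longleftrightarrow> witness (dim_row A) (dim_col A) (\<lambda>i j. A $$ (i, j)) rs cs \<and>
     (dim_row A - length rs) + (dim_col A - length cs) \<le> k"
  unfolding accepts_def instance_blocks_simps capval binval_binary
  using witness_cong[of "dim_row A" "dim_col A" "cell (instance_blocks A k)" "\<lambda>i j. A $$ (i, j)" rs cs]
  by (auto simp: instance_blocks_simps)

text \<open>Parsing succeeds on every string, also on one that is no concatenation of delimited
  blocks; the first conjunct excludes such inputs by encoding the blocks again. The next two blocks
  list the kept rows and columns in unary.\<close>

definition verifier :: language where
  "verifier = {z. concat (map delimit (blocks (head [] (blocks z)))) = head [] (blocks z) \<and>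
     accepts (blocks (head [] (blocks z))) (map length (blocks (entry [] (blocks z) 1)))
       (map length (blocks (entry [] (blocks z) 2)))}"

lemma verifier_sound:
  assumes "pair_code x u \<in> verifier"
  shows "x \<in> SC1P_deletion_language"
proof -
  have head: "head [] (blocks (pair_code x u)) = x"
    using blocks_delimit_append[of x u] by (auto simp: pair_code_def)
  obtain rs cs where "concat (map delimit (blocks x)) = x" "accepts (blocks x) rs cs"
    using assms unfolding verifier_def mem_Collect_eq head by blast
  moreover from this obtain A k where "blocks x = instance_blocks A k"
    using well_formed_instance unfolding accepts_def by metis
  ultimately have "x = encode_instance A k" "SC1P_deletion A k"
    by (auto simp: encode_instance_blocks accepts_instance SC1P_deletion_iff)
  then show ?thesis unfolding SC1P_deletion_language_def by blast
qed

definition code_nats :: "nat list \<Rightarrow> bool list" where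
  "code_nats l = concat (map delimit (map (\<lambda>i. replicate i True) l))"

lemma length_delimit: "length (delimit x) = 2 * length x + 1"
  by (induction x) (simp_all add: delimit_def)

lemma length_code_nats:
  assumes "distinct l" "set l \<subseteq> {..<n}"
  shows "length (code_nats l) \<le> n * (2 * n + 1)"
proof -
  have "length (code_nats l) = (\<Sum>i\<leftarrow>l. 2 * i + 1)"
    by (simp add: code_nats_def length_concat length_delimit comp_def)
  also have "\<dots> \<le> (\<Sum>i\<leftarrow>l. 2 * n + 1)"
    using assms(2) by (intro sum_list_mono) auto
  also have "\<dots> = length l * (2 * n + 1)" by (simp add: sum_list_triv)
  also have "\<dots> \<le> n * (2 * n + 1)"
    using card_mono[OF _ assms(2)] by (intro mult_right_mono) (simp_all add: distinct_card[OF assms(1)])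
  finally show ?thesis .
qed

text \<open>The bound is 2 * (2 * n * (2 * n + 1) + 1) for input length n: two delimited blocks,
  each coding at most n indices below n. Both dimensions are at most n because the instance states
  them in unary.\<close>

lemma verifier_complete:
  assumes "x \<in> SC1P_deletion_language"
  obtains u where "length u \<le> poly [:2, 4, 8:] (length x)" "pair_code x u \<in> verifier"
proof -
  obtain A k where x: "x = encode_instance A k" and "SC1P_deletion A k"
    using assms unfolding SC1P_deletion_language_def by blast
  then obtain rs cs where acc: "accepts (instance_blocks A k) rs cs"
    unfolding SC1P_deletion_iff accepts_instance by blast
  define u where "u = delimit (code_nats rs) @ delimit (code_nats cs)"
  have "pair_code x u = concat (map delimit [x, code_nats rs, code_nats cs])"
    by (simp add: pair_code_def u_def)
  then have "blocks (pair_code x u) = [x, code_nats rs, code_nats cs]"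
    by (simp only: blocks_concat)
  moreover have "blocks x = instance_blocks A k"
    unfolding x encode_instance_blocks by (rule blocks_concat)
  moreover have "map length (blocks (code_nats l)) = l" for l
    unfolding code_nats_def blocks_concat by (simp add: map_idI)
  ultimately have "pair_code x u \<in> verifier"
    using acc x by (simp add: verifier_def entry_def numeral_2_eq_2 encode_instance_blocks)
  moreover have "length u \<le> poly [:2, 4, 8:] (length x)"
  proof -
    have "dim_row A \<le> length x" "dim_col A \<le> length x"
      unfolding x by (simp_all add: encode_instance_def length_delimit)
    then have "set rs \<subseteq> {..<length x}" "set cs \<subseteq> {..<length x}" "distinct rs" "distinct cs"
      using acc unfolding accepts_instance witness_iff by auto
    then have "length (code_nats rs) \<le> length x * (2 * length x + 1)" "length (code_nats cs) \<le> length x * (2 * length x + 1)"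
      by (blast intro: length_code_nats)+
    then show ?thesis by (simp add: u_def length_delimit algebra_simps)
  qed
  ultimately show ?thesis by (rule that[rotated])
qed

lemma pf_accepts:
  assumes "polyfun ws" "polyfun rs" "polyfun cs"
  shows "polyfun (\<lambda>x. accepts (ws x) (rs x) (cs x))"
proof -
  have "polyfun (\<lambda>p. accepts (fst p) (fst (snd p)) (snd (snd p)))"
    unfolding accepts_def well_formed_def witness_def consec_def cell_def row_count_def col_count_def budget_def
    by (intro pf)
  from pf_comp[OF this, of "\<lambda>x. (ws x, rs x, cs x)"] show ?thesis
    using assms by (simp add: pf)
qed

lemma SC1P_deletion_in_NP: "in_NP SC1P_deletion_language"
proof -
  have "polyfun (\<lambda>z. [z \<in> verifier])"
    unfolding verifier_def mem_Collect_eq by (intro pf pf_accepts)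
  then have "polytime_decidable verifier"
    unfolding polytime_decidable_def by (rule polyfun_polytime_computable)
  then show ?thesis
    unfolding in_NP_def using verifier_sound verifier_complete by metis
qed

section \<open>From independent sets to the deletion problem\<close>

text \<open>Columns: three for each vertex, a centre (kind 0) and two leaves (kinds 1 and 2). Row \<open>(a, b)\<close> with
  \<open>a < N\<close> joins the centres of the two ends of an edge; the rows \<open>(N, b)\<close> and \<open>(N + 1, b)\<close> join the
  centre of \<open>b\<close> to its leaves.\<close>

definition incident :: "nat \<Rightarrow> (nat \<Rightarrow> nat \<Rightarrow> bool) \<Rightarrow> nat \<Rightarrow> nat \<Rightarrow> nat \<Rightarrow> nat \<Rightarrow> bool" where
  "incident N E a b \<kappa> v \<longleftrightarrow>
     (if a < N then a \<noteq> b \<and> E a b \<and> \<kappa> = 0 \<and> (v = a \<or> v = b)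
      else if a = N then v = b \<and> (\<kappa> = 0 \<or> \<kappa> = 1)
      else v = b \<and> (\<kappa> = 0 \<or> \<kappa> = 2))"

definition graph_cell :: "nat \<Rightarrow> (nat \<Rightarrow> nat \<Rightarrow> bool) \<Rightarrow> nat \<Rightarrow> nat \<Rightarrow> bool" where
  "graph_cell N E i j = incident N E (i div N) (i mod N) (j div N) (j mod N)"

definition graph_matrix :: "nat \<Rightarrow> (nat \<Rightarrow> nat \<Rightarrow> bool) \<Rightarrow> bool mat" where
  "graph_matrix N E = mat (N * (N + 2)) (3 * N) (\<lambda>(i, j). graph_cell N E i j)"

lemma witness_graph_matrix:
  "SC1P_deletion (graph_matrix N E) k \<longleftrightarrow> (\<exists>rs cs. witness (N * (N + 2)) (3 * N) (graph_cell N E) rs cs \<and>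
     (N * (N + 2) - length rs) + (3 * N - length cs) \<le> k)"
proof -
  have "witness (N * (N + 2)) (3 * N) (\<lambda>i j. graph_matrix N E $$ (i, j)) rs cs =
      witness (N * (N + 2)) (3 * N) (graph_cell N E) rs cs" for rs cs
    by (rule witness_cong) (simp add: graph_matrix_def)
  then show ?thesis unfolding SC1P_deletion_iff by (simp add: graph_matrix_def)
qed

definition independent_set :: "(nat \<Rightarrow> nat \<Rightarrow> bool) \<Rightarrow> nat set \<Rightarrow> bool" where
  "independent_set E I \<longleftrightarrow> (\<forall>a\<in>I. \<forall>b\<in>I. a \<noteq> b \<longrightarrow> \<not> E a b)"

text \<open>If both ends of an edge were left with their rows and leaves, a centre would need three neighbours.\<close>

lemma three_neighbours:
  assumes "distinct [p, p1, p2, p3]" "{p, p1, p2, p3} \<subseteq> {..<n}"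
    and "consec f1 n" "f1 p" "f1 p1" "\<not> f1 p2" "\<not> f1 p3"
    and "consec f2 n" "f2 p" "f2 p2" "\<not> f2 p1" "\<not> f2 p3"
    and "consec f3 n" "f3 p" "f3 p3" "\<not> f3 p1" "\<not> f3 p2"
  shows False
proof -
  have close: "\<not> (p < q \<and> q < r) \<and> \<not> (r < q \<and> q < p)"
    if "consec f n" "f p" "f r" "\<not> f q" "q < n" "r < n" "p < n" for f q r
    using that unfolding consec_def by blast
  have n: "p < n" "p1 < n" "p2 < n" "p3 < n" using assms(2) by auto
  note 1 = close[OF assms(3-6) n(3,2,1)] close[OF assms(3-5) assms(7) n(4,2,1)]
  note 2 = close[OF assms(8-11) n(2,3,1)] close[OF assms(8-10) assms(12) n(4,3,1)]
  note 3 = close[OF assms(13-16) n(2,4,1)] close[OF assms(13-15) assms(17) n(3,4,1)]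
  have d: "p \<noteq> p1" "p \<noteq> p2" "p \<noteq> p3" "p1 \<noteq> p2" "p1 \<noteq> p3" "p2 \<noteq> p3" using assms(1) by auto
  \<comment> \<open>Two of the three neighbours lie on the same side of \<open>p\<close>. The nearer
    one is then a hole between \<open>p\<close> and the farther one in the row that contains these
    two.\<close>
  show False using 1 2 3 d by (smt (verit) nat_neq_iff)
qed

lemma div_mod_block: "b < N \<Longrightarrow> (a * N + b) div N = a" "b < N \<Longrightarrow> (a * N + b) mod N = (b :: nat)"
  by simp_all

lemma block_less:
  assumes "a < k" "b < N"
  shows "a * N + b < k * (N :: nat)"
proof -
  have "a * N + b < Suc a * N" using assms(2) by simp
  also have "\<dots> \<le> k * N" using assms(1) by (intro mult_le_mono1) simp
  finally show ?thesis .
qed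

text \<open>Every deleted row or column is charged to one vertex, an edge row to its first end only,
  so at most N - m vertices are charged. Around an edge between two uncharged vertices a and b there
  survive the edge row, both leaf rows and both leaves of a, and the two centres, which
  \<open>three_neighbours\<close> excludes.\<close>

lemma deletion_imp_independent:
  assumes w: "witness (N * (N + 2)) (3 * N) (graph_cell N E) rs cs"
    and k: "(N * (N + 2) - length rs) + (3 * N - length cs) \<le> N - m" and m: "m \<le> N"
  shows "\<exists>I\<subseteq>{..<N}. m \<le> card I \<and> independent_set E I"
proof -
  define group where "group i = (if i div N < N then i div N else i mod N)" for i
  let ?R = "{..<N * (N + 2)} - set rs" and ?C = "{..<3 * N} - set cs"
  define S where "S = group ` ?R \<union> (\<lambda>j. j mod N) ` ?C"
  let ?I = "{..<N} - S"
  have w': "distinct rs" "distinct cs" "set rs \<subseteq> {..<N * (N + 2)}" "set cs \<subseteq> {..<3 * N}"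
    "\<forall>i<length rs. consec (\<lambda>j. graph_cell N E (rs ! i) (cs ! j)) (length cs)"
    using w unfolding witness_iff by blast+
  have "card S \<le> card (group ` ?R) + card ((\<lambda>j. j mod N) ` ?C)" unfolding S_def by (rule card_Un_le)
  also have "\<dots> \<le> card ?R + card ?C" by (intro add_mono card_image_le) auto
  also have "\<dots> = (N * (N + 2) - length rs) + (3 * N - length cs)"
    using w' by (simp add: card_Diff_subset distinct_card)
  finally have "card S \<le> N - m" using k by simp
  moreover have "finite S" by (simp add: S_def)
  ultimately have card: "m \<le> card ?I" using m diff_card_le_card_Diff[of S "{..<N}"] by simp
  have "\<not> E a b" if a: "a \<in> ?I" and b: "b \<in> ?I" and "a \<noteq> b" for a b
  proof
    assume "E a b"
    have N: "a < N" "b < N" using a b by auto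
    have row: "\<exists>i<length rs. rs ! i = r * N + s" if "r < N + 2" "s < N" "group (r * N + s) \<notin> S" for r s
    proof -
      have "r * N + s \<in> {..<N * (N + 2)}" using block_less[OF that(1,2)] by (simp add: mult.commute)
      then show ?thesis using that(3) unfolding S_def by (metis DiffI UnI1 imageI in_set_conv_nth)
    qed
    have col: "\<exists>j<length cs. cs ! j = r * N + s" if "r < 3" "s < N" "s \<notin> S" for r s
    proof -
      have "r * N + s \<in> {..<3 * N}" using block_less[OF that(1,2)] by simp
      moreover have "(r * N + s) mod N = s" using that(2) by simp
      ultimately show ?thesis using that(3) unfolding S_def by (metis (no_types, lifting) DiffI UnI2 image_eqI in_set_conv_nth)
    qed
    have g: "group (a * N + b) \<notin> S" "group (N * N + a) \<notin> S" "group ((N + 1) * N + a) \<notin> S"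
      using a N unfolding group_def by (simp_all only: div_mod_block) simp_all
    obtain i1 where i1: "i1 < length rs" "rs ! i1 = a * N + b" using row[OF _ N(2) g(1)] N by auto
    obtain i2 where i2: "i2 < length rs" "rs ! i2 = N * N + a" using row[OF _ N(1) g(2)] by auto
    obtain i3 where i3: "i3 < length rs" "rs ! i3 = (N + 1) * N + a" using row[OF _ N(1) g(3)] by auto
    obtain p where p: "p < length cs" "cs ! p = 0 * N + a" using col[of 0 a] a N by auto
    obtain p1 where p1: "p1 < length cs" "cs ! p1 = 0 * N + b" using col[of 0 b] b N by auto
    obtain p2 where p2: "p2 < length cs" "cs ! p2 = 1 * N + a" using col[of 1 a] a N by auto
    obtain p3 where p3: "p3 < length cs" "cs ! p3 = 2 * N + a" using col[of 2 a] a N by auto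
    note c1 = w'(5)[rule_format, OF i1(1)] and c2 = w'(5)[rule_format, OF i2(1)] and c3 = w'(5)[rule_format, OF i3(1)]
    have dm: "rs ! i1 div N = a" "rs ! i1 mod N = b" "rs ! i2 div N = N" "rs ! i2 mod N = a"
      "rs ! i3 div N = N + 1" "rs ! i3 mod N = a" "cs ! p div N = 0" "cs ! p mod N = a"
      "cs ! p1 div N = 0" "cs ! p1 mod N = b" "cs ! p2 div N = 1" "cs ! p2 mod N = a"
      "cs ! p3 div N = 2" "cs ! p3 mod N = a"
      by (simp_all only: i1 i2 i3 p p1 p2 p3 div_mod_block N)
    have "distinct [p, p1, p2, p3]"
      using p(2) p1(2) p2(2) p3(2) N \<open>a \<noteq> b\<close> by auto
    moreover have "{p, p1, p2, p3} \<subseteq> {..<length cs}" using p p1 p2 p3 by auto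
    ultimately show False
      by (rule three_neighbours[OF _ _ c1 _ _ _ _ c2 _ _ _ _ c3])
        (use N \<open>a \<noteq> b\<close> \<open>E a b\<close> in \<open>simp_all add: graph_cell_def incident_def dm\<close>)
  qed
  then have "independent_set E ?I" unfolding independent_set_def by blast
  then show ?thesis using card by (intro exI[of _ ?I] conjI) auto
qed

section \<open>Consecutive orders around an independent set\<close>

lemma triple_unique: "3 * a + d = 3 * b + e \<Longrightarrow> d < 3 \<Longrightarrow> e < 3 \<Longrightarrow> a = b \<and> d = (e :: nat)"
  by presburger

text \<open>Replaces positions in a sorted list by convexity with respect to the key. The case of
  equal keys is included: \<open>f\<close> must not separate them, so the order among them is
  irrelevant.\<close>

lemma consec_sort_key:
  fixes key :: "nat \<Rightarrow> nat"
  assumes "\<And>x y z. \<lbrakk>x \<in> set l; y \<in> set l; z \<in> set l; key x \<le> key y; key y \<le> key z; f x; f z\<rbrakk> \<Longrightarrow> f y"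
  shows "consec (\<lambda>j. f (sort_key key l ! j)) (length (sort_key key l))"
  unfolding consec_def
proof (intro allI impI)
  let ?l = "sort_key key l"
  fix a b c assume *: "a < length ?l" "b < length ?l" "c < length ?l" "a < b" "b < c" "f (?l ! a)" "f (?l ! c)"
  have sorted: "sorted (map key ?l)" by simp
  have "key (?l ! a) \<le> key (?l ! b)" "key (?l ! b) \<le> key (?l ! c)"
    using sorted_nth_mono[OF sorted, of a b] sorted_nth_mono[OF sorted, of b c] * by simp_all
  moreover have "?l ! a \<in> set l" "?l ! b \<in> set l" "?l ! c \<in> set l"
    using * by (metis nth_mem set_sort)+
  ultimately show "f (?l ! b)" using assms * by blast
qed

text \<open>Each vertex of an independent set keeps its centre: its leaf rows enclose the rows of its edges.\<close>

lemma independent_imp_deletion: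
  assumes I: "I \<subseteq> {..<N}" "independent_set E I" and "0 < N"
  shows "\<exists>rs cs. witness (N * (N + 2)) (3 * N) (graph_cell N E) rs cs \<and>
     (N * (N + 2) - length rs) + (3 * N - length cs) = N - card I"
proof -
  \<comment> \<open>Both orders give each vertex v the keys 3v, 3v + 1, 3v + 2. Columns come as
    first leaf, centre, second leaf, so a leaf row meets two neighbours. Rows come as first leaf
    row, owned edge rows, second leaf row, so the centre column meets the whole block. Edge rows
    without an owner get the key 3N; they have no ones left.\<close>
  define ckey where "ckey j = 3 * (j mod N) + (if j div N = 0 then 1 else if j div N = 1 then 0 else 2)" for j
  \<comment> \<open>The owner is the end of the edge whose centre survives; independence makes it
    unique.\<close>
  define owner where "owner a b v \<longleftrightarrow> a \<noteq> b \<and> E a b \<and> v \<in> I \<and> (v = a \<or> v = b)" for a b v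
  define rkey where "rkey i = (let a = i div N; b = i mod N in
     if a = N then 3 * b else if a = N + 1 then 3 * b + 2
     else if owner a b a then 3 * a + 1 else if owner a b b then 3 * b + 1 else 3 * N)" for i
  \<comment> \<open>Only the centres of vertices outside \<open>I\<close> are deleted, and no
    row.\<close>
  define lc where "lc = filter (\<lambda>j. j < N \<longrightarrow> j \<in> I) [0..<3 * N]"
  let ?cs = "sort_key ckey lc" and ?rs = "sort_key rkey [0..<N * (N + 2)]"
  have unique: "v = v'" if "owner a b v" "owner a b v'" for a b v v'
    using that I(2) unfolding owner_def independent_set_def by metis
  have col: "j div N < 3 \<and> (j div N = 0 \<longrightarrow> j mod N \<in> I) \<and> j mod N < N" if "j \<in> set lc" for j
  proof -
    have "j < 3 * N" "j < N \<Longrightarrow> j \<in> I" using that by (auto simp: lc_def)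
    moreover have "j div N = 0 \<longleftrightarrow> j < N" using \<open>0 < N\<close> by (simp add: div_eq_0_iff)
    ultimately show ?thesis using \<open>0 < N\<close> by (auto simp: less_mult_imp_div_less)
  qed
  have ckey_inj: "x = y" if "x \<in> set lc" "y \<in> set lc" "ckey x = ckey y" for x y
  proof -
    have "x mod N = y mod N \<and> (if x div N = 0 then 1 else if x div N = 1 then 0 else 2) =
        (if y div N = 0 then 1 else if y div N = 1 then 0 else (2 :: nat))"
      by (rule triple_unique) (use that(3) in \<open>simp_all add: ckey_def\<close>)
    then have "x mod N = y mod N \<and> x div N = y div N"
      using col[OF that(1)] col[OF that(2)] by (auto split: if_splits)
    then show ?thesis by (metis div_mult_mod_eq)
  qed
  have rows: "consec (\<lambda>j. graph_cell N E i (?cs ! j)) (length ?cs)" if "i < N * (N + 2)" for i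
  proof (rule consec_sort_key)
    fix x y z assume xyz: "x \<in> set lc" "y \<in> set lc" "z \<in> set lc" "ckey x \<le> ckey y" "ckey y \<le> ckey z"
      "graph_cell N E i x" "graph_cell N E i z"
    note cx = col[OF xyz(1)] and cy = col[OF xyz(2)] and cz = col[OF xyz(3)]
    show "graph_cell N E i y"
    proof (cases "i div N < N")
      case True
      then have "owner (i div N) (i mod N) (x mod N)" "owner (i div N) (i mod N) (z mod N)" "x div N = 0" "z div N = 0"
        using xyz(6,7) cx cz by (auto simp: graph_cell_def incident_def owner_def)
      then have "x = z" using unique by (metis div_mult_mod_eq)
      then have "y = x" using ckey_inj xyz(1,2,4,5) by simp
      then show ?thesis using xyz by simp
    next
      case False
      then have xb: "x mod N = i mod N" "z mod N = i mod N"
        using xyz(6,7) by (auto simp: graph_cell_def incident_def split: if_splits)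
      then have yb: "y mod N = i mod N" using xyz(4,5) by (auto simp: ckey_def split: if_splits)
      then show ?thesis
        using False xyz(4-7) cx cy cz xb by (auto simp: graph_cell_def incident_def ckey_def split: if_splits)
    qed
  qed
  have row: "i div N < N + 2 \<and> i mod N < N" if "i < N * (N + 2)" for i
    using that \<open>0 < N\<close> by (auto simp: less_mult_imp_div_less mult.commute)
  have cols: "consec (\<lambda>i. graph_cell N E (?rs ! i) j) (length ?rs)" if "j \<in> set lc" for j
  proof (rule consec_sort_key[where f = "\<lambda>i. graph_cell N E i j"])
    fix x y z assume xyz: "x \<in> set [0..<N * (N + 2)]" "y \<in> set [0..<N * (N + 2)]" "z \<in> set [0..<N * (N + 2)]"
      "rkey x \<le> rkey y" "rkey y \<le> rkey z" "graph_cell N E x j" "graph_cell N E z j"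
    note cj = col[OF that]
    \<comment> \<open>The rows with a one in column \<open>j\<close> have their keys in the block of
      its vertex; \<open>conv\<close> below is the converse: a key in the block yields a one, for a
      centre at every offset, for a leaf only at the end where its own row stands.\<close>
    have range: "rkey i = 3 * (j mod N) + (if i div N = N then 0 else if i div N = N + 1 then 2 else 1)"
      if "graph_cell N E i j" "i < N * (N + 2)" for i
    proof (cases "i div N < N")
      case True
      then have "owner (i div N) (i mod N) (j mod N)"
        using that(1) cj by (auto simp: graph_cell_def incident_def owner_def)
      moreover from this have "j mod N = i div N \<or> j mod N = i mod N" by (auto simp: owner_def)
      ultimately show ?thesis using True unique unfolding rkey_def Let_def by auto
    next
      case False
      then show ?thesis using that row[of i] by (auto simp: graph_cell_def incident_def rkey_def)
    qed
    have conv: "graph_cell N E i j" if "rkey i = 3 * (j mod N) + e" "e < 3" "i < N * (N + 2)"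
      "j div N = 0 \<or> (j div N = 1 \<and> e = 0) \<or> (j div N = 2 \<and> e = 2)" for i e
    proof -
      have own: "owner a b v \<Longrightarrow> v < N" for a b v using I(1) by (auto simp: owner_def)
      note ri = row[OF that(3)]
      consider "i div N = N" | "i div N = N + 1" | "i div N < N" using ri by linarith
      then show ?thesis
      proof cases
        case 1
        then have "i mod N = j mod N \<and> 0 = e"
          using that(1,2) by (intro triple_unique) (simp_all add: rkey_def)
        then show ?thesis using 1 that(4) by (auto simp: graph_cell_def incident_def)
      next
        case 2
        then have "i mod N = j mod N \<and> 2 = e"
          using that(1,2) by (intro triple_unique) (simp_all add: rkey_def)
        then show ?thesis using 2 that(4) by (auto simp: graph_cell_def incident_def)
      next
        case 3
        have "rkey i \<noteq> 3 * N"
        proof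
          assume "rkey i = 3 * N"
          then have "3 * N = 3 * (j mod N) + e" using that(1) by simp
          moreover have "j mod N < N" using cj by simp
          ultimately show False using that(2) by linarith
        qed
        then obtain v where v: "owner (i div N) (i mod N) v" "rkey i = 3 * v + 1"
          using 3 unfolding rkey_def Let_def by (auto split: if_splits)
        have "v = j mod N \<and> 1 = e"
          using that(1,2) v(2) by (intro triple_unique) simp_all
        then show ?thesis using 3 v(1) that(4) by (auto simp: graph_cell_def incident_def owner_def)
      qed
    qed
    have lt: "x < N * (N + 2)" "y < N * (N + 2)" "z < N * (N + 2)" using xyz(1-3) by simp_all
    note rx = range[OF xyz(6) lt(1)] and rz = range[OF xyz(7) lt(3)]
    define e where "e = rkey y - 3 * (j mod N)"
    have ex: "(if x div N = N then 0 else if x div N = N + 1 then 2 else 1) \<le> e"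
      "e \<le> (if z div N = N then 0 else if z div N = N + 1 then 2 else (1 :: nat))"
      "rkey y = 3 * (j mod N) + e"
      using xyz(4,5) rx rz unfolding e_def by linarith+
    have "e < 3" using ex(2) by (auto split: if_splits)
    moreover have "x div N < N \<or> x div N = N \<or> x div N = N + 1" "z div N < N \<or> z div N = N \<or> z div N = N + 1"
      using row[OF lt(1)] row[OF lt(3)] by linarith+
    then have "j div N = 0 \<or> (j div N = 1 \<and> e = 0) \<or> (j div N = 2 \<and> e = 2)"
      using xyz(6,7) ex(1,2) cj by (auto simp: graph_cell_def incident_def split: if_splits)
    ultimately show "graph_cell N E y j" using conv[OF ex(3)] lt(2) by blast
  qed
  have len: "length lc = 2 * N + card I"
  proof -
    have "length lc = card (set lc)" by (rule distinct_card[symmetric]) (simp add: lc_def)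
    also have "set lc = I \<union> {N..<3 * N}" using I(1) \<open>0 < N\<close> by (auto simp: lc_def)
    also have "card \<dots> = card I + 2 * N" using I(1) by (subst card_Un_disjoint) (auto intro: finite_subset)
    finally show ?thesis by simp
  qed
  have "witness (N * (N + 2)) (3 * N) (graph_cell N E) ?rs ?cs"
    unfolding witness_iff
  proof (intro conjI allI impI)
    show "set ?cs \<subseteq> {..<3 * N}" by (auto simp: lc_def)
    show "set ?rs \<subseteq> {..<N * (N + 2)}" by auto
    show "distinct ?cs" by (simp add: lc_def)
    show "distinct ?rs" by simp
    fix i assume "i < length ?rs"
    then have "?rs ! i \<in> set [0..<N * (N + 2)]" by (metis nth_mem set_sort)
    then show "consec (\<lambda>j. graph_cell N E (?rs ! i) (?cs ! j)) (length ?cs)" using rows by simp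
  next
    fix j assume "j < length ?cs"
    then have "?cs ! j \<in> set lc" by (metis nth_mem set_sort)
    then show "consec (\<lambda>i. graph_cell N E (?rs ! i) (?cs ! j)) (length ?rs)" by (rule cols)
  qed
  moreover have "(N * (N + 2) - length ?rs) + (3 * N - length ?cs) = N - card I" using len by simp
  ultimately show ?thesis by blast
qed

lemma SC1P_deletion_graph_matrix:
  assumes "m \<le> N" "0 < N"
  shows "SC1P_deletion (graph_matrix N E) (N - m) \<longleftrightarrow> (\<exists>I\<subseteq>{..<N}. m \<le> card I \<and> independent_set E I)"
proof
  assume "SC1P_deletion (graph_matrix N E) (N - m)"
  then show "\<exists>I\<subseteq>{..<N}. m \<le> card I \<and> independent_set E I"
    unfolding witness_graph_matrix using deletion_imp_independent assms(1) by blast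
next
  assume "\<exists>I\<subseteq>{..<N}. m \<le> card I \<and> independent_set E I"
  then obtain I where I: "I \<subseteq> {..<N}" "m \<le> card I" "independent_set E I" by blast
  from independent_imp_deletion[OF I(1,3) assms(2)] obtain rs cs where
    "witness (N * (N + 2)) (3 * N) (graph_cell N E) rs cs"
    "(N * (N + 2) - length rs) + (3 * N - length cs) = N - card I" by blast
  moreover have "N - card I \<le> N - m" using I(2) by simp
  ultimately show "SC1P_deletion (graph_matrix N E) (N - m)" unfolding witness_graph_matrix by metis
qed

text \<open>Moves the lowest bit of the number to the end of the list. The number is available in
  unary, so it can be the number of rounds; rounds after it has reached 0 change nothing.\<close>

definition halve :: "nat \<times> bool list \<Rightarrow> nat \<times> bool list" where
  "halve q = (fst q div 2, if fst q = 0 then snd q else snd q @ [fst q mod 2 = 1])"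

lemma pf_binary [pf]:
  assumes n: "polyfun n" shows "polyfun (\<lambda>x. binary (n x))"
proof -
  have eq: "esize (l @ m) + 1 = esize l + esize m" for l m :: "bool list"
    by (induction l) auto
  have "polyfun (\<lambda>x. ((\<lambda>q. halve q) ^^ n x) (n x, []))"
  proof (rule pf_funpow_add[where k = "\<lambda>x. [True]"])
    fix q :: "nat \<times> bool list"
    have "fst q div 2 \<le> fst q" by simp
    moreover have "esize [fst q mod 2 = 1] \<le> esize [True]"
      by (simp add: esize_def encode_bool_def tree_of_bool_def)
    ultimately show "esize (halve q) \<le> esize q + esize [True]"
      using eq[of "snd q" "[fst q mod 2 = 1]"] by (cases q) (auto simp: halve_def esize_nat)
  qed (unfold halve_def, (intro pf n)+)
  moreover have H: "snd ((halve ^^ i) q) @ binary (fst ((halve ^^ i) q)) = snd q @ binary (fst q) \<and>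
      fst ((halve ^^ i) q) = fst q div 2 ^ i" for i q
  proof (induction i)
    case (Suc i)
    have inv: "snd (halve q) @ binary (fst (halve q)) = snd q @ binary (fst q)" for q
    proof (cases "fst q = 0")
      case False
      then show ?thesis by (subst (2) binary.simps) (simp add: halve_def odd_iff_mod_2_eq_one)
    qed (simp add: halve_def)
    have "fst (halve q) = fst q div 2" for q by (simp add: halve_def)
    then have "fst ((halve ^^ Suc i) q) = fst q div 2 ^ Suc i"
      using Suc by (simp add: div_mult2_eq[symmetric] mult.commute)
    moreover have "snd ((halve ^^ Suc i) q) @ binary (fst ((halve ^^ Suc i) q)) = snd q @ binary (fst q)"
      by (simp only: funpow.simps comp_apply inv Suc.IH[THEN conjunct1])
    ultimately show ?case by blast
  qed simp
  have "snd ((halve ^^ n x) (n x, [])) = binary (n x)" for x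
  proof -
    have "fst ((halve ^^ n x) (n x, [])) = 0" using H[of "n x" "(n x, [])"] by simp
    then show ?thesis using H[THEN conjunct1, of "n x" "(n x, [])"] by (simp add: binary.simps[of 0])
  qed
  ultimately show ?thesis using pf_snd[of "\<lambda>x. (halve ^^ n x) (n x, [])"] by simp
qed

section \<open>From computations to independent sets\<close>

definition trans_fun :: "machine \<Rightarrow> nat \<Rightarrow> nat list \<Rightarrow> nat \<times> (nat \<times> move) list" where
  "trans_fun M q ss = (if q < num_states M then transition M q ss else (q, map (\<lambda>s. (s, Stay)) ss))"

definition run :: "machine \<Rightarrow> bool list \<Rightarrow> nat \<Rightarrow> config" where
  "run M z t = (step M ^^ t) (start_config M z)"

definition rstate :: "machine \<Rightarrow> bool list \<Rightarrow> nat \<Rightarrow> nat" where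
  "rstate M z t = fst (run M z t)"

definition rhead :: "machine \<Rightarrow> bool list \<Rightarrow> nat \<Rightarrow> nat \<Rightarrow> int" where
  "rhead M z t i = snd (snd (run M z t) ! i)"

definition rcell :: "machine \<Rightarrow> bool list \<Rightarrow> nat \<Rightarrow> nat \<Rightarrow> int \<Rightarrow> nat" where
  "rcell M z t i = fst (snd (run M z t) ! i)"

definition rscan :: "machine \<Rightarrow> bool list \<Rightarrow> nat \<Rightarrow> nat list" where
  "rscan M z t = map (\<lambda>i. rcell M z t i (rhead M z t i)) [0..<num_tapes M]"

definition valid_tapes :: "machine \<Rightarrow> tape list \<Rightarrow> bool" where
  "valid_tapes M ts \<longleftrightarrow> length ts = num_tapes M \<and> (\<forall>i<num_tapes M. \<forall>p. fst (ts ! i) p < num_symbols M)"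

lemma step_valid:
  assumes tm: "turing_machine M" and q: "q \<le> num_states M" and ts: "valid_tapes M ts"
  defines "A \<equiv> trans_fun M q (map (\<lambda>t. fst t (snd t)) ts)"
  shows "step M (q, ts) = (fst A, map2 act (snd A) ts)" "length (snd A) = num_tapes M" "fst A \<le> num_states M"
    "valid_tapes M (map2 act (snd A) ts)"
proof -
  have sc: "(\<lambda>(c, h). c h) = (\<lambda>t :: tape. fst t (snd t))" by auto
  let ?ss = "map (\<lambda>t. fst t (snd t)) ts"
  have len: "length ts = num_tapes M" using ts by (simp add: valid_tapes_def)
  have ss: "set ?ss \<subseteq> {..<num_symbols M}"
    using ts by (auto simp: valid_tapes_def in_set_conv_nth) (metis fst_conv)
  have A: "length (snd A) = num_tapes M \<and> fst A \<le> num_states M \<and> fst ` set (snd A) \<subseteq> {..<num_symbols M}"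
  proof (cases "q < num_states M")
    case True
    then have "A = transition M q ?ss" by (simp add: A_def trans_fun_def)
    moreover have "case transition M q ?ss of (q', acts) \<Rightarrow> q' \<le> num_states M \<and> length acts = num_tapes M \<and>
        fst ` set acts \<subseteq> {..<num_symbols M}"
      using tm[unfolded turing_machine_def, THEN conjunct2, THEN conjunct2, rule_format, OF True _ ss] len
      by (simp only: length_map)
    ultimately show ?thesis by (auto split: prod.splits)
  next
    case False
    then show ?thesis using q len ss by (auto simp: A_def trans_fun_def)
  qed
  then show "length (snd A) = num_tapes M" "fst A \<le> num_states M" by simp_all
  have "map2 act (map (\<lambda>s. (s, Stay)) ?ss) ts = ts"
    by (rule nth_equalityI) (simp_all add: act_stay)
  then show "step M (q, ts) = (fst A, map2 act (snd A) ts)"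
    by (simp add: step_def A_def trans_fun_def sc split: prod.split)
  show "valid_tapes M (map2 act (snd A) ts)"
    unfolding valid_tapes_def
  proof (intro conjI allI impI)
    show "length (map2 act (snd A) ts) = num_tapes M" using A len by simp
    fix i p assume i: "i < num_tapes M"
    have "snd A ! i \<in> set (snd A)" using A i by simp
    then have "fst (snd A ! i) < num_symbols M" using A by blast
    then show "fst (map2 act (snd A) ts ! i) p < num_symbols M"
      using ts A len i by (cases "snd A ! i"; cases "ts ! i") (auto simp: valid_tapes_def act_def)
  qed
qed

lemma run_valid:
  assumes tm: "turing_machine M"
  shows "rstate M z t \<le> num_states M \<and> valid_tapes M (snd (run M z t))"
proof (induction t)
  case 0
  have tm': "2 \<le> num_tapes M" "3 \<le> num_symbols M" using tm unfolding turing_machine_def by blast+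
  have "contents x p < num_symbols M" for x p
    using tm'(2) by (auto simp: contents_def bit_symbol_def)
  then show ?case
    using tm' by (auto simp: rstate_def run_def start_config_def valid_tapes_def nth_Cons')
next
  case (Suc t)
  obtain q ts where qts: "run M z t = (q, ts)" by fastforce
  have "run M z (Suc t) = step M (q, ts)" by (simp add: run_def qts[unfolded run_def])
  then show ?case using step_valid[OF tm, of q ts] Suc qts by (simp add: rstate_def)
qed

lemma rscan_run:
  assumes "turing_machine M"
  shows "rscan M z t = map (\<lambda>t. fst t (snd t)) (snd (run M z t))"
  using run_valid[OF assms, of z t]
  by (intro nth_equalityI) (simp_all add: valid_tapes_def rscan_def rcell_def rhead_def)

lemma length_rscan: "length (rscan M z t) = num_tapes M"
  by (simp add: rscan_def)

lemma run_Suc: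
  fixes M z
  assumes tm: "turing_machine M"
  defines "A t \<equiv> trans_fun M (rstate M z t) (rscan M z t)"
  shows "rstate M z (Suc t) = fst (A t)" "length (snd (A t)) = num_tapes M"
    "i < num_tapes M \<Longrightarrow> rhead M z (Suc t) i = rhead M z t i + offset (snd (snd (A t) ! i))"
    "i < num_tapes M \<Longrightarrow> rcell M z (Suc t) i = (rcell M z t i)(rhead M z t i := fst (snd (A t) ! i))"
proof -
  obtain q ts where qts: "run M z t = (q, ts)" by fastforce
  have *: "q \<le> num_states M" "valid_tapes M ts" using run_valid[OF tm, of z t] qts by (simp_all add: rstate_def)
  have A: "A t = trans_fun M q (map (\<lambda>t. fst t (snd t)) ts)" by (simp add: A_def rscan_run[OF tm] rstate_def qts)
  have Suc: "run M z (Suc t) = (fst (A t), map2 act (snd (A t)) ts)"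
    using step_valid(1)[OF tm *] by (simp add: run_def qts[unfolded run_def] A)
  then show "rstate M z (Suc t) = fst (A t)" by (simp add: rstate_def)
  show len: "length (snd (A t)) = num_tapes M" using step_valid(2)[OF tm *] by (simp add: A)
  assume i: "i < num_tapes M"
  then have "snd (run M z (Suc t)) ! i = act (snd (A t) ! i) (ts ! i)"
    using Suc len *(2) by (simp add: valid_tapes_def)
  then show "rhead M z (Suc t) i = rhead M z t i + offset (snd (snd (A t) ! i))"
    "rcell M z (Suc t) i = (rcell M z t i)(rhead M z t i := fst (snd (A t) ! i))"
    by (simp_all add: rhead_def rcell_def qts act_def split: prod.split)
qed

lemma rscan_symbols: "turing_machine M \<Longrightarrow> set (rscan M z t) \<subseteq> {..<num_symbols M}"
  using run_valid[of M z t] by (auto simp: rscan_def rcell_def valid_tapes_def)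

lemma run_start:
  assumes tm: "turing_machine M" and "i < num_tapes M"
  shows "rstate M z 0 = 0" "rhead M z 0 i = 0" "rcell M z 0 i = (if i = 0 then contents z else contents [])"
  using assms(2) by (auto simp: rstate_def rhead_def rcell_def run_def start_config_def nth_Cons')

lemma rhead_bound:
  assumes tm: "turing_machine M" and i: "i < num_tapes M"
  shows "\<bar>rhead M z t i\<bar> \<le> int t"
proof (induction t)
  case (Suc t)
  obtain d where "rhead M z (Suc t) i = rhead M z t i + offset d"
    using run_Suc(3)[OF tm i] by blast
  moreover have "\<bar>offset d\<bar> \<le> 1" by (cases d) auto
  ultimately show ?case using Suc by simp
qed (simp add: run_start[OF tm i])

lemma run_halted:
  assumes "rstate M z t = num_states M" "t \<le> t'"
  shows "run M z t' = run M z t"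
  using assms(2)
proof (induction t' rule: dec_induct)
  case (step n)
  obtain q ts where "run M z n = (q, ts)" by fastforce
  with step assms(1) show ?case by (simp add: run_def rstate_def step_def)
qed simp

text \<open>The fact behind the links: a cell changes only at a visit, so a scanned symbol is
  determined by the last earlier visit alone.\<close>

lemma rcell_unvisited:
  assumes tm: "turing_machine M" and i: "i < num_tapes M" and "a \<le> b"
    and "\<And>t. a \<le> t \<Longrightarrow> t < b \<Longrightarrow> rhead M z t i \<noteq> p"
  shows "rcell M z b i p = rcell M z a i p"
  using assms(3,4)
proof (induction b rule: dec_induct)
  case (step n)
  then have "rhead M z n i \<noteq> p" "rcell M z n i p = rcell M z a i p" by simp_all
  then show ?case using run_Suc(4)[OF tm i, of z n] by auto
qed simp

fun move_code :: "move \<Rightarrow> nat" where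
  "move_code Left = 0"
| "move_code Stay = 1"
| "move_code Right = 2"

lemma move_code: "int (move_code d) = offset d + 1"
  by (cases d) auto

text \<open>\<open>transition M\<close> is an arbitrary function, but on its finitely many valid
  arguments it is a table and therefore computable. Elsewhere the machine idles, with 1 as the code
  of \<open>Stay\<close>; this also covers the halting state.\<close>

definition table :: "machine \<Rightarrow> nat \<times> nat list \<Rightarrow> nat \<times> (nat \<times> nat) list" where
  "table M y = (if y \<in> {..<num_states M} \<times> {ss. set ss \<subseteq> {..<num_symbols M} \<and> length ss = num_tapes M}
     then (fst (transition M (fst y) (snd y)), map (\<lambda>(s, d). (s, move_code d)) (snd (transition M (fst y) (snd y))))
     else (fst y, map (\<lambda>s. (s, 1)) (snd y)))"

lemma table_trans_fun:
  assumes "set ss \<subseteq> {..<num_symbols M}" "length ss = num_tapes M"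
  shows "table M (q, ss) = (fst (trans_fun M q ss), map (\<lambda>(s, d). (s, move_code d)) (snd (trans_fun M q ss)))"
  using assms by (auto simp: table_def trans_fun_def)

lemma pf_finite_cases:
  assumes "finite D" "polyfun g"
  shows "polyfun (\<lambda>y. if y \<in> D then F y else g y)"
  using assms(1)
proof (induction D)
  case (insert d D)
  have "(if y \<in> insert d D then F y else g y) = (if y = d then F d else if y \<in> D then F y else g y)" for y by simp
  then show ?case using insert.IH by (simp add: pf)
qed (simp add: assms(2))

lemma pf_table [pf]: "polyfun y \<Longrightarrow> polyfun (\<lambda>x. table M (y x))"
proof (rule pf_comp[of "table M"])
  show "polyfun (table M)"
    unfolding table_def
    by (rule pf_finite_cases) (intro finite_cartesian_product finite_lessThan finite_lists_length_eq, intro pf)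
qed

text \<open>A configuration at time \<open>t\<close> is stored as a list of numbers: \<open>t\<close>, the length of the certificate,
  the state, and for every tape the head position (shifted by \<open>T\<close>), the scanned symbol, and a link:
  the successor of the last earlier time at which the head was on the same cell, or 0. With the links, all
  constraints between configurations are binary. At the extra time \<open>T + 1\<close> all heads jump to cell 0, so
  that the output is read.\<close>

definition v_time :: "nat list \<Rightarrow> nat" where "v_time v = entry 0 v 0"
definition v_len :: "nat list \<Rightarrow> nat" where "v_len v = entry 0 v 1"
definition v_state :: "nat list \<Rightarrow> nat" where "v_state v = entry 0 v 2"
definition v_head :: "nat \<Rightarrow> nat list \<Rightarrow> nat" where "v_head i v = entry 0 v (3 + i)"
definition v_sym :: "machine \<Rightarrow> nat \<Rightarrow> nat list \<Rightarrow> nat" where "v_sym M i v = entry 0 v (3 + num_tapes M + i)"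
definition v_link :: "machine \<Rightarrow> nat \<Rightarrow> nat list \<Rightarrow> nat" where "v_link M i v = entry 0 v (3 + 2 * num_tapes M + i)"

definition v_next :: "machine \<Rightarrow> nat list \<Rightarrow> nat \<times> (nat \<times> nat) list" where
  "v_next M v = table M (v_state v, map (\<lambda>i. v_sym M i v) [0..<num_tapes M])"

definition v_write :: "machine \<Rightarrow> nat \<Rightarrow> nat list \<Rightarrow> nat" where
  "v_write M i v = fst (entry (0, 0) (snd (v_next M v)) i)"

definition v_move :: "machine \<Rightarrow> nat \<Rightarrow> nat list \<Rightarrow> nat" where
  "v_move M i v = snd (entry (0, 0) (snd (v_next M v)) i)"

text \<open>The condition on a symbol seen at a first visit. Input cells are prescribed, certificate
  cells may show either bit, which is where nondeterminism enters, and all others are blank.\<close>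

definition initial_ok :: "machine \<Rightarrow> nat \<Rightarrow> bool list \<Rightarrow> nat \<Rightarrow> nat list \<Rightarrow> bool" where
  "initial_ok M T d i v \<longleftrightarrow>
     (if i = 0 \<and> T \<le> v_head i v \<and> v_head i v < T + length d
        then v_sym M i v = (if entry False d (v_head i v - T) then 2 else 1)
      else if i = 0 \<and> T \<le> v_head i v \<and> v_head i v < T + length d + v_len v
        then v_sym M i v = 1 \<or> v_sym M i v = 2
      else v_sym M i v = 0)"

text \<open>The conditions on a single record. Links are shifted by one, so a link up to
  \<open>v_time v\<close> means an earlier time. At time T + 1 the symbol 2 on tape 1 is the output
  bit 1 in cell 0.\<close>

definition admissible :: "machine \<Rightarrow> nat \<Rightarrow> nat \<Rightarrow> bool list \<Rightarrow> nat list \<Rightarrow> bool" where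
  "admissible M T m d v \<longleftrightarrow> v_time v \<le> T + 1 \<and> v_len v \<le> m \<and>
     (\<forall>i<num_tapes M. v_sym M i v < num_symbols M \<and> v_link M i v \<le> v_time v \<and>
        (v_time v = 0 \<longrightarrow> v_head i v = T) \<and> (v_time v = T + 1 \<longrightarrow> v_head i v = T) \<and>
        (v_link M i v = 0 \<longrightarrow> initial_ok M T d i v)) \<and>
     (v_time v = 0 \<longrightarrow> v_state v = 0) \<and> (v_time v = T + 1 \<longrightarrow> v_sym M 1 v = 2)"

text \<open>Here \<open>v\<close> is the earlier record. The last two conditions, over all earlier
  \<open>v\<close>, say that a link names the last visit: the linked record is on the same cell and
  wrote the symbol, and every record after it is elsewhere. Moves are constrained before time T
  only, because the heads jump at T + 1.\<close>

definition compatible :: "machine \<Rightarrow> nat \<Rightarrow> nat list \<Rightarrow> nat list \<Rightarrow> bool" where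
  "compatible M T v w \<longleftrightarrow> v_len v = v_len w \<and>
     (v_time w = v_time v + 1 \<longrightarrow> v_state w = fst (v_next M v) \<and>
        (v_time v < T \<longrightarrow> (\<forall>i<num_tapes M. v_head i w + 1 = v_head i v + v_move M i v))) \<and>
     (\<forall>i<num_tapes M.
        (v_link M i w = v_time v + 1 \<longrightarrow> v_head i v = v_head i w \<and> v_sym M i w = v_write M i v) \<and>
        (v_link M i w < v_time v + 1 \<longrightarrow> v_head i v \<noteq> v_head i w))"

text \<open>Unary conditions become edges by letting an inadmissible record conflict with every
  record.\<close>

definition conflict :: "machine \<Rightarrow> nat \<Rightarrow> nat \<Rightarrow> bool list \<Rightarrow> nat list \<Rightarrow> nat list \<Rightarrow> bool" where
  "conflict M T m d v w \<longleftrightarrow> \<not> admissible M T m d v \<or> \<not> admissible M T m d w \<or> v_time v = v_time w \<or>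
     (v_time v < v_time w \<and> \<not> compatible M T v w) \<or> (v_time w < v_time v \<and> \<not> compatible M T w v)"

definition history :: "machine \<Rightarrow> nat \<Rightarrow> nat \<Rightarrow> bool list \<Rightarrow> (nat \<Rightarrow> nat list) \<Rightarrow> bool" where
  "history M T m d v \<longleftrightarrow> (\<forall>t\<le>T + 1. v_time (v t) = t \<and> admissible M T m d (v t)) \<and>
     (\<forall>t'\<le>T + 1. \<forall>t<t'. compatible M T (v t) (v t'))"

definition bounded_history :: "machine \<Rightarrow> nat \<Rightarrow> nat \<Rightarrow> bool list \<Rightarrow> nat \<Rightarrow> (nat \<Rightarrow> nat list) \<Rightarrow> bool" where
  "bounded_history M T m d B v \<longleftrightarrow> history M T m d v \<and>
     (\<forall>t\<le>T + 1. length (v t) = 3 + 3 * num_tapes M \<and> set (v t) \<subseteq> {..<B})"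

lemma v_next_run:
  assumes tm: "turing_machine M" and "v_state v = rstate M z t"
    and "\<And>i. i < num_tapes M \<Longrightarrow> v_sym M i v = rcell M z t i (rhead M z t i)"
  shows "fst (v_next M v) = rstate M z (Suc t)"
    "i < num_tapes M \<Longrightarrow> rcell M z (Suc t) i = (rcell M z t i)(rhead M z t i := v_write M i v)"
    "i < num_tapes M \<Longrightarrow> rhead M z (Suc t) i + 1 = rhead M z t i + int (v_move M i v)"
proof -
  let ?A = "trans_fun M (rstate M z t) (rscan M z t)"
  have "map (\<lambda>i. v_sym M i v) [0..<num_tapes M] = rscan M z t"
    using assms(3) by (simp add: rscan_def)
  then have nxt: "v_next M v = (fst ?A, map (\<lambda>(s, d). (s, move_code d)) (snd ?A))"
    unfolding v_next_def assms(2) by (simp add: table_trans_fun[OF rscan_symbols[OF tm] length_rscan])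
  show "fst (v_next M v) = rstate M z (Suc t)" by (simp add: nxt run_Suc(1)[OF tm])
  assume i: "i < num_tapes M"
  have e: "entry (0, 0) (snd (v_next M v)) i = (fst (snd ?A ! i), move_code (snd (snd ?A ! i)))"
    using i run_Suc(2)[OF tm, of z t] by (simp add: nxt entry_nth split: prod.split)
  show "rcell M z (Suc t) i = (rcell M z t i)(rhead M z t i := v_write M i v)"
    by (simp add: run_Suc(4)[OF tm i] v_write_def e)
  show "rhead M z (Suc t) i + 1 = rhead M z t i + int (v_move M i v)"
    by (simp add: run_Suc(3)[OF tm i] v_move_def e move_code)
qed

text \<open>The certificate is read off the records, and strong induction on time shows that they
  describe the run on it. The time T + 1 needs a separate argument, as its head positions are not
  those of the machine.\<close>

lemma history_sound:
  assumes tm: "turing_machine M" and h: "history M T m d v"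
  shows "\<exists>u. length u \<le> m \<and> rcell M (d @ u) (T + 1) 1 0 = 2"
proof -
  let ?K = "num_tapes M"
  have K: "2 \<le> ?K" using tm unfolding turing_machine_def by blast
  have time: "v_time (v t) = t" and adm: "admissible M T m d (v t)" if "t \<le> T + 1" for t
    using h that unfolding history_def by blast+
  have comp: "compatible M T (v t) (v t')" if "t < t'" "t' \<le> T + 1" for t t'
    using h that unfolding history_def by blast
  define L where "L = v_len (v 0)"
  have L: "v_len (v t) = L" if "t \<le> T + 1" for t
    using comp[of 0 t] that by (cases "t = 0") (auto simp: L_def compatible_def)
  have "L \<le> m" using adm[of 0] by (simp add: admissible_def L_def)
  \<comment> \<open>A certificate cell gets the symbol of its first visit, the one with link 0,
    which is unique by \<open>once\<close>; cells never visited get \<open>False\<close>.\<close>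
  define u where "u = map (\<lambda>j. \<exists>t\<le>T + 1. v_link M 0 (v t) = 0 \<and> v_head 0 (v t) = T + length d + j \<and> v_sym M 0 (v t) = 2) [0..<L]"
  have lu: "length u = L" by (simp add: u_def)
  let ?z = "d @ u"
  have once: "v_head i (v t) \<noteq> v_head i (v t')" if "t < t'" "t' \<le> T + 1" "i < ?K" "v_link M i (v t') = 0" for i t t'
    using comp[OF that(1,2)] that time[of t] by (auto simp: compatible_def)
  have init: "rcell M ?z 0 i (int (v_head i (v t)) - int T) = v_sym M i (v t)"
    if t: "t \<le> T + 1" and i: "i < ?K" and link: "v_link M i (v t) = 0" for t i
  proof -
    let ?h = "v_head i (v t)"
    have ok: "initial_ok M T d i (v t)" using adm[OF t] i link by (simp add: admissible_def)
    consider "i = 0" "T \<le> ?h" "?h < T + length d" | "i = 0" "T + length d \<le> ?h" "?h < T + length d + L"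
      | "i \<noteq> 0 \<or> ?h < T \<or> T + length d + L \<le> ?h" by linarith
    then show ?thesis
    proof cases
      case 1
      then show ?thesis using ok run_start(3)[OF tm i, of ?z]
        by (auto simp: initial_ok_def contents_def bit_symbol_def nth_append nat_diff_distrib entry_nth)
    next
      case 2
      let ?j = "?h - T - length d"
      have j: "?j < L" "?h = T + length d + ?j" using 2 by auto
      have "u ! ?j \<longleftrightarrow> v_sym M 0 (v t) = 2"
      proof
        assume "u ! ?j"
        then obtain t' where t': "t' \<le> T + 1" "v_link M 0 (v t') = 0" "v_head 0 (v t') = ?h" "v_sym M 0 (v t') = 2"
          using j by (auto simp: u_def)
        have "t' = t"
        proof (rule ccontr)
          assume "t' \<noteq> t"
          then consider "t < t'" | "t' < t" by linarith
          then show False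
            using once[of t t' 0] once[of t' t 0] t t' link i 2(1) by cases simp_all
        qed
        then show "v_sym M 0 (v t) = 2" using t' by simp
      next
        assume "v_sym M 0 (v t) = 2"
        then show "u ! ?j" using j t link 2(1) by (auto simp: u_def)
      qed
      moreover have "v_sym M 0 (v t) = 1 \<or> v_sym M 0 (v t) = 2"
        using ok 2 L[OF t] by (auto simp: initial_ok_def)
      moreover have "nat (int ?h - int T) - length d = ?j" by simp
      ultimately show ?thesis using 2 run_start(3)[OF tm i, of ?z] lu
        by (auto simp: contents_def bit_symbol_def nth_append)
    next
      case 3
      then have "v_sym M i (v t) = 0" using ok L[OF t] by (auto simp: initial_ok_def)
      then show ?thesis using 3 run_start(3)[OF tm i, of ?z] lu by (auto simp: contents_def)
    qed
  qed
  \<comment> \<open>The position is the recorded one and the hypotheses concern earlier times only.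
    So the claim serves both inside the induction and at time T + 1.\<close>
  have memory: "rcell M ?z t i (int (v_head i (v t)) - int T) = v_sym M i (v t)"
    if t: "t \<le> T + 1" and i: "i < ?K"
      and past: "\<And>t'. t' < t \<Longrightarrow> rhead M ?z t' i = int (v_head i (v t')) - int T \<and>
        rcell M ?z (Suc t') i = (rcell M ?z t' i)(rhead M ?z t' i := v_write M i (v t'))" for t i
  proof (cases "v_link M i (v t)")
    case 0
    have "rcell M ?z t i (int (v_head i (v t)) - int T) = rcell M ?z 0 i (int (v_head i (v t)) - int T)"
      by (rule rcell_unvisited[OF tm i]) (use past once[OF _ t i 0] in force)+
    then show ?thesis using init[OF t i 0] by simp
  next
    case (Suc s)
    have s: "s < t" using adm[OF t] i Suc time[OF t] by (auto simp: admissible_def)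
    then have c: "v_head i (v s) = v_head i (v t)" "v_sym M i (v t) = v_write M i (v s)"
      using comp[OF s t] i Suc time[of s] t by (auto simp: compatible_def)
    have "v_head i (v r) \<noteq> v_head i (v t)" if "s < r" "r < t" for r
      using comp[OF that(2) t] i Suc time[of r] that t by (auto simp: compatible_def)
    then have "rcell M ?z t i (int (v_head i (v t)) - int T) = rcell M ?z (Suc s) i (int (v_head i (v t)) - int T)"
      by (intro rcell_unvisited[OF tm i]) (use past s in force)+
    then show ?thesis using past[OF s] c by simp
  qed
  have main: "rstate M ?z t = v_state (v t) \<and> (\<forall>i<?K. rhead M ?z t i = int (v_head i (v t)) - int T \<and>
      rcell M ?z t i (rhead M ?z t i) = v_sym M i (v t))" if "t \<le> T" for t
    using that
  proof (induction t rule: less_induct)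
    case (less t)
    have nx: "fst (v_next M (v t')) = rstate M ?z (Suc t')"
      "\<And>i. i < ?K \<Longrightarrow> rcell M ?z (Suc t') i = (rcell M ?z t' i)(rhead M ?z t' i := v_write M i (v t'))"
      "\<And>i. i < ?K \<Longrightarrow> rhead M ?z (Suc t') i + 1 = rhead M ?z t' i + int (v_move M i (v t'))" if "t' < t" for t'
    proof -
      have st: "v_state (v t') = rstate M ?z t'"
        and sy: "\<And>i. i < ?K \<Longrightarrow> v_sym M i (v t') = rcell M ?z t' i (rhead M ?z t' i)"
        using less.IH[OF that order.trans[OF less_imp_le[OF that] less.prems]] by metis+
      show "fst (v_next M (v t')) = rstate M ?z (Suc t')" by (rule v_next_run[OF tm st sy])
      show "i < ?K \<Longrightarrow> rcell M ?z (Suc t') i = (rcell M ?z t' i)(rhead M ?z t' i := v_write M i (v t'))" for i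
        by (rule v_next_run[OF tm st sy])
      show "i < ?K \<Longrightarrow> rhead M ?z (Suc t') i + 1 = rhead M ?z t' i + int (v_move M i (v t'))" for i
        by (rule v_next_run[OF tm st sy])
    qed
    have st: "rstate M ?z t = v_state (v t) \<and> (\<forall>i<?K. rhead M ?z t i = int (v_head i (v t)) - int T)"
    proof (cases t)
      case 0
      then show ?thesis using adm[of 0] time[of 0] run_start(1)[OF tm, of 0 ?z] run_start(2)[OF tm, of _ ?z] K
          by (auto simp: admissible_def)
    next
      case (Suc s)
      then have s: "s < t" "s < T" "t \<le> T + 1" using less.prems by simp_all
      have c: "v_state (v t) = fst (v_next M (v s))" "\<And>i. i < ?K \<Longrightarrow> v_head i (v t) + 1 = v_head i (v s) + v_move M i (v s)"
        using comp[OF s(1,3)] time[of s] time[of t] s Suc by (auto simp: compatible_def)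
      have "rhead M ?z t i = int (v_head i (v t)) - int T" if "i < ?K" for i
        using c(2)[OF that] nx(3)[OF s(1) that] less.IH[OF s(1)] s that Suc by fastforce
      then show ?thesis using c(1) nx(1)[OF s(1)] Suc by simp
    qed
    have "rcell M ?z t i (rhead M ?z t i) = v_sym M i (v t)" if "i < ?K" for i
    proof -
      have "rcell M ?z t i (int (v_head i (v t)) - int T) = v_sym M i (v t)"
        by (rule memory) (use less.prems less.IH nx(2) that in auto)
      then show ?thesis using st that by simp
    qed
    with st show ?case by blast
  qed
  have "rcell M ?z (T + 1) 1 (int (v_head 1 (v (T + 1))) - int T) = v_sym M 1 (v (T + 1))"
  proof (rule memory)
    fix t' assume "t' < T + 1"
    then have t': "t' \<le> T" by simp
    have st: "v_state (v t') = rstate M ?z t'"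
      and sy: "\<And>i. i < ?K \<Longrightarrow> v_sym M i (v t') = rcell M ?z t' i (rhead M ?z t' i)"
      using main[OF t'] by metis+
    have "rcell M ?z (Suc t') 1 = (rcell M ?z t' 1)(rhead M ?z t' 1 := v_write M 1 (v t'))"
      by (rule v_next_run[OF tm st sy]) (use K in simp_all)
    then show "rhead M ?z t' 1 = int (v_head 1 (v t')) - int T \<and>
        rcell M ?z (Suc t') 1 = (rcell M ?z t' 1)(rhead M ?z t' 1 := v_write M 1 (v t'))"
      using main[OF t'] K by simp
  qed (use K in simp_all)
  moreover have "v_head 1 (v (T + 1)) = T" "v_sym M 1 (v (T + 1)) = 2"
    using adm[of "T + 1"] time[of "T + 1"] K by (auto simp: admissible_def)
  ultimately have "rcell M ?z (T + 1) 1 0 = 2" by simp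
  then show ?thesis using \<open>L \<le> m\<close> lu by blast
qed

text \<open>\<open>B\<close> exceeds every entry of a record: shifted heads reach 2 * T, times and
  links T + 1, and the other entries are a certificate length, a state or a symbol.\<close>

lemma history_complete:
  assumes tm: "turing_machine M" and u: "length u \<le> m"
    and out: "rcell M (d @ u) (T + 1) 1 0 = 2"
    and B: "2 * T + m + num_states M + num_symbols M + 3 \<le> B"
  shows "\<exists>v. bounded_history M T m d B v"
proof -
  let ?K = "num_tapes M" and ?z = "d @ u"
  have K: "2 \<le> ?K" using tm unfolding turing_machine_def by blast
  \<comment> \<open>The recorded position; at time T + 1 it is cell 0, where the output is
    read.\<close>
  define P where "P t i = (if t \<le> T then rhead M ?z t i else 0)" for t i
  define link where "link t i = (if \<exists>t'<t. P t' i = P t i then Suc (Max {t'. t' < t \<and> P t' i = P t i}) else 0)" for t i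
  define v where "v t = [t, length u, rstate M ?z t] @ map (\<lambda>i. nat (P t i + int T)) [0..<?K] @
    map (\<lambda>i. rcell M ?z t i (P t i)) [0..<?K] @ map (link t) [0..<?K]" for t
  have P: "\<bar>P t i\<bar> \<le> int T" if "i < ?K" for t i
    using rhead_bound[OF tm that, of ?z t] by (auto simp: P_def)
  have Pnat: "int (nat (P t i + int T)) = P t i + int T" if "i < ?K" for t i
    using P[OF that, of t] by simp
  have Peq: "nat (P t i + int T) = nat (P t' i + int T) \<longleftrightarrow> P t i = P t' i" if "i < ?K" for t t' i
    using Pnat[OF that, of t] Pnat[OF that, of t'] by linarith
  have len: "length (v t) = 3 + 3 * ?K" for t by (simp add: v_def)
  have acc: "v_time (v t) = t" "v_len (v t) = length u" "v_state (v t) = rstate M ?z t" for t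
    by (simp_all add: v_time_def v_len_def v_state_def v_def entry_def numeral_2_eq_2)
  have acc_i: "v_head i (v t) = nat (P t i + int T)" "v_sym M i (v t) = rcell M ?z t i (P t i)" "v_link M i (v t) = link t i"
    if "i < ?K" for t i
    using that by (simp_all add: v_head_def v_sym_def v_link_def entry_nth len) (simp_all add: v_def nth_append)
  have link_le: "link t i \<le> t" for t i
  proof (cases "\<exists>t'<t. P t' i = P t i")
    case True
    then have "Max {t'. t' < t \<and> P t' i = P t i} \<in> {t'. t' < t \<and> P t' i = P t i}" by (intro Max_in) auto
    then have "Max {t'. t' < t \<and> P t' i = P t i} < t" by blast
    then show ?thesis using True by (simp only: link_def if_True Suc_le_eq)
  next
    case False
    then show ?thesis by (simp only: link_def if_False)
  qed
  have link_ge: "Suc t \<le> link t' i" if "t < t'" "P t i = P t' i" for t t' i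
    using that by (auto simp: link_def intro!: Max_ge)
  have link_eq: "P t i = P t' i" if "link t' i = Suc t" for t t' i
  proof -
    have ex: "\<exists>s<t'. P s i = P t' i" using that by (auto simp: link_def split: if_splits)
    then have "Max {s. s < t' \<and> P s i = P t' i} \<in> {s. s < t' \<and> P s i = P t' i}" by (intro Max_in) auto
    then show ?thesis using that ex by (simp add: link_def)
  qed
  have still: "rcell M ?z t' i (P t' i) = rcell M ?z (link t' i) i (P t' i)" if "i < ?K" "t' \<le> T + 1" for i t'
  proof (rule rcell_unvisited[OF tm that(1) link_le])
    fix t assume t: "link t' i \<le> t" "t < t'"
    then have "P t i \<noteq> P t' i" using link_ge[of t t' i] by auto
    moreover have "P t i = rhead M ?z t i" using t that by (simp add: P_def)
    ultimately show "rhead M ?z t i \<noteq> P t' i" by simp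
  qed
  have scan: "v_sym M i (v t) = rcell M ?z t i (rhead M ?z t i)" if "i < ?K" "t \<le> T" for i t
    using acc_i[OF that(1)] that by (simp add: P_def)
  have adm: "admissible M T m d (v t)" if t: "t \<le> T + 1" for t
    unfolding admissible_def acc
  proof (intro conjI allI impI)
    show "t \<le> T + 1" "length u \<le> m" using t u by simp_all
    show "rstate M ?z t = 0" if "t = 0" using that run_start(1)[OF tm, of 0] K by simp
    show "v_sym M 1 (v t) = 2" if "t = T + 1" using that acc_i(2)[of 1] K out by (simp add: P_def)
    fix i assume i: "i < ?K"
    show "v_sym M i (v t) < num_symbols M"
      using run_valid[OF tm, of ?z t] i acc_i[OF i] by (simp add: valid_tapes_def rcell_def)
    show "v_link M i (v t) \<le> t" using acc_i[OF i] link_le by simp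
    show "v_head i (v t) = T" if "t = 0" using that acc_i[OF i] run_start(2)[OF tm i] by (simp add: P_def)
    show "v_head i (v t) = T" if "t = T + 1" using that acc_i[OF i] by (simp add: P_def)
    assume "v_link M i (v t) = 0"
    then have "rcell M ?z t i (P t i) = rcell M ?z 0 i (P t i)" using still[OF i t] acc_i[OF i] by simp
    then have sym: "v_sym M i (v t) = (if i = 0 then contents ?z else contents []) (P t i)"
      using acc_i[OF i] run_start(3)[OF tm i] by simp
    have h: "int (v_head i (v t)) = P t i + int T" using acc_i[OF i] Pnat[OF i] by simp
    show "initial_ok M T d i (v t)"
    proof (cases "i = 0 \<and> 0 \<le> P t i \<and> P t i < int (length ?z)")
      case True
      then have "v_head i (v t) - T = nat (P t i)" "T \<le> v_head i (v t)" using h by linarith+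
      then show ?thesis using True h sym unfolding initial_ok_def acc
        by (auto simp: contents_def bit_symbol_def nth_append entry_nth split: if_splits)
    next
      case False
      then have "v_sym M i (v t) = 0" using sym by (auto simp: contents_def)
      moreover have "\<not> (i = 0 \<and> T \<le> v_head i (v t) \<and> v_head i (v t) < T + length d + length u)"
        using False h by (cases "i = 0") auto
      ultimately show ?thesis unfolding initial_ok_def acc by auto
    qed
  qed
  have comp: "compatible M T (v t) (v t')" if t: "t < t'" "t' \<le> T + 1" for t t'
    unfolding compatible_def acc
  proof (intro conjI allI impI)
    have tT: "t \<le> T" using t by simp
    note nx = v_next_run[OF tm acc(3)[of t] scan[OF _ tT]]
    show "rstate M ?z t' = fst (v_next M (v t))" if "t' = t + 1" using nx(1) that by simp
    fix i assume i: "i < ?K"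
    show "v_head i (v t') + 1 = v_head i (v t) + v_move M i (v t)" if "t' = t + 1" "t < T"
    proof -
      have "int (v_head i (v t')) = rhead M ?z (Suc t) i + int T" "int (v_head i (v t)) = rhead M ?z t i + int T"
        unfolding acc_i(1)[OF i] Pnat[OF i] using that by (simp_all add: P_def)
      then show ?thesis using nx(3)[OF _ i] by simp
    qed
    show "v_head i (v t) = v_head i (v t')" if "v_link M i (v t') = t + 1"
      using that link_eq[of t' i t] by (simp add: acc_i[OF i])
    show "v_head i (v t) \<noteq> v_head i (v t')" if "v_link M i (v t') < t + 1"
      using that link_ge[of t t' i] t by (auto simp: acc_i[OF i] Peq[OF i])
    assume l: "v_link M i (v t') = t + 1"
    then have "link t' i = Suc t" by (simp add: acc_i[OF i])
    then have "rcell M ?z t' i (P t' i) = rcell M ?z (Suc t) i (P t' i)" "P t' i = P t i"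
      using still[OF i t(2)] link_eq[of t' i t] by simp_all
    moreover have "P t i = rhead M ?z t i" using tT by (simp add: P_def)
    ultimately show "v_sym M i (v t') = v_write M i (v t)" using nx(2)[OF _ i] by (simp add: acc_i[OF i])
  qed simp
  have "set (v t) \<subseteq> {..<B}" if t: "t \<le> T + 1" for t
  proof -
    have a: "t < B" "length u < B" using t u B by simp_all
    have b: "rstate M ?z t < B" using run_valid[OF tm, of ?z t] B by simp
    have c: "nat (P t i + int T) < B" if "i < ?K" for i using P[OF that, of t] B by linarith
    have e: "rcell M ?z t i (P t i) < B" if "i < ?K" for i
      using run_valid[OF tm, of ?z t] that B unfolding valid_tapes_def rcell_def by (meson add_leE le_trans less_le_trans)
    have f: "link t i < B" for i using link_le[of t i] a by simp
    show ?thesis using a b c e f by (auto simp: v_def)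
  qed
  moreover have "history M T m d v" unfolding history_def using adm comp acc(1) by simp
  ultimately show ?thesis using len unfolding bounded_history_def by (intro exI[of _ v]) simp
qed

text \<open>Times in an independent set are distinct and at most T + 1, so a set of size T + 2
  contains exactly one record for each time.\<close>

lemma independent_set_history:
  fixes M :: machine and B :: nat
  defines "Vs \<equiv> List.n_lists (3 + 3 * num_tapes M) [0..<B]"
  shows "(\<exists>I\<subseteq>{..<length Vs}. T + 2 \<le> card I \<and>
      independent_set (\<lambda>a b. conflict M T m d (entry [] Vs a) (entry [] Vs b)) I) \<longleftrightarrow>
    (\<exists>v. bounded_history M T m d B v)"
proof
  assume "\<exists>I\<subseteq>{..<length Vs}. T + 2 \<le> card I \<and>
      independent_set (\<lambda>a b. conflict M T m d (entry [] Vs a) (entry [] Vs b)) I"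
  then obtain I where I: "I \<subseteq> {..<length Vs}" "T + 2 \<le> card I"
    and ind: "\<And>a b. a \<in> I \<Longrightarrow> b \<in> I \<Longrightarrow> a \<noteq> b \<Longrightarrow> \<not> conflict M T m d (Vs ! a) (Vs ! b)"
    unfolding independent_set_def by (metis entry_nth lessThan_iff subsetD)
  \<comment> \<open>Only pairs of different vertices are tested, so admissibility needs a partner;
    there is one because T + 2 is at least 2.\<close>
  have adm: "admissible M T m d (Vs ! a)" if "a \<in> I" for a
  proof -
    have "\<not> I \<subseteq> {a}" using I(2) card_mono[of "{a}" I] by auto
    then obtain b where "b \<in> I" "b \<noteq> a" by blast
    then show ?thesis using ind[OF that] unfolding conflict_def by blast
  qed
  let ?f = "\<lambda>a. v_time (Vs ! a)"
  have inj: "inj_on ?f I" using ind unfolding inj_on_def conflict_def by blast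
  have sub: "?f ` I \<subseteq> {..T + 1}" using adm by (auto simp: admissible_def)
  have "card (?f ` I) = card {..T + 1}"
    using card_image[OF inj] I(2) card_mono[OF _ sub] by simp
  then have img: "?f ` I = {..T + 1}" using sub by (intro card_subset_eq) auto
  then have "\<forall>t\<in>{..T + 1}. \<exists>a. a \<in> I \<and> ?f a = t" by (metis (no_types, lifting) image_iff)
  then obtain a where a: "\<And>t. t \<le> T + 1 \<Longrightarrow> a t \<in> I \<and> v_time (Vs ! a t) = t" by (metis atMost_iff)
  have "history M T m d (\<lambda>t. Vs ! a t)"
    unfolding history_def
  proof (intro conjI allI impI)
    fix t t' assume t: "t' \<le> T + 1" "t < t'"
    then have "a t \<noteq> a t'" using a[of t] a[of t'] by auto
    then have "\<not> conflict M T m d (Vs ! a t) (Vs ! a t')" using a[of t] a[of t'] t ind by simp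
    then show "compatible M T (Vs ! a t) (Vs ! a t')" using a[of t] a[of t'] t by (simp add: conflict_def)
  qed (use a adm in blast)+
  moreover have "length (Vs ! a t) = 3 + 3 * num_tapes M \<and> set (Vs ! a t) \<subseteq> {..<B}" if "t \<le> T + 1" for t
  proof -
    have "Vs ! a t \<in> set Vs" using a[OF that] I(1) by auto
    then show ?thesis by (auto simp: Vs_def set_n_lists)
  qed
  ultimately show "\<exists>v. bounded_history M T m d B v"
    unfolding bounded_history_def by blast
next
  assume "\<exists>v. bounded_history M T m d B v"
  then obtain v where h: "history M T m d v"
    and v: "\<And>t. t \<le> T + 1 \<Longrightarrow> length (v t) = 3 + 3 * num_tapes M \<and> set (v t) \<subseteq> {..<B}"
    unfolding bounded_history_def by blast
  have "v t \<in> set Vs" if "t \<le> T + 1" for t using v[OF that] by (auto simp: Vs_def set_n_lists)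
  then have "\<forall>t. \<exists>a. t \<le> T + 1 \<longrightarrow> a < length Vs \<and> Vs ! a = v t" by (metis in_set_conv_nth)
  then obtain a where a: "\<And>t. t \<le> T + 1 \<Longrightarrow> a t < length Vs \<and> Vs ! a t = v t" by metis
  let ?I = "a ` {..T + 1}"
  have "inj_on a {..T + 1}"
  proof (rule inj_onI)
    fix t t' assume t: "t \<in> {..T + 1}" "t' \<in> {..T + 1}" "a t = a t'"
    then have "v t = v t'" using a[of t] a[of t'] by simp
    then show "t = t'" using h t unfolding history_def by (metis atMost_iff)
  qed
  then have "card ?I = T + 2" by (simp add: card_image)
  moreover have "?I \<subseteq> {..<length Vs}" using a by auto
  moreover have "independent_set (\<lambda>a b. conflict M T m d (entry [] Vs a) (entry [] Vs b)) ?I"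
    unfolding independent_set_def
  proof (intro ballI impI)
    fix x y assume xy: "x \<in> ?I" "y \<in> ?I" "x \<noteq> y"
    then obtain t t' where t: "t \<le> T + 1" "x = a t" "t' \<le> T + 1" "y = a t'" by auto
    then have "t \<noteq> t'" using xy by auto
    then have "\<not> conflict M T m d (v t) (v t')"
      using h t unfolding history_def conflict_def by (metis nat_neq_iff)
    then show "\<not> conflict M T m d (entry [] Vs x) (entry [] Vs y)" using a t by (simp add: entry_nth)
  qed
  ultimately show "\<exists>I\<subseteq>{..<length Vs}. T + 2 \<le> card I \<and>
      independent_set (\<lambda>a b. conflict M T m d (entry [] Vs a) (entry [] Vs b)) I"
    by (intro exI[of _ ?I]) simp
qed

section \<open>Computing the reduction\<close>

lemma pf_conflict:
  assumes "polyfun T" "polyfun m" "polyfun d" "polyfun v" "polyfun w"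
  shows "polyfun (\<lambda>x. conflict M (T x) (m x) (d x) (v x) (w x))"
proof -
  have "polyfun (\<lambda>p. conflict M (fst p) (fst (snd p)) (fst (snd (snd p))) (fst (snd (snd (snd p)))) (snd (snd (snd (snd p)))))"
    unfolding conflict_def admissible_def compatible_def initial_ok_def v_write_def v_move_def v_next_def
      v_time_def v_len_def v_state_def v_head_def v_sym_def v_link_def
    by (intro pf)
  from pf_comp[OF this, of "\<lambda>x. (T x, m x, d x, v x, w x)"] show ?thesis
    using assms by (simp add: pf)
qed

lemma pf_encode_graph_matrix:
  assumes N: "polyfun N" and k: "polyfun k" and E: "polyfun (\<lambda>p. E (fst p) (fst (snd p)) (snd (snd p)))"
  shows "polyfun (\<lambda>x. encode_instance (graph_matrix (N x) (E x)) (k x))"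
proof -
  have eq: "mat_to_list (graph_matrix n e) = map (\<lambda>i. map (\<lambda>j. graph_cell n e i j) [0..<3 * n]) [0..<n * (n + 2)]" for n e
    by (simp add: mat_to_list_def graph_matrix_def)
  have dims: "dim_row (graph_matrix n e) = n * (n + 2)" "dim_col (graph_matrix n e) = 3 * n" for n e
    by (simp_all add: graph_matrix_def)
  have E': "polyfun f \<Longrightarrow> polyfun g \<Longrightarrow> polyfun h \<Longrightarrow> polyfun (\<lambda>x. E (f x) (g x) (h x))" for f :: "'d :: encodable \<Rightarrow> _" and g h
    using pf_comp[OF E, of "\<lambda>x. (f x, g x, h x)"] by (simp add: pf)
  show ?thesis
    unfolding encode_instance_def eq dims graph_cell_def incident_def
    by (intro pf N k E' pf_comp[OF N])
qed

lemma SC1P_deletion_NP_hard: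
  assumes "in_NP L"
  shows "polytime_reducible L SC1P_deletion_language"
proof -
  obtain V q where V: "polytime_decidable V"
    and L: "\<And>x. x \<in> L \<longleftrightarrow> (\<exists>u. length u \<le> poly q (length x) \<and> pair_code x u \<in> V)"
    using assms unfolding in_NP_def by blast
  obtain M p where tm: "turing_machine M"
    and M: "\<And>z. \<exists>t\<le>poly p (length z). halts_with_output M z t [z \<in> V]"
    using V unfolding polytime_decidable_def polytime_computable_def by blast
  define m where "m x = poly q (length x)" for x :: "bool list"
  \<comment> \<open>The time bound is taken at the greatest length of an input to the verifier and
    so holds for all certificates. A halted machine keeps its output, which can therefore be read at
    time T + 1.\<close>
  define T where "T x = poly p (length (delimit x) + m x)" for x
  define B where "B x = 2 * T x + m x + num_states M + num_symbols M + 3" for x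
  \<comment> \<open>The exponent depends only on the machine, so the number of vertices is
    polynomial in \<open>B x\<close>.\<close>
  define Vs where "Vs x = List.n_lists (3 + 3 * num_tapes M) [0..<B x]" for x
  define E where "E x a b = conflict M (T x) (m x) (delimit x) (entry [] (Vs x) a) (entry [] (Vs x) b)" for x a b
  define f where "f x = encode_instance (graph_matrix (length (Vs x)) (E x)) (length (Vs x) - (T x + 2))" for x
  have "x \<in> L \<longleftrightarrow> f x \<in> SC1P_deletion_language" for x
  proof -
    have V_iff: "pair_code x u \<in> V \<longleftrightarrow> rcell M (delimit x @ u) (T x + 1) 1 0 = 2" if "length u \<le> m x" for u
    proof -
      let ?z = "delimit x @ u"
      obtain t where t: "t \<le> poly p (length ?z)" "halts_with_output M ?z t [?z \<in> V]" using M by blast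
      have "t \<le> T x"
        using t(1) that poly_mono_nat[of "length ?z" "length (delimit x) + m x" p] by (simp add: T_def)
      have "rstate M ?z t = num_states M" "rcell M ?z t 1 = contents [?z \<in> V]"
        using t(2) by (auto simp: halts_with_output_def rstate_def rcell_def run_def split: prod.splits)
      then have "rcell M ?z (T x + 1) 1 = contents [?z \<in> V]"
        using run_halted[of M ?z t "T x + 1"] \<open>t \<le> T x\<close> by (simp add: rcell_def)
      then show ?thesis by (simp add: pair_code_def contents_def bit_symbol_def)
    qed
    have hist: "(\<exists>v. bounded_history M (T x) (m x) (delimit x) (B x) v) \<longleftrightarrow> x \<in> L"
    proof
      assume "x \<in> L"
      then obtain u where "length u \<le> m x" "pair_code x u \<in> V" using L by (auto simp: m_def)
      then show "\<exists>v. bounded_history M (T x) (m x) (delimit x) (B x) v"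
        using V_iff by (intro history_complete[OF tm]) (simp_all add: B_def)
    next
      assume "\<exists>v. bounded_history M (T x) (m x) (delimit x) (B x) v"
      then obtain u where "length u \<le> m x" "rcell M (delimit x @ u) (T x + 1) 1 0 = 2"
        using history_sound[OF tm] unfolding bounded_history_def by blast
      then show "x \<in> L" using V_iff L by (auto simp: m_def)
    qed
    \<comment> \<open>There are at least T + 2 vertices, so the budget, a difference of natural
      numbers, is not truncated.\<close>
    have "B x ^ 1 \<le> B x ^ (3 + 3 * num_tapes M)" by (rule power_increasing) (simp_all add: B_def)
    then have "T x + 2 \<le> length (Vs x)" by (simp add: Vs_def length_n_lists B_def)
    then have "SC1P_deletion (graph_matrix (length (Vs x)) (E x)) (length (Vs x) - (T x + 2)) \<longleftrightarrow>
        (\<exists>I\<subseteq>{..<length (Vs x)}. T x + 2 \<le> card I \<and> independent_set (E x) I)"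
      by (intro SC1P_deletion_graph_matrix) linarith+
    also have "\<dots> \<longleftrightarrow> x \<in> L"
      using independent_set_history[of M "B x" "T x" "m x" "delimit x"] hist
      unfolding E_def[abs_def] Vs_def by (simp add: B_def)
    finally show ?thesis
      unfolding f_def SC1P_deletion_language_def by (auto simp: encode_instance_inject)
  qed
  moreover have "polytime_computable f"
  proof (rule polyfun_polytime_computable)
    have m: "polyfun m" unfolding m_def by (intro pf)
    have T: "polyfun T" unfolding T_def by (intro pf m)
    have B: "polyfun B" unfolding B_def by (intro pf m T)
    have Vs: "polyfun Vs" unfolding Vs_def by (intro pf B)
    show "polyfun f"
      unfolding f_def E_def
      by (intro pf_encode_graph_matrix pf pf_conflict T Vs
          pf_comp[OF T] pf_comp[OF m] pf_comp[OF Vs])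
  qed
  ultimately show ?thesis unfolding polytime_reducible_def by blast
qed

theorem theorem6:
  shows "NP_complete SC1P_deletion_language"
  unfolding NP_complete_def using SC1P_deletion_in_NP SC1P_deletion_NP_hard by blast

end
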